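(* Let $X$ be a semi-equivelar map on the surface of Euler characteristic $-1$. Then $X$ is of one of the following types: $[3^1,4^1,3^1,4^2]$, $[3^5,4^1]$, $[3^1,4^1,8^1,4^1]$, $[4^1,6^1,16^1]$, $[6^2,8^1]$, $[4^3,5^1]$, $[6^2,7^1]$, $[3^1,4^1,7^1,4^1]$, $[4^1,6^1,14^1]$ or $[4^1,8^1,10^1]$.
   Context: A map is a finite connected 2-dimensional cell complex whose underlying space is a closed surface (equivalently, a cellular embedding of a finite connected simple graph in a closed surface). All maps are polyhedral: every face is a closed disc bounded by a cycle of length at least $3$, every vertex has degree at least $3$, and two distinct faces intersect in the empty set, a single vertex or a single edge. For a vertex $u$, the faces containing $u$, taken in their cyclic order around $u$, form the face-cycle $C_u$. A map is semi-equivelar of type $[p_1^{n_1},\dots,p_k^{n_k}]$ (with $p_i\ge 3$, $n_i\ge 1$, and $p_i\ne p_{i+1}$, indices mod $k$) if for every vertex $u$ the face-cycle $C_u$ consists of $n_1$ consecutive $p_1$-gons, followed by $n_2$ consecutive $p_2$-gons, ..., followed by $n_k$ consecutive $p_k$-gons. Types are considered up to cyclic rotation and reversal. A map is semi-equivelar if it is semi-equivelar of some type. The surface of Euler characteristic $-1$ is the closed non-orientable surface of Euler genus $3$. *)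

theory Defs
  imports "HOL-Analysis.Analysis"
begin

text \<open>
  A closed surface: a nonempty compact connected Hausdorff space in which every point has an
  open neighbourhood homeomorphic to the plane, here taken to be the complex plane. (Second
  countability follows from compactness.)
\<close>

definition closed_surface :: "'a topology \<Rightarrow> bool" where
  "closed_surface S \<longleftrightarrow>
     topspace S \<noteq> {} \<and> compact_space S \<and> connected_space S \<and> Hausdorff_space S \<and>
     (\<forall>x \<in> topspace S. \<exists>U. openin S U \<and> x \<in> U \<and>
        subtopology S U homeomorphic_space (euclidean :: complex topology))"

text \<open>
  Edges and faces are given as closed cells, i.e. as sets of points of the underlying space.
  The ends of an edge \<open>e\<close> are recovered as \<open>e \<inter> verts X\<close>.
\<close>

record 'a cell_map =
  surface :: "'a topology"
  verts :: "'a set"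
  edges :: "'a set set"
  faces :: "'a set set"

definition is_edge_cell :: "'a cell_map \<Rightarrow> 'a set \<Rightarrow> bool" where
  "is_edge_cell X e \<longleftrightarrow>
     (\<exists>h. embedding_map (top_of_set {0..1::real}) (surface X) h \<and>
          e = h ` {0..1} \<and> e \<inter> verts X = {h 0, h 1})"

text \<open>
  A cycle of the graph, as the list of its vertices together with the list of its edges: the
  \<open>i\<close>-th edge joins the \<open>i\<close>-th vertex to the next one, cyclically.
\<close>

definition graph_cycle :: "'a cell_map \<Rightarrow> 'a list \<Rightarrow> 'a set list \<Rightarrow> bool" where
  "graph_cycle X vs es \<longleftrightarrow>
     3 \<le> length vs \<and> length es = length vs \<and> distinct vs \<and>
     (\<forall>i < length vs. es ! i \<in> edges X \<and>
        es ! i \<inter> verts X = {vs ! i, vs ! (Suc i mod length vs)})"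

text \<open>
  A face is a closed disc whose boundary circle is the point set of a cycle of length at
  least 3 and whose interior contains no point of the graph.
\<close>

definition is_face_cell :: "'a cell_map \<Rightarrow> 'a set \<Rightarrow> bool" where
  "is_face_cell X f \<longleftrightarrow>
     (\<exists>h. embedding_map (top_of_set (cball (0::complex) 1)) (surface X) h \<and>
          f = h ` cball 0 1 \<and>
          (\<exists>vs es. graph_cycle X vs es \<and> h ` sphere 0 1 = \<Union> (set es)) \<and>
          h ` ball 0 1 \<inter> (verts X \<union> \<Union> (edges X)) = {})"

text \<open>
  A finite 2-dimensional cell complex, all of whose closed cells are embedded, with underlying
  space \<open>surface X\<close>: the cells cover the space and distinct cells have disjoint interiors.
\<close>

definition cell_complex :: "'a cell_map \<Rightarrow> bool" where
  "cell_complex X \<longleftrightarrow>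
     finite (verts X) \<and> finite (edges X) \<and> finite (faces X) \<and>
     verts X \<subseteq> topspace (surface X) \<and>
     (\<forall>e \<in> edges X. is_edge_cell X e) \<and>
     (\<forall>f \<in> faces X. is_face_cell X f) \<and>
     topspace (surface X) = verts X \<union> \<Union> (edges X) \<union> \<Union> (faces X) \<and>
     (\<forall>e \<in> edges X. \<forall>e' \<in> edges X. e \<noteq> e' \<longrightarrow> e \<inter> e' \<subseteq> verts X) \<and>
     (\<forall>f \<in> faces X. \<forall>f' \<in> faces X. f \<noteq> f' \<longrightarrow> f \<inter> f' \<subseteq> \<Union> (edges X))"

text \<open>
  A loop is excluded by \<^const>\<open>is_edge_cell\<close>, so the graph is simple as soon as no two edges
  have the same ends.
\<close>

definition polyhedral_map :: "'a cell_map \<Rightarrow> bool" where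
  "polyhedral_map X \<longleftrightarrow>
     closed_surface (surface X) \<and> cell_complex X \<and>
     (\<forall>e \<in> edges X. \<forall>e' \<in> edges X. e \<inter> verts X = e' \<inter> verts X \<longrightarrow> e = e') \<and>
     (\<forall>u \<in> verts X. 3 \<le> card {e \<in> edges X. u \<in> e}) \<and>
     (\<forall>f \<in> faces X. \<forall>f' \<in> faces X. f \<noteq> f' \<longrightarrow>
        f \<inter> f' = {} \<or> (\<exists>u \<in> verts X. f \<inter> f' = {u}) \<or> f \<inter> f' \<in> edges X)"

definition euler_char :: "'a cell_map \<Rightarrow> int" where
  "euler_char X = int (card (verts X)) - int (card (edges X)) + int (card (faces X))"

text \<open>The number \<open>p\<close> such that the face \<open>f\<close> is a \<open>p\<close>-gon.\<close>

definition gonality :: "'a cell_map \<Rightarrow> 'a set \<Rightarrow> nat" where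
  "gonality X f = card (f \<inter> verts X)"

text \<open>
  The face-cycle of \<open>u\<close>, written as a list from an arbitrary starting face in either direction.
  Going around \<open>u\<close>, one passes from a face to the next one across an edge at \<open>u\<close>. As the number
  of faces at \<open>u\<close> is at least 3 in a polyhedral map, this determines the list up to rotation
  and reversal.
\<close>

definition face_cycle :: "'a cell_map \<Rightarrow> 'a \<Rightarrow> 'a set list \<Rightarrow> bool" where
  "face_cycle X u fs \<longleftrightarrow>
     distinct fs \<and> set fs = {f \<in> faces X. u \<in> f} \<and>
     (\<forall>i < length fs. \<exists>e \<in> edges X. u \<in> e \<and>
        e \<subseteq> fs ! i \<and> e \<subseteq> fs ! (Suc i mod length fs))"

text \<open>
  The type \<open>[p\<^sub>1^n\<^sub>1, \<dots>, p\<^sub>k^n\<^sub>k]\<close> is the list of the pairs \<open>(p\<^sub>i, n\<^sub>i)\<close>. The condition that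
  cyclically consecutive \<open>p\<^sub>i\<close> differ is void for \<open>k = 1\<close>.
\<close>

type_synonym vertex_type = "(nat \<times> nat) list"

definition valid_type :: "vertex_type \<Rightarrow> bool" where
  "valid_type t \<longleftrightarrow>
     t \<noteq> [] \<and> (\<forall>(p, n) \<in> set t. 3 \<le> p \<and> 1 \<le> n) \<and>
     (2 \<le> length t \<longrightarrow>
        (\<forall>i < length t. fst (t ! i) \<noteq> fst (t ! (Suc i mod length t))))"

definition expand_type :: "vertex_type \<Rightarrow> nat list" where
  "expand_type t = concat (map (\<lambda>(p, n). replicate n p) t)"

text \<open>
  Since the face-cycle may be read from any face and in either direction, being of a type is
  invariant under rotation and reversal of the type.
\<close>

definition semi_equivelar_of_type :: "'a cell_map \<Rightarrow> vertex_type \<Rightarrow> bool" where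
  "semi_equivelar_of_type X t \<longleftrightarrow>
     valid_type t \<and>
     (\<forall>u \<in> verts X. \<exists>fs. face_cycle X u fs \<and> map (gonality X) fs = expand_type t)"

definition semi_equivelar :: "'a cell_map \<Rightarrow> bool" where
  "semi_equivelar X \<longleftrightarrow> (\<exists>t. semi_equivelar_of_type X t)"

end

theory Submission
  imports Defs "HOL-Combinatorics.Orbits" "HOL-Combinatorics.Cycles"
begin

text \<open>Invariance of domain shows that every edge lies on exactly two faces, so that only the incidences
  of vertices, edges and faces matter. If the vertex figure is \<open>p\<^sub>1, \<dots>, p\<^sub>d\<close>, Euler's formula reads
  \<open>d/2 - 1 - (1/p\<^sub>1 + \<dots> + 1/p\<^sub>d) = 1/n\<close> with \<open>n\<close> the number of vertices, and \<open>n\<close> is at least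
  \<open>1 + (p\<^sub>1 - 2) + \<dots> + (p\<^sub>d - 2)\<close> because the faces at a vertex meet in nothing else than the edges at
  that vertex. This leaves finitely many vertex figures. Parity around faces of odd length and a count of the
  \<open>q\<close>-gons that meet a given \<open>p\<close>-gon leave the ten types and \<open>[5,8,8]\<close>, \<open>[3,5,5,5]\<close>, \<open>[3,3,3,3,7]\<close>,
  \<open>[3,3,3,3,8]\<close>, \<open>[3,3,4,3,5]\<close>. In the last three, rotations around faces are permutations of the vertices
  whose signs are incompatible. For \<open>[5,8,8]\<close> each of the four pentagons meets each of the five octagons,
  and the pairs of octagons meeting at its vertices form a 2-regular graph; four such graphs would cover
  \<open>K\<^sub>5\<close> twice without sharing an angle. For \<open>[3,5,5,5]\<close> the nine pentagons are determined by the
  triangles they share an edge with up to few cases, each of which is a small unsatisfiable system of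
  constraints.\<close>

subsection \<open>The two faces at an edge\<close>

text \<open>The signs used for the three chiral figures are Euler's formula in disguise. If
  \<open>\<sigma>\<close>, \<open>\<alpha>\<close> and \<open>\<sigma> \<circ> \<alpha>\<close> have
  c1, c2 and c3 cycles on n vertices, the product of their signs is 1 and also (-1)^(3n - c1 - c2 -
  c3), so c1 + c2 + c3 - n must be even. This number is the Euler characteristic: 6 + 21 + 14 - 42
  for [3,3,3,3,7], 3 + 12 + 8 - 24 for [3,3,3,3,8] and 4 + 10 + 5 - 20 for [3,3,4,3,5], each time
  -1. In other words, a chiral vertex figure would orient the surface, and an orientable closed
  surface has even characteristic. The figures [5,8,8] and [3,5,5,5] are mirror symmetric and orient
  nothing. For [5,8,8] the incidence inequalities between pentagons and octagons and among octagons
  are equalities, so all these adjacencies are forced and a rigid pattern on five octagons remains.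
  For [3,5,5,5] there is slack, so the possible adjacencies of pentagons and triangles have to be
  enumerated.\<close>

lemma closed_surface_chart:
  assumes "closed_surface S" "x \<in> topspace S"
  obtains U \<phi> \<psi> where "openin S U" "x \<in> U"
    "homeomorphic_maps (subtopology S U) (euclidean :: complex topology) \<phi> \<psi>"
proof -
  have "\<exists>U. openin S U \<and> x \<in> U \<and> subtopology S U homeomorphic_space (euclidean :: complex topology)"
    using assms by (simp add: closed_surface_def)
  then show ?thesis unfolding homeomorphic_space_def by (elim exE conjE) (rule that)
qed

text \<open>Openness is local: near each point, \<open>g\<close> composed with the inverse of a
  chart is an injective continuous map on an open set of the plane, where the classical invariance
  of domain applies.\<close>

lemma surface_invariance_of_domain_to_plane:
  fixes g :: "'a \<Rightarrow> complex"
  assumes S: "closed_surface S" and W: "openin S W"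
    and g: "continuous_map (subtopology S W) euclidean g" and inj: "inj_on g W"
  shows "open (g ` W)"
proof (subst open_subopen, rule ballI)
  fix y assume "y \<in> g ` W"
  then obtain x where x: "x \<in> W" "y = g x" by blast
  then have "x \<in> topspace S" using W openin_subset by blast
  then obtain U \<phi> \<psi> where U: "openin S U" "x \<in> U"
    and h: "homeomorphic_maps (subtopology S U) (euclidean :: complex topology) \<phi> \<psi>"
    using closed_surface_chart[OF S] by blast
  have US: "U \<subseteq> topspace S" using U openin_subset by blast
  have \<psi>: "continuous_map euclidean (subtopology S U) \<psi>" "\<And>z. \<phi> (\<psi> z) = z"
    "\<And>x. x \<in> U \<Longrightarrow> \<psi> (\<phi> x) = x"
    using h US by (auto simp: homeomorphic_maps_def)
  have \<psi>U: "\<psi> z \<in> U" for z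
    using \<psi>(1) US by (auto simp: continuous_map_def Pi_iff)
  define D where "D = {z. \<psi> z \<in> W}"
  have "openin euclidean {z \<in> topspace euclidean. \<psi> z \<in> U \<inter> W}"
    by (rule openin_continuous_map_preimage[OF \<psi>(1)])
       (use W in \<open>metis inf_commute openin_subtopology_Int\<close>)
  then have D: "open D" using \<psi>U by (simp add: D_def)
  have "continuous_map (top_of_set D) S \<psi>"
    using \<psi>(1) continuous_map_from_subtopology continuous_map_into_fulltopology by blast
  then have "continuous_map (top_of_set D) (subtopology S W) \<psi>"
    by (auto simp: continuous_map_in_subtopology D_def)
  then have "continuous_map (top_of_set D) euclidean (g \<circ> \<psi>)"
    using g by (rule continuous_map_compose)
  then have c: "continuous_on D (g \<circ> \<psi>)" by simp
  have "inj_on (g \<circ> \<psi>) D"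
    using inj \<psi>(2) by (auto simp: inj_on_def D_def) metis
  then have "open ((g \<circ> \<psi>) ` D)" using invariance_of_domain[OF c D] by blast
  moreover have "y \<in> (g \<circ> \<psi>) ` D"
    using x U \<psi>(3) by (auto simp: D_def image_iff intro!: exI[of _ "\<phi> x"])
  moreover have "(g \<circ> \<psi>) ` D \<subseteq> g ` W" by (auto simp: D_def)
  ultimately show "\<exists>T. open T \<and> y \<in> T \<and> T \<subseteq> g ` W" by blast
qed

text \<open>The converse direction: the chart is composed after \<open>H\<close>, on the part of
  \<open>D\<close> that \<open>H\<close> sends into the chart, and the open image is pulled back
  through the chart.\<close>

lemma plane_invariance_of_domain_to_surface:
  fixes H :: "complex \<Rightarrow> 'a"
  assumes S: "closed_surface S" and D: "open D"
    and H: "continuous_map (top_of_set D) S H" and inj: "inj_on H D"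
  shows "openin S (H ` D)"
proof (subst openin_subopen, rule ballI)
  fix y assume "y \<in> H ` D"
  then obtain x where x: "x \<in> D" "y = H x" by blast
  then have "y \<in> topspace S" using H by (auto simp: continuous_map_def)
  then obtain U \<phi> \<psi> where U: "openin S U" "y \<in> U"
    and h: "homeomorphic_maps (subtopology S U) (euclidean :: complex topology) \<phi> \<psi>"
    using closed_surface_chart[OF S] by blast
  have US: "U \<subseteq> topspace S" using U openin_subset by blast
  have \<phi>: "continuous_map (subtopology S U) euclidean \<phi>"
    "\<And>x. x \<in> U \<Longrightarrow> \<psi> (\<phi> x) = x"
    using h US by (auto simp: homeomorphic_maps_def)
  define D' where "D' = {z \<in> D. H z \<in> U}"
  have "openin (top_of_set D) {z \<in> topspace (top_of_set D). H z \<in> U}"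
    by (rule openin_continuous_map_preimage[OF H U(1)])
  then have D': "open D'" using D by (simp add: D'_def openin_open_eq)
  have "continuous_map (top_of_set D') S H"
    using H by (rule continuous_map_from_subtopology_mono) (auto simp: D'_def)
  then have "continuous_map (top_of_set D') (subtopology S U) H"
    by (auto simp: continuous_map_in_subtopology D'_def)
  then have "continuous_map (top_of_set D') euclidean (\<phi> \<circ> H)"
    using \<phi>(1) by (rule continuous_map_compose)
  then have c: "continuous_on D' (\<phi> \<circ> H)" by simp
  have "inj_on (\<phi> \<circ> H) D'"
    using inj \<phi>(2) by (auto simp: inj_on_def D'_def) metis
  then have o: "open ((\<phi> \<circ> H) ` D')" using invariance_of_domain[OF c D'] by blast
  have "openin (subtopology S U) {y \<in> topspace (subtopology S U). \<phi> y \<in> (\<phi> \<circ> H) ` D'}"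
    by (rule openin_continuous_map_preimage[OF \<phi>(1)]) (use o in simp)
  moreover have "{y \<in> topspace (subtopology S U). \<phi> y \<in> (\<phi> \<circ> H) ` D'} = H ` D'"
    using \<phi>(2) US by (auto simp: D'_def image_iff) metis
  ultimately have "openin S (H ` D')" using openin_open_subtopology[OF U(1)] by simp
  moreover have "y \<in> H ` D'" using x U by (auto simp: D'_def)
  moreover have "H ` D' \<subseteq> H ` D" by (auto simp: D'_def)
  ultimately show "\<exists>T. openin S T \<and> y \<in> T \<and> T \<subseteq> H ` D" by blast
qed

lemma cball_eq_ball_Un_sphere: "cball a r = ball a r \<union> sphere a r"
  by auto

lemma embedding_map_inverse:
  assumes "embedding_map (top_of_set K) S h"
  obtains g where "continuous_map (subtopology S (h ` K)) (top_of_set K) g"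
    "\<forall>z\<in>K. g (h z) = z" "continuous_map (top_of_set K) S h" "inj_on h K"
    "h ` K \<subseteq> topspace S"
proof -
  have 0: "homeomorphic_map (top_of_set K) (subtopology S (h ` K)) h"
    using assms by (simp add: embedding_map_def)
  then obtain g where g: "homeomorphic_maps (top_of_set K) (subtopology S (h ` K)) h g"
    using homeomorphic_map_maps by blast
  have 1: "continuous_map (top_of_set K) S h"
    using g by (auto simp: homeomorphic_maps_def continuous_map_in_subtopology)
  have 2: "inj_on h K" using 0 by (simp add: homeomorphic_eq_everything_map)
  have "h ` K \<subseteq> topspace S" using 1 by (auto simp: continuous_map_def)
  then show ?thesis using that[of g] g 1 2 by (auto simp: homeomorphic_maps_def)
qed

lemma embedding_map_compact_closedin:
  assumes "Hausdorff_space S" "embedding_map (top_of_set K) S h" "compact K"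
  shows "closedin S (h ` K)"
proof -
  have "compactin S (h ` K)"
    using assms embedding_map_inverse[OF assms(2)]
    by (metis compactin_euclidean_iff compactin_subtopology image_compactin subset_refl)
  then show ?thesis using assms(1) compactin_imp_closedin by blast
qed

section \<open>Cells of a map on a closed surface and their neighbourhoods\<close>

locale surface_map =
  fixes X :: "'a cell_map"
  assumes surf: "closed_surface (surface X)" and cell: "cell_complex X"
begin

lemmas cell_simps =
  cell[unfolded cell_complex_def, THEN conjunct1]
  cell[unfolded cell_complex_def, THEN conjunct2, THEN conjunct1]
  cell[unfolded cell_complex_def, THEN conjunct2, THEN conjunct2, THEN conjunct1]
  cell[unfolded cell_complex_def, THEN conjunct2, THEN conjunct2, THEN conjunct2, THEN conjunct1]
  cell[unfolded cell_complex_def, THEN conjunct2, THEN conjunct2, THEN conjunct2, THEN conjunct2, THEN conjunct1]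
  cell[unfolded cell_complex_def, THEN conjunct2, THEN conjunct2, THEN conjunct2, THEN conjunct2, THEN conjunct2, THEN conjunct1]
  cell[unfolded cell_complex_def, THEN conjunct2, THEN conjunct2, THEN conjunct2, THEN conjunct2, THEN conjunct2, THEN conjunct2, THEN conjunct1]
  cell[unfolded cell_complex_def, THEN conjunct2, THEN conjunct2, THEN conjunct2, THEN conjunct2, THEN conjunct2, THEN conjunct2, THEN conjunct2, THEN conjunct1]
  cell[unfolded cell_complex_def, THEN conjunct2, THEN conjunct2, THEN conjunct2, THEN conjunct2, THEN conjunct2, THEN conjunct2, THEN conjunct2, THEN conjunct2]

lemma surface_Hausdorff: "Hausdorff_space (surface X)"
  using surf by (simp add: closed_surface_def)

lemma edge_obtain:
  assumes "e \<in> edges X"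
  obtains h where "embedding_map (top_of_set {0..1::real}) (surface X) h"
    "e = h ` {0..1}" "e \<inter> verts X = {h 0, h 1}" "h 0 \<noteq> h 1"
proof -
  obtain h where h: "embedding_map (top_of_set {0..1::real}) (surface X) h"
    "e = h ` {0..1}" "e \<inter> verts X = {h 0, h 1}"
    using bspec[OF cell_simps(5) assms] unfolding is_edge_cell_def by metis
  have "inj_on h {0..1}" using embedding_map_inverse[OF h(1)] by blast
  then have "h 0 \<noteq> h 1" by (auto dest: inj_onD)
  then show ?thesis using that h by blast
qed

lemma face_obtain:
  assumes "f \<in> faces X"
  obtains h vs es where "embedding_map (top_of_set (cball (0::complex) 1)) (surface X) h"
    "f = h ` cball 0 1" "graph_cycle X vs es" "h ` sphere 0 1 = \<Union> (set es)"
    "h ` ball 0 1 \<inter> (verts X \<union> \<Union> (edges X)) = {}"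
  using bspec[OF cell_simps(6) assms] unfolding is_face_cell_def by (elim exE conjE) (rule that)

lemma edge_closedin: "e \<in> edges X \<Longrightarrow> closedin (surface X) e"
  by (erule edge_obtain) (simp add: embedding_map_compact_closedin[OF surface_Hausdorff])

lemma face_closedin: "f \<in> faces X \<Longrightarrow> closedin (surface X) f"
  by (erule face_obtain) (simp add: embedding_map_compact_closedin[OF surface_Hausdorff])

lemma edges_meet: "e \<in> edges X \<Longrightarrow> e' \<in> edges X \<Longrightarrow> e \<noteq> e' \<Longrightarrow> e \<inter> e' \<subseteq> verts X"
  using cell_simps(8) by blast

lemma faces_meet: "f \<in> faces X \<Longrightarrow> f' \<in> faces X \<Longrightarrow> f \<noteq> f' \<Longrightarrow> f \<inter> f' \<subseteq> \<Union> (edges X)"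
  using cell_simps(9) by blast

lemma edge_inner_point:
  assumes "e \<in> edges X" obtains x where "x \<in> e" "x \<notin> verts X"
proof -
  obtain h where h: "embedding_map (top_of_set {0..1::real}) (surface X) h"
    "e = h ` {0..1}" "e \<inter> verts X = {h 0, h 1}" "h 0 \<noteq> h 1" by (rule edge_obtain[OF assms])
  have "inj_on h {0..1}" using embedding_map_inverse[OF h(1)] by blast
  then have "h (1/2) \<noteq> h 0" "h (1/2) \<noteq> h 1"
    by (auto dest: inj_onD)
  moreover have "h (1/2) \<in> e" using h by auto
  ultimately show ?thesis using that h(3) by blast
qed

text \<open>The open cell of \<open>f\<close> misses the graph, so \<open>x\<close> is on the
  boundary circle and hence on some boundary edge; that edge is \<open>e\<close> because distinct
  edges meet only in vertices.\<close>

lemma cycle_edge_iff: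
  assumes "f \<in> faces X" "f = h ` cball 0 1" "graph_cycle X vs es"
    "h ` sphere 0 1 = \<Union> (set es)" "h ` ball 0 1 \<inter> (verts X \<union> \<Union> (edges X)) = {}"
    and e: "e \<in> edges X" and x: "x \<in> e" "x \<in> f" "x \<notin> verts X"
  shows "e \<in> set es"
proof -
  have "x \<notin> h ` ball 0 1" using assms(5) e x by blast
  then have "x \<in> h ` sphere 0 1"
    using x(2) unfolding assms(2) by (auto simp: cball_eq_ball_Un_sphere)
  then have "x \<in> \<Union> (set es)" by (simp only: assms(4))
  then obtain e' where e': "e' \<in> set es" "x \<in> e'" by (rule UnionE)
  then have "e' \<in> edges X" using assms(3) by (auto simp: graph_cycle_def in_set_conv_nth)
  then have "e' = e" using edges_meet[OF e] e' x by blast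
  then show ?thesis using e' by simp
qed

text \<open>Turns the parametrised disc into incidence data: afterwards the boundary edges of a face
  are recognised by inclusion alone.\<close>

lemma face_cycle_exists:
  assumes f: "f \<in> faces X"
  obtains vs es where "graph_cycle X vs es" "f \<inter> verts X = set vs"
    "{e \<in> edges X. e \<subseteq> f} = set es"
proof -
  obtain h vs es where "embedding_map (top_of_set (cball (0::complex) 1)) (surface X) h"
    and h: "f = h ` cball 0 1" "graph_cycle X vs es" "h ` sphere 0 1 = \<Union> (set es)"
    "h ` ball 0 1 \<inter> (verts X \<union> \<Union> (edges X)) = {}"
    by (rule face_obtain[OF f])
  have es: "set es \<subseteq> edges X" using h(2) by (auto simp: graph_cycle_def in_set_conv_nth)
  have sub: "\<Union> (set es) \<subseteq> f" using h(1,3) by (metis image_mono sphere_cball)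
  have 1: "{e \<in> edges X. e \<subseteq> f} = set es"
  proof
    show "{e \<in> edges X. e \<subseteq> f} \<subseteq> set es"
    proof clarify
      fix e assume e: "e \<in> edges X" "e \<subseteq> f"
      obtain x where "x \<in> e" "x \<notin> verts X" using edge_inner_point[OF e(1)] .
      then show "e \<in> set es" using cycle_edge_iff[OF f h e(1)] e by blast
    qed
    show "set es \<subseteq> {e \<in> edges X. e \<subseteq> f}" using es sub by blast
  qed
  have n: "3 \<le> length vs" "length es = length vs"
    "\<And>i. i < length vs \<Longrightarrow> es ! i \<inter> verts X = {vs ! i, vs ! (Suc i mod length vs)}"
    using h(2) by (auto simp: graph_cycle_def)
  have 2: "f \<inter> verts X = set vs"
  proof
    show "f \<inter> verts X \<subseteq> set vs"
    proof
      fix v assume v: "v \<in> f \<inter> verts X"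
      then have "v \<notin> h ` ball 0 1" using h(4) by blast
      then have "v \<in> h ` sphere 0 1"
        using IntD1[OF v] unfolding h(1) by (auto simp: cball_eq_ball_Un_sphere)
      then obtain i where i: "i < length es" "v \<in> es ! i" using h(3) by (auto simp: in_set_conv_nth)
      then have "v \<in> {vs ! i, vs ! (Suc i mod length vs)}" using n v by auto
      moreover have "Suc i mod length vs < length vs" using n(1) by (intro mod_less_divisor) linarith
      ultimately show "v \<in> set vs" using i n(2) by auto
    qed
    show "set vs \<subseteq> f \<inter> verts X"
    proof
      fix v assume "v \<in> set vs"
      then obtain i where i: "i < length vs" "v = vs ! i" by (auto simp: in_set_conv_nth)
      then have "v \<in> es ! i \<inter> verts X" using n(3) by auto
      moreover have "es ! i \<in> set es" using i n(2) by simp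
      ultimately show "v \<in> f \<inter> verts X" using sub by blast
    qed
  qed
  show ?thesis by (rule that[OF h(2) 2 1])
qed

text \<open>All vertices, all other edges and all faces not containing \<open>e\<close> form a
  finite union of closed sets that avoids \<open>x\<close>; the neighbourhood is its complement. A
  face through \<open>x\<close> contains all of \<open>e\<close> by
  \<open>cycle_edge_iff\<close>.\<close>

lemma edge_point_nbhd:
  assumes e: "e \<in> edges X" and x: "x \<in> e" "x \<notin> verts X"
  obtains W where "openin (surface X) W" "x \<in> W" "W \<inter> verts X = {}"
    "\<forall>e' \<in> edges X. e' \<noteq> e \<longrightarrow> W \<inter> e' = {}"
    "W \<subseteq> e \<union> \<Union> {f \<in> faces X. e \<subseteq> f}"
proof -
  let ?S = "surface X"
  have fin: "finite (verts X)" "finite (edges X)" "finite (faces X)" "verts X \<subseteq> topspace ?S"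
    and cov: "topspace ?S = verts X \<union> \<Union> (edges X) \<union> \<Union> (faces X)"
    using cell_simps by simp_all
  let ?C = "\<Union> (((\<lambda>v. {v}) ` verts X) \<union> (edges X - {e}) \<union> {f \<in> faces X. \<not> e \<subseteq> f})"
  have "closedin ?S ?C"
    using fin edge_closedin face_closedin surface_Hausdorff
    by (intro closedin_Union) (auto simp: closedin_Hausdorff_sing_eq)
  then have o: "openin ?S (topspace ?S - ?C)" by blast
  have xnf: "x \<notin> f" if f: "f \<in> faces X" "\<not> e \<subseteq> f" for f
  proof
    assume "x \<in> f"
    obtain h vs es where "embedding_map (top_of_set (cball (0::complex) 1)) (surface X) h"
      and h: "f = h ` cball 0 1" "graph_cycle X vs es"
      "h ` sphere 0 1 = \<Union> (set es)" "h ` ball 0 1 \<inter> (verts X \<union> \<Union> (edges X)) = {}"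
      by (rule face_obtain[OF f(1)])
    have "e \<in> set es" using cycle_edge_iff[OF f(1) h e x(1) \<open>x \<in> f\<close> x(2)] .
    then have "e \<subseteq> f" using h(1,3) by (metis Sup_upper image_mono sphere_cball subset_trans)
    then show False using f by blast
  qed
  have "x \<notin> ?C" using x edges_meet[OF e] xnf by fastforce
  moreover have "x \<in> topspace ?S" using cov e x by blast
  ultimately have "x \<in> topspace ?S - ?C" by blast
  then show ?thesis
  proof (rule that[OF o])
    show "(topspace ?S - ?C) \<inter> verts X = {}" by auto
    show "\<forall>e' \<in> edges X. e' \<noteq> e \<longrightarrow> (topspace ?S - ?C) \<inter> e' = {}" by auto
    show "topspace ?S - ?C \<subseteq> e \<union> \<Union> {f \<in> faces X. e \<subseteq> f}"
      unfolding cov by auto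
  qed
qed

text \<open>Otherwise an open piece of the surface would lie in an arc, and its injective image in
  the real axis would be open in the plane.\<close>

lemma edge_in_some_face:
  assumes e: "e \<in> edges X" shows "{f \<in> faces X. e \<subseteq> f} \<noteq> {}"
proof
  assume A: "{f \<in> faces X. e \<subseteq> f} = {}"
  obtain x where x: "x \<in> e" "x \<notin> verts X" using edge_inner_point[OF e] .
  obtain W where W: "openin (surface X) W" "x \<in> W" "W \<inter> verts X = {}"
    "\<forall>e' \<in> edges X. e' \<noteq> e \<longrightarrow> W \<inter> e' = {}"
    "W \<subseteq> e \<union> \<Union> {f \<in> faces X. e \<subseteq> f}"
    by (rule edge_point_nbhd[OF e x])
  then have We: "W \<subseteq> e" using A by simp
  obtain h where h: "embedding_map (top_of_set {0..1::real}) (surface X) h" "e = h ` {0..1}"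
    "e \<inter> verts X = {h 0, h 1}" "h 0 \<noteq> h 1" by (rule edge_obtain[OF e])
  obtain g where g: "continuous_map (subtopology (surface X) e) (top_of_set {0..1::real}) g"
    "\<forall>z\<in>{0..1}. g (h z) = z" "continuous_map (top_of_set ({0..1})) (surface X) h"
    "inj_on h ({0..1})" "e \<subseteq> topspace (surface X)"
    by (rule embedding_map_inverse[OF h(1), folded h(2)])
  have "continuous_map (subtopology (surface X) W) euclideanreal g"
    by (rule continuous_map_into_fulltopology[OF continuous_map_from_subtopology_mono[OF g(1) We]])
  then have c: "continuous_map (subtopology (surface X) W) euclidean (complex_of_real \<circ> g)"
    by (rule continuous_map_compose) (simp add: continuous_on_of_real)
  have "inj_on (complex_of_real \<circ> g) W"
    using We h(2) g(2) by (auto simp: inj_on_def subset_iff image_iff) metis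
  then have "open ((complex_of_real \<circ> g) ` W)"
    using surface_invariance_of_domain_to_plane[OF surf W(1) c] by blast
  moreover have "complex_of_real (g x) \<in> (complex_of_real \<circ> g) ` W" using W by auto
  ultimately obtain r where r: "r > 0" "ball (complex_of_real (g x)) r \<subseteq> (complex_of_real \<circ> g) ` W"
    using open_contains_ball by metis
  \<comment> \<open>A point of the ball off the real axis, whereas the image of \<open>W\<close> is
    contained in that axis.\<close>
  have "complex_of_real (g x) + \<i> * of_real (r/2) \<in> ball (complex_of_real (g x)) r"
    using r by (simp add: dist_norm norm_mult)
  then obtain y where "complex_of_real (g x) + \<i> * of_real (r/2) = complex_of_real (g y)"
    using r by auto
  then have "Im (complex_of_real (g x) + \<i> * of_real (r/2)) = 0" by simp
  then show False using r by simp
qed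

text \<open>Otherwise a neighbourhood of an inner point of \<open>e\<close> would correspond to an
  open subset of the closed unit disc, hence of the open disc, although the open cell contains no
  point of the graph.\<close>

lemma edge_not_in_one_face:
  assumes e: "e \<in> edges X" shows "{f \<in> faces X. e \<subseteq> f} \<noteq> {f}"
proof
  assume A: "{f \<in> faces X. e \<subseteq> f} = {f}"
  then have f: "f \<in> faces X" "e \<subseteq> f" by auto
  obtain x where x: "x \<in> e" "x \<notin> verts X" using edge_inner_point[OF e] .
  obtain W where W: "openin (surface X) W" "x \<in> W" "W \<inter> verts X = {}"
    "\<forall>e' \<in> edges X. e' \<noteq> e \<longrightarrow> W \<inter> e' = {}"
    "W \<subseteq> e \<union> \<Union> {f \<in> faces X. e \<subseteq> f}"
    by (rule edge_point_nbhd[OF e x])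
  have Wf: "W \<subseteq> f" using W(5) f(2) unfolding A by blast
  obtain h vs es where h: "embedding_map (top_of_set (cball (0::complex) 1)) (surface X) h" "f = h ` cball 0 1"
     and "graph_cycle X vs es" "h ` sphere 0 1 = \<Union> (set es)"
     and h3: "h ` ball 0 1 \<inter> (verts X \<union> \<Union> (edges X)) = {}"
    by (rule face_obtain[OF f(1)])
  obtain g where g: "continuous_map (subtopology (surface X) f) (top_of_set (cball (0::complex) 1)) g"
    "\<forall>z\<in>cball 0 1. g (h z) = z" "continuous_map (top_of_set (cball 0 1)) (surface X) h"
    "inj_on h (cball 0 1)" "f \<subseteq> topspace (surface X)"
    by (rule embedding_map_inverse[OF h(1), folded h(2)])
  have c: "continuous_map (subtopology (surface X) W) euclidean g"
    by (rule continuous_map_into_fulltopology[OF continuous_map_from_subtopology_mono[OF g(1) Wf]])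
  have hg: "h (g y) = y" "g y \<in> cball 0 1" if "y \<in> f" for y using that h(2) g(2) by auto
  have "inj_on g W"
    using Wf hg by (metis inj_onI subsetD)
  then have "open (g ` W)"
    using surface_invariance_of_domain_to_plane[OF surf W(1) c] by blast
  moreover have "g ` W \<subseteq> cball 0 1" using hg Wf by blast
  ultimately have "g ` W \<subseteq> ball 0 1" by (metis interior_cball interior_maximal)
  then have "h (g x) \<in> h ` ball 0 1" using W by blast
  then have "x \<in> h ` ball 0 1" using hg W Wf by auto
  then show False using h3 e x by blast
qed

text \<open>Two half-discs glued along an arc make a disc. A small plane disc around the parameter
  of \<open>x\<close> on the unit circle is mapped injectively into the surface, its inner half into
  \<open>f1\<close> and its outer half into \<open>f2\<close>, and invariance of domain makes the
  image open.\<close>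

lemma two_faces_fill_edge_nbhd:
  assumes e: "e \<in> edges X" and x: "x \<in> e" "x \<notin> verts X"
    and f1: "f1 \<in> faces X" "e \<subseteq> f1" and f2: "f2 \<in> faces X" "e \<subseteq> f2" and ne: "f1 \<noteq> f2"
  shows "\<exists>T. openin (surface X) T \<and> x \<in> T \<and> T \<subseteq> f1 \<union> f2"
proof -
  obtain W where W: "openin (surface X) W" "x \<in> W" "W \<inter> verts X = {}"
    "\<forall>e' \<in> edges X. e' \<noteq> e \<longrightarrow> W \<inter> e' = {}"
    "W \<subseteq> e \<union> \<Union> {f \<in> faces X. e \<subseteq> f}"
    by (rule edge_point_nbhd[OF e x])
  obtain h1 vs1 es1 where h1: "embedding_map (top_of_set (cball (0::complex) 1)) (surface X) h1"
    "f1 = h1 ` cball 0 1" and gc1: "graph_cycle X vs1 es1" "h1 ` sphere 0 1 = \<Union> (set es1)"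
    and in1: "h1 ` ball 0 1 \<inter> (verts X \<union> \<Union> (edges X)) = {}"
    by (rule face_obtain[OF f1(1)])
  obtain h2 vs2 es2 where h2: "embedding_map (top_of_set (cball (0::complex) 1)) (surface X) h2"
    "f2 = h2 ` cball 0 1" and gc2: "graph_cycle X vs2 es2" "h2 ` sphere 0 1 = \<Union> (set es2)"
    and in2: "h2 ` ball 0 1 \<inter> (verts X \<union> \<Union> (edges X)) = {}"
    by (rule face_obtain[OF f2(1)])
  obtain g1 where g1: "continuous_map (subtopology (surface X) f1) (top_of_set (cball (0::complex) 1)) g1"
    "\<forall>z\<in>cball 0 1. g1 (h1 z) = z" "continuous_map (top_of_set (cball 0 1)) (surface X) h1"
    "inj_on h1 (cball 0 1)" "f1 \<subseteq> topspace (surface X)"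
    by (rule embedding_map_inverse[OF h1(1), folded h1(2)])
  obtain g2 where g2: "continuous_map (subtopology (surface X) f2) (top_of_set (cball (0::complex) 1)) g2"
    "\<forall>z\<in>cball 0 1. g2 (h2 z) = z" "continuous_map (top_of_set (cball 0 1)) (surface X) h2"
    "inj_on h2 (cball 0 1)" "f2 \<subseteq> topspace (surface X)"
    by (rule embedding_map_inverse[OF h2(1), folded h2(2)])
  define z0 where "z0 = g1 x"
  have hg1: "h1 (g1 y) = y" "g1 y \<in> cball 0 1" if "y \<in> f1" for y using that h1(2) g1(2) by auto
  have hg2: "h2 (g2 y) = y" "g2 y \<in> cball 0 1" if "y \<in> f2" for y using that h2(2) g2(2) by auto
  have on1: "g1 y \<in> sphere 0 1" if "y \<in> e" for y
  proof -
    have "y \<in> f1" using that f1 by blast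
    then have "g1 y \<notin> ball 0 1" using hg1(1) in1 e that by (metis IntI UnCI UnionI empty_iff imageI)
    then show ?thesis using hg1(2)[OF \<open>y \<in> f1\<close>] by (auto simp: cball_eq_ball_Un_sphere)
  qed
  have on2: "g2 y \<in> sphere 0 1" if "y \<in> e" for y
  proof -
    have "y \<in> f2" using that f2 by blast
    then have "g2 y \<notin> ball 0 1" using hg2(1) in2 e that by (metis IntI UnCI UnionI empty_iff imageI)
    then show ?thesis using hg2(2)[OF \<open>y \<in> f2\<close>] by (auto simp: cball_eq_ball_Un_sphere)
  qed
  have z0: "norm z0 = 1" "h1 z0 = x" using on1[OF x(1)] hg1 x(1) f1(2) by (auto simp: z0_def)
  have "openin (top_of_set (cball (0::complex) 1)) {z \<in> topspace (top_of_set (cball 0 1)). h1 z \<in> W}"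
    by (rule openin_continuous_map_preimage[OF g1(3) W(1)])
  then obtain O1 where O1: "open O1" "{z \<in> cball 0 1. h1 z \<in> W} = cball 0 1 \<inter> O1"
    by (auto simp: openin_open)
  have "z0 \<in> {z \<in> cball 0 1. h1 z \<in> W}" using z0 W(2) by simp
  then have "z0 \<in> O1" unfolding O1(2) by blast
  then obtain d where d: "d > 0" "ball z0 d \<subseteq> O1" using O1(1) open_contains_ball by blast
  have he: "h1 z \<in> e" if "norm z = 1" "dist z0 z < d" for z
  proof -
    have "z \<in> cball 0 1 \<inter> O1" using that d by auto
    then have "h1 z \<in> W" unfolding O1(2)[symmetric] by simp
    moreover have "h1 z \<in> \<Union> (set es1)" using that gc1(2) by (metis imageI mem_sphere_0)
    then obtain e' where e': "e' \<in> set es1" "h1 z \<in> e'" by blast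
    then have "e' \<in> edges X" using gc1(1) by (auto simp: graph_cycle_def in_set_conv_nth)
    ultimately show ?thesis using W(4) e'(2) by blast
  qed
  \<comment> \<open>The bound 1/2 keeps \<open>D\<close> away from 0, so that \<open>sgn\<close> is
    continuous there. The bound \<open>d/2\<close> keeps \<open>sgn z\<close> within
    \<open>d\<close> of \<open>z0\<close>: both \<open>z0\<close> and \<open>sgn z\<close> are less
    than \<open>\<delta>\<close> away from \<open>z\<close>.\<close>
  define \<delta> where "\<delta> = min (1/2) (d/2)"
  define D where "D = ball z0 \<delta>"
  have \<delta>: "\<delta> > 0" "\<delta> \<le> 1/2" "\<delta> \<le> d/2" using d by (auto simp: \<delta>_def)
  have Dn0: "z \<noteq> 0" if "z \<in> D" for z
    using that \<delta> z0 by (auto simp: D_def dist_norm)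
  have Dsgn: "norm (sgn z) = 1 \<and> h1 (sgn z) \<in> e" if "z \<in> D" for z
  proof
    show n: "norm (sgn z) = 1" using Dn0[OF that] by (simp add: norm_sgn)
    have "z = norm z *\<^sub>R sgn z" using Dn0[OF that] by (simp add: sgn_div_norm)
    then have "norm (sgn z - z) = norm ((1 - norm z) *\<^sub>R sgn z)"
      by (metis scaleR_left_diff_distrib scaleR_one)
    also have "\<dots> = \<bar>norm z0 - norm z\<bar>" using n z0 by simp
    also have "\<dots> \<le> norm (z0 - z)" by (rule norm_triangle_ineq3)
    finally have "norm (sgn z - z) < \<delta>" using that by (simp add: D_def dist_norm)
    moreover have "norm (z0 - z) < \<delta>" using that by (simp add: D_def dist_norm)
    ultimately have "dist z0 (sgn z) < d" using \<delta>
      by (smt (verit) dist_norm norm_minus_commute norm_triangle_lt diff_add_cancel add_diff_eq field_sum_of_halves)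
    then show "h1 (sgn z) \<in> e" using he n by blast
  qed
  \<comment> \<open>outside the unit disc, reflect radially into the second face, matching the two
      parametrisations along the common edge\<close>
  define k where "k z = h2 (inverse (norm z) *\<^sub>R g2 (h1 (sgn z)))" for z
  define H where "H z = (if norm z \<le> 1 then h1 z else k z)" for z
  have g2s: "norm (g2 (h1 (sgn z))) = 1" if "z \<in> D" for z
    using on2 Dsgn[OF that] by auto
  have kn: "norm (inverse (norm z) *\<^sub>R g2 (h1 (sgn z))) = inverse (norm z)" if "z \<in> D" for z
    using g2s[OF that] by simp
  have cont: "continuous_map (top_of_set D) (surface X) H"
    unfolding H_def
  proof (rule continuous_map_cases_le)
    show "continuous_map (top_of_set D) euclideanreal norm" by (simp add: continuous_on_norm)
    show "continuous_map (top_of_set D) euclideanreal (\<lambda>_. 1)" by simp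
    show "continuous_map (subtopology (top_of_set D) {x \<in> topspace (top_of_set D). norm x \<le> 1}) (surface X) h1"
      unfolding subtopology_subtopology
      by (rule continuous_map_from_subtopology_mono[OF g1(3)]) auto
    let ?K = "D \<inter> {x \<in> topspace (top_of_set D). 1 \<le> norm x}"
    have c1: "continuous_map (top_of_set ?K) (top_of_set (cball (0::complex) 1)) sgn"
    proof -
      have "continuous_on ?K (\<lambda>z::complex. sgn z)"
        using Dn0 by (intro continuous_on_sgn continuous_on_id) auto
      moreover have "sgn ` ?K \<subseteq> cball 0 1" using Dsgn by auto
      ultimately show ?thesis by (auto simp: continuous_map_in_subtopology)
    qed
    have "continuous_map (top_of_set ?K) (surface X) (h1 \<circ> sgn)"
      by (rule continuous_map_compose[OF c1 g1(3)])
    then have "continuous_map (top_of_set ?K) (subtopology (surface X) f2) (h1 \<circ> sgn)"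
      using Dsgn f2(2) by (auto simp: continuous_map_in_subtopology)
    from continuous_map_compose[OF this g2(1)]
    have "continuous_on ?K (\<lambda>z. g2 (h1 (sgn z)))"
      by (simp add: continuous_map_in_subtopology o_def)
    then have "continuous_on ?K (\<lambda>z. inverse (norm z) *\<^sub>R g2 (h1 (sgn z)))"
      using Dn0 by (intro continuous_intros) auto
    moreover have "(\<lambda>z. inverse (norm z) *\<^sub>R g2 (h1 (sgn z))) ` ?K \<subseteq> cball 0 1"
    proof clarify
      fix z assume "z \<in> D" "z \<in> topspace (top_of_set D)" "1 \<le> norm z"
      then show "inverse (norm z) *\<^sub>R g2 (h1 (sgn z)) \<in> cball 0 1"
        using kn[of z] by (simp only: mem_cball_0) (simp add: inverse_le_1_iff)
    qed
    ultimately have "continuous_map (top_of_set ?K) (top_of_set (cball (0::complex) 1)) (\<lambda>z. inverse (norm z) *\<^sub>R g2 (h1 (sgn z)))"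
      by (auto simp: continuous_map_in_subtopology)
    from continuous_map_compose[OF this g2(3)]
    show "continuous_map (subtopology (top_of_set D) {x \<in> topspace (top_of_set D). 1 \<le> norm x}) (surface X) k"
      unfolding subtopology_subtopology by (simp add: k_def[abs_def] o_def)
    fix z assume "z \<in> topspace (top_of_set D)" and n: "norm z = 1"
    then have z: "z \<in> D" by simp
    have "sgn z = z" using n by (simp add: sgn_div_norm)
    then have "k z = h2 (g2 (h1 z))" using n by (simp add: k_def)
    also have "\<dots> = h1 z" using hg2(1) Dsgn[OF z] f2(2) \<open>sgn z = z\<close> by auto
    finally show "h1 z = k z" ..
  qed
  have Hf1: "H z \<in> f1" if "z \<in> D" "norm z \<le> 1" for z
    using that by (auto simp: H_def h1(2))
  have kball: "inverse (norm z) *\<^sub>R g2 (h1 (sgn z)) \<in> ball 0 1" if "z \<in> D" "\<not> norm z \<le> 1" for z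
    using kn[OF that(1)] that(2) by (simp only: mem_ball_0) (simp add: inverse_less_1_iff)
  \<comment> \<open>Points strictly outside the unit circle go to the open cell of
    \<open>f2\<close>, which no other face meets; so the two halves of \<open>H\<close> cannot
    collide.\<close>
  have Hf2: "H z \<in> f2 \<and> H z \<notin> f1" if "z \<in> D" "\<not> norm z \<le> 1" for z
  proof -
    have eq: "H z = h2 (inverse (norm z) *\<^sub>R g2 (h1 (sgn z)))" using that by (simp add: H_def k_def)
    have i2: "H z \<in> h2 ` ball 0 1" unfolding eq using kball[OF that] by (rule imageI)
    then have "H z \<in> f2" unfolding h2(2) by (auto simp: cball_eq_ball_Un_sphere)
    moreover have "H z \<notin> \<Union> (edges X)" using i2 in2 by blast
    ultimately show ?thesis using faces_meet[OF f1(1) f2(1) ne] by blast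
  qed
  have inj: "inj_on H D"
  proof (rule inj_onI)
    fix z w assume z: "z \<in> D" and w: "w \<in> D" and eq: "H z = H w"
    show "z = w"
    proof (cases "norm z \<le> 1")
      case True
      then have "norm w \<le> 1" using Hf1[OF z] Hf2[OF w] eq by metis
      then show ?thesis using True eq g1(4) by (auto simp: H_def inj_on_def)
    next
      case nz: False
      then have nw: "\<not> norm w \<le> 1" using Hf1[OF w] Hf2[OF z] eq by metis
      have "k z = k w" using eq nz nw by (simp add: H_def)
      then have *: "inverse (norm z) *\<^sub>R g2 (h1 (sgn z)) = inverse (norm w) *\<^sub>R g2 (h1 (sgn w))"
        using kball[OF z nz] kball[OF w nw] g2(4) unfolding k_def inj_on_def
        by (meson ball_subset_cball subsetD)
      then have n: "norm z = norm w" using kn[OF z] kn[OF w] by (metis inverse_inverse_eq)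
      then have "g2 (h1 (sgn z)) = g2 (h1 (sgn w))" using * Dn0[OF z] Dn0[OF w] by auto
      then have "h1 (sgn z) = h1 (sgn w)" using hg2(1) Dsgn[OF z] Dsgn[OF w] f2(2) by (metis subsetD)
      moreover have "sgn z \<in> cball 0 1" "sgn w \<in> cball 0 1" using Dsgn[OF z] Dsgn[OF w] by auto
      ultimately have "sgn z = sgn w" using g1(4) by (simp add: inj_on_def)
      then show ?thesis using n Dn0[OF z] Dn0[OF w] by (simp add: sgn_div_norm)
    qed
  qed
  have "open D" by (simp add: D_def)
  then have "openin (surface X) (H ` D)"
    using plane_invariance_of_domain_to_surface[OF surf _ cont inj] by blast
  moreover have "z0 \<in> D" using \<delta> by (simp add: D_def)
  then have "x \<in> H ` D" using z0 by (auto simp: H_def image_iff intro!: bexI[of _ z0])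
  moreover have "H ` D \<subseteq> f1 \<union> f2" using Hf1 Hf2 by blast
  ultimately show ?thesis by blast
qed

text \<open>Two of the faces already fill a neighbourhood of an inner point of \<open>e\<close>, but
  points of the open cell of the third face accumulate there, and these belong to no other
  face.\<close>

lemma edge_not_in_three_faces:
  assumes e: "e \<in> edges X" and f: "f1 \<in> faces X" "f2 \<in> faces X" "f3 \<in> faces X"
    "e \<subseteq> f1" "e \<subseteq> f2" "e \<subseteq> f3" "f1 \<noteq> f2" "f1 \<noteq> f3" "f2 \<noteq> f3"
  shows False
proof -
  obtain x where x: "x \<in> e" "x \<notin> verts X" using edge_inner_point[OF e] .
  obtain T where T: "openin (surface X) T" "x \<in> T" "T \<subseteq> f1 \<union> f2"
    using two_faces_fill_edge_nbhd[OF e x f(1,4,2,5,7)] by blast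
  obtain h vs es where h: "embedding_map (top_of_set (cball (0::complex) 1)) (surface X) h" "f3 = h ` cball 0 1"
     and "graph_cycle X vs es" "h ` sphere 0 1 = \<Union> (set es)"
     and h3: "h ` ball 0 1 \<inter> (verts X \<union> \<Union> (edges X)) = {}"
    by (rule face_obtain[OF f(3)])
  obtain g where g: "continuous_map (subtopology (surface X) f3) (top_of_set (cball (0::complex) 1)) g"
    "\<forall>z\<in>cball 0 1. g (h z) = z" "continuous_map (top_of_set (cball 0 1)) (surface X) h"
    "inj_on h (cball 0 1)" "f3 \<subseteq> topspace (surface X)"
    by (rule embedding_map_inverse[OF h(1), folded h(2)])
  obtain z0 where z0: "z0 \<in> cball 0 1" "h z0 = x" using x f(6) h(2) by blast
  have "openin (top_of_set (cball (0::complex) 1)) {z \<in> topspace (top_of_set (cball 0 1)). h z \<in> T}"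
    by (rule openin_continuous_map_preimage[OF g(3) T(1)])
  then obtain O1 where O1: "open O1" "{z \<in> cball 0 1. h z \<in> T} = cball 0 1 \<inter> O1"
    by (auto simp: openin_open)
  have "z0 \<in> {z \<in> cball 0 1. h z \<in> T}" using z0 T(2) by simp
  then have "z0 \<in> O1" unfolding O1(2) by blast
  moreover have "z0 \<in> closure (ball 0 1)" using z0 by simp
  ultimately have "O1 \<inter> ball 0 1 \<noteq> {}" using O1(1)
    by (metis closure_iff_nhds_not_empty inf_commute subset_refl)
  then obtain z where z: "z \<in> O1" "z \<in> ball 0 1" by blast
  then have "z \<in> cball 0 1 \<inter> O1" by auto
  then have "h z \<in> T" unfolding O1(2)[symmetric] by simp
  moreover have "h z \<in> f3" using h(2) z by auto
  ultimately have "h z \<in> \<Union> (edges X)" using T(3) f faces_meet by blast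
  then show False using h3 z by blast
qed

lemma card_faces_at_edge:
  assumes e: "e \<in> edges X" shows "card {f \<in> faces X. e \<subseteq> f} = 2"
proof -
  let ?F = "{f \<in> faces X. e \<subseteq> f}"
  obtain f1 where f1: "f1 \<in> ?F" using edge_in_some_face[OF e] by blast
  then obtain f2 where f2: "f2 \<in> ?F" "f2 \<noteq> f1" using edge_not_in_one_face[OF e] by blast
  have "?F = {f1, f2}" using f1 f2 edge_not_in_three_faces[OF e, of f1 f2] by blast
  then show ?thesis using f2(2) by simp
qed

end

subsection \<open>Incidence of vertices, edges and faces\<close>

text \<open>The topology survives only in \<open>edge_faces\<close>; everything else is incidence.
  Edges and faces remain point sets, with inclusion as incidence, so that the condition on
  intersections of faces can be taken over literally.\<close>

locale poly_map =
  fixes V :: "'a set" and E F :: "'a set set"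
  assumes fin: "finite V" "finite E" "finite F"
    and edge_ends: "e \<in> E \<Longrightarrow> \<exists>a b. a \<noteq> b \<and> e \<inter> V = {a, b}"
    and edge_eqI: "e \<in> E \<Longrightarrow> e' \<in> E \<Longrightarrow> e \<inter> V = e' \<inter> V \<Longrightarrow> e = e'"
    and edge_faces: "e \<in> E \<Longrightarrow> card {f \<in> F. e \<subseteq> f} = 2"
    and face_boundary: "f \<in> F \<Longrightarrow> \<exists>vs es. 3 \<le> length vs \<and> length es = length vs \<and> distinct vs \<and>
      (\<forall>i < length vs. es ! i \<inter> V = {vs ! i, vs ! (Suc i mod length vs)}) \<and>
      f \<inter> V = set vs \<and> {e \<in> E. e \<subseteq> f} = set es"
    and faces_meet: "f \<in> F \<Longrightarrow> f' \<in> F \<Longrightarrow> f \<noteq> f' \<Longrightarrow>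
      f \<inter> f' = {} \<or> (\<exists>u \<in> V. f \<inter> f' = {u}) \<or> f \<inter> f' \<in> E"
begin

definition gon :: "'a set \<Rightarrow> nat" where "gon f = card (f \<inter> V)"

definition adj :: "'a set \<Rightarrow> 'a set \<Rightarrow> bool" where
  "adj f g \<longleftrightarrow> f \<in> F \<and> g \<in> F \<and> f \<noteq> g \<and> f \<inter> g \<in> E"

lemma adj_sym: "adj f g \<Longrightarrow> adj g f"
  by (auto simp: adj_def Int_commute)

lemma finite_at [simp]: "finite {f \<in> F. P f}" "finite {e \<in> E. P e}" "finite (f \<inter> V)"
  using fin by auto

lemma face_boundaryE:
  assumes "f \<in> F"
  obtains vs es where "3 \<le> length vs" "length es = length vs" "distinct vs"
      "\<forall>i < length vs. es ! i \<inter> V = {vs ! i, vs ! (Suc i mod length vs)}"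
      "f \<inter> V = set vs" "{e \<in> E. e \<subseteq> f} = set es"
  using face_boundary[OF assms] by (elim exE conjE) (rule that)

lemma boundary_index:
  assumes "distinct vs" "3 \<le> length vs" "i < length vs" "j < length vs"
    "vs ! i = vs ! j \<or> vs ! i = vs ! (Suc j mod length vs)"
  shows "j = i \<or> i = Suc j mod length vs"
proof -
  have "Suc j mod length vs < length vs" using assms(2) by (intro mod_less_divisor) linarith
  then show ?thesis using assms by (auto simp: nth_eq_iff_index_eq)
qed

text \<open>Two equal edges at different positions would make each position the successor of the
  other, which needs a cycle of length 2.\<close>

lemma boundary_edges_distinct:
  assumes "3 \<le> length vs" "length es = length vs" "distinct vs"
      "\<forall>i < length vs. es ! i \<inter> V = {vs ! i, vs ! (Suc i mod length vs)}"
  shows "distinct es"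
proof -
  have "es ! i \<noteq> es ! j" if "i < j" "j < length vs" for i j
  proof
    assume "es ! i = es ! j"
    then have eq: "{vs ! i, vs ! (Suc i mod length vs)} = {vs ! j, vs ! (Suc j mod length vs)}"
      using assms(4) that by (metis order.strict_trans)
    have "vs ! i \<in> {vs ! j, vs ! (Suc j mod length vs)}" using eq by blast
    then have 1: "i = Suc j mod length vs" using boundary_index[of vs i j] that assms by auto
    have "vs ! j \<in> {vs ! i, vs ! (Suc i mod length vs)}" using eq by blast
    then have 2: "j = Suc i mod length vs" using boundary_index[of vs j i] that assms by auto
    have "j = Suc i" using 2 that by (cases "Suc i = length vs") auto
    then show False using 1 that assms(1) by (cases "Suc j = length vs") auto
  qed
  then show ?thesis using assms(2) by (metis distinct_conv_nth nat_neq_iff)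
qed

lemma gon_ge_3: assumes "f \<in> F" shows "3 \<le> gon f"
proof -
  obtain vs es where b: "3 \<le> length vs" "length es = length vs" "distinct vs"
      "\<forall>i < length vs. es ! i \<inter> V = {vs ! i, vs ! (Suc i mod length vs)}"
      "f \<inter> V = set vs" "{e \<in> E. e \<subseteq> f} = set es"
    by (rule face_boundaryE[OF assms])
  show ?thesis using b(1,3) unfolding gon_def b(5) by (simp add: distinct_card)
qed

lemma card_face_edges_at:
  assumes "f \<in> F" "u \<in> f" "u \<in> V" shows "card {e \<in> E. u \<in> e \<and> e \<subseteq> f} = 2"
proof -
  obtain vs es where b: "3 \<le> length vs" "length es = length vs" "distinct vs"
      "\<forall>i < length vs. es ! i \<inter> V = {vs ! i, vs ! (Suc i mod length vs)}"
      "f \<inter> V = set vs" "{e \<in> E. e \<subseteq> f} = set es"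
    by (rule face_boundaryE[OF assms(1)])
  let ?n = "length vs"
  have "u \<in> set vs" using assms b(5) by blast
  then obtain i where i: "i < ?n" "u = vs ! i" by (auto simp: in_set_conv_nth)
  define p where "p = (if i = 0 then ?n - 1 else i - 1)"
  have p: "p < ?n" "Suc p mod ?n = i" "p \<noteq> i" using i(1) b(1) by (auto simp: p_def)
  have "{e \<in> E. u \<in> e \<and> e \<subseteq> f} = {es ! i, es ! p}"
  proof
    show "{e \<in> E. u \<in> e \<and> e \<subseteq> f} \<subseteq> {es ! i, es ! p}"
    proof
      fix e assume "e \<in> {e \<in> E. u \<in> e \<and> e \<subseteq> f}"
      then have e: "e \<in> E" "u \<in> e" "e \<subseteq> f" by auto
      then have "e \<in> set es" unfolding b(6)[symmetric] by simp
      then obtain j where j: "j < ?n" "e = es ! j" using b(2) by (auto simp: in_set_conv_nth)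
      have "u \<in> e \<inter> V" using e assms(3) by simp
      then have "u \<in> {vs ! j, vs ! (Suc j mod ?n)}" unfolding j(2) using b(4) j(1) by simp
      then have "j = i \<or> i = Suc j mod ?n" using boundary_index[OF b(3,1) i(1) j(1)] i(2) by simp
      moreover have "p = j" if "i = Suc j mod ?n"
        using that j(1) by (cases "Suc j = ?n") (auto simp: p_def)
      ultimately show "e \<in> {es ! i, es ! p}" using j(2) by blast
    qed
    have "u \<in> es ! i \<inter> V" using b(4)[rule_format, OF i(1)] i(2) by simp
    moreover have "u \<in> es ! p \<inter> V" using b(4)[rule_format, OF p(1)] p(2) i(2) by simp
    ultimately have "u \<in> es ! i" "u \<in> es ! p" by simp_all
    moreover have "es ! i \<in> {e \<in> E. e \<subseteq> f}" "es ! p \<in> {e \<in> E. e \<subseteq> f}"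
      unfolding b(6) using i p b(2) by auto
    ultimately show "{es ! i, es ! p} \<subseteq> {e \<in> E. u \<in> e \<and> e \<subseteq> f}" by blast
  qed
  moreover have "es ! i \<noteq> es ! p"
    using boundary_edges_distinct[OF b(1-4)] i p b(2) by (simp add: nth_eq_iff_index_eq)
  ultimately show ?thesis by simp
qed

text \<open>Walking around the boundary from one vertex of \<open>S\<close> never leaves
  \<open>S\<close>. This identifies orbits of rotations with boundaries of faces, and it shows that
  a boundary which closes up early is already complete.\<close>

lemma face_boundary_connected:
  assumes f: "f \<in> F" and S: "S \<subseteq> f \<inter> V" "S \<noteq> {}"
    and cl: "\<And>e. e \<in> E \<Longrightarrow> e \<subseteq> f \<Longrightarrow> e \<inter> S \<noteq> {} \<Longrightarrow> e \<inter> V \<subseteq> S"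
  shows "S = f \<inter> V"
proof -
  obtain vs es where b: "3 \<le> length vs" "length es = length vs" "distinct vs"
      "\<forall>i < length vs. es ! i \<inter> V = {vs ! i, vs ! (Suc i mod length vs)}"
      "f \<inter> V = set vs" "{e \<in> E. e \<subseteq> f} = set es"
    by (rule face_boundaryE[OF f])
  let ?n = "length vs"
  have es: "es ! i \<in> E" "es ! i \<subseteq> f" if "i < ?n" for i
    using b(6) that b(2) by (metis (mono_tags, lifting) mem_Collect_eq nth_mem)+
  have step: "vs ! (Suc i mod ?n) \<in> S" if "i < ?n" "vs ! i \<in> S" for i
  proof -
    have "vs ! i \<in> es ! i" using b(4) that by blast
    then have "es ! i \<inter> V \<subseteq> S" using cl[OF es[OF that(1)]] that(2) by blast
    then show ?thesis using b(4) that(1) by blast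
  qed
  obtain k where k: "k < ?n" "vs ! k \<in> S" using S b(5) by (metis all_not_in_conv in_set_conv_nth subset_iff)
  have all: "vs ! ((k + m) mod ?n) \<in> S" for m
  proof (induction m)
    case 0 then show ?case using k by simp
  next
    case (Suc m)
    have "(k + m) mod ?n < ?n" using b(1) by (intro mod_less_divisor) linarith
    from step[OF this Suc] show ?case by (simp add: mod_Suc_eq)
  qed
  have "set vs \<subseteq> S"
  proof
    fix v assume "v \<in> set vs"
    then obtain j where j: "j < ?n" "v = vs ! j" by (auto simp: in_set_conv_nth)
    have "(k + (?n - k + j)) mod ?n = j" using k(1) j(1) by simp
    then show "v \<in> S" using all[of "?n - k + j"] j by simp
  qed
  then show ?thesis using S b(5) by blast
qed

lemma faces_share_edge:
  assumes "f \<in> F" "f' \<in> F" "f \<noteq> f'" "a \<in> f \<inter> f'" "b \<in> f \<inter> f'" "a \<noteq> b"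
  shows "f \<inter> f' \<in> E"
proof -
  have "\<not> (\<exists>u \<in> V. f \<inter> f' = {u})" using assms(4-6) by (metis singletonD)
  then show ?thesis using faces_meet[OF assms(1-3)] assms(4) by blast
qed

lemma edge_vertices:
  assumes "e \<in> E" "a \<in> e" "b \<in> e" "a \<noteq> b" "a \<in> V" "b \<in> V"
  shows "e \<inter> V = {a, b}"
proof -
  obtain x y where "e \<inter> V = {x, y}" using edge_ends[OF assms(1)] by blast
  moreover have "a \<in> e \<inter> V" "b \<in> e \<inter> V" using assms by auto
  ultimately show ?thesis using assms(4) by auto
qed

text \<open>The intersection of the two faces at \<open>e\<close> is an edge with the same ends as
  \<open>e\<close>, hence \<open>e\<close> itself, because the graph is simple.\<close>

lemma edge_face_pair:
  assumes "e \<in> E" "f \<in> F" "e \<subseteq> f"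
  obtains g where "adj f g" "f \<inter> g = e" "{h \<in> F. e \<subseteq> h} = {f, g}"
proof -
  obtain a b where ab: "a \<noteq> b" "e \<inter> V = {a, b}" using edge_ends[OF assms(1)] by blast
  obtain x y where xy: "{h \<in> F. e \<subseteq> h} = {x, y}" "x \<noteq> y"
    using edge_faces[OF assms(1)] by (auto simp: card_2_iff)
  then have "f \<in> {x, y}" using assms by blast
  then obtain g where g: "{h \<in> F. e \<subseteq> h} = {f, g}" "f \<noteq> g" using xy by (metis insertE insert_commute singletonD)
  then have g': "g \<in> F" "e \<subseteq> g" by auto
  have i: "f \<inter> g \<in> E"
    using faces_share_edge[OF assms(2) g'(1) g(2), of a b] ab assms(3) g' by blast
  moreover have "(f \<inter> g) \<inter> V = {a, b}"
    using edge_vertices[OF i, of a b] ab assms(3) g'(2) by blast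
  ultimately have "f \<inter> g = e" using edge_eqI[OF _ assms(1)] ab(2) by simp
  then show ?thesis using that[of g] g g' i assms(2) by (simp add: adj_def)
qed

lemma adj_card: assumes "adj f g" shows "card (f \<inter> g \<inter> V) = 2"
proof -
  have "f \<inter> g \<in> E" using assms by (simp add: adj_def)
  then obtain a b where "a \<noteq> b" "f \<inter> g \<inter> V = {a, b}" using edge_ends by blast
  then show ?thesis by simp
qed

lemma adj_edge_unique:
  assumes "adj f g" "adj f h" "f \<inter> g = f \<inter> h" shows "g = h"
proof -
  have e: "f \<inter> g \<in> E" "f \<in> F" "f \<inter> g \<subseteq> f" using assms by (auto simp: adj_def)
  obtain k where k: "{h \<in> F. f \<inter> g \<subseteq> h} = {f, k}" using edge_face_pair[OF e] by metis
  have "g \<in> {h \<in> F. f \<inter> g \<subseteq> h}" "h \<in> {h \<in> F. f \<inter> g \<subseteq> h}" "g \<noteq> f" "h \<noteq> f"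
    using assms by (auto simp: adj_def)
  then show ?thesis unfolding k by auto
qed

lemma not_adj_card:
  assumes "f \<in> F" "g \<in> F" "f \<noteq> g" "\<not> adj f g" shows "card (f \<inter> g \<inter> V) \<le> 1"
proof -
  have "\<forall>a \<in> f \<inter> g \<inter> V. \<forall>b \<in> f \<inter> g \<inter> V. a = b"
    using faces_share_edge[OF assms(1-3)] assms by (auto simp: adj_def)
  then show ?thesis
    by (metis card_le_Suc0_iff_eq finite_Int fin(1) One_nat_def)
qed

text \<open>The neighbours of \<open>f\<close> at \<open>u\<close> correspond to the two boundary
  edges of \<open>f\<close> at \<open>u\<close>.\<close>

lemma card_adj_at:
  assumes "f \<in> F" "u \<in> f" "u \<in> V" shows "card {g \<in> F. u \<in> g \<and> adj f g} = 2"
proof -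
  have "bij_betw (\<lambda>g. f \<inter> g) {g \<in> F. u \<in> g \<and> adj f g} {e \<in> E. u \<in> e \<and> e \<subseteq> f}"
    unfolding bij_betw_def
  proof
    show "inj_on (\<lambda>g. f \<inter> g) {g \<in> F. u \<in> g \<and> adj f g}"
      using adj_edge_unique by (auto intro!: inj_onI)
    show "(\<lambda>g. f \<inter> g) ` {g \<in> F. u \<in> g \<and> adj f g} = {e \<in> E. u \<in> e \<and> e \<subseteq> f}"
    proof
      show "(\<lambda>g. f \<inter> g) ` {g \<in> F. u \<in> g \<and> adj f g} \<subseteq> {e \<in> E. u \<in> e \<and> e \<subseteq> f}"
        using assms unfolding adj_def by blast
      show "{e \<in> E. u \<in> e \<and> e \<subseteq> f} \<subseteq> (\<lambda>g. f \<inter> g) ` {g \<in> F. u \<in> g \<and> adj f g}"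
      proof clarify
        fix e assume e: "e \<in> E" "u \<in> e" "e \<subseteq> f"
        obtain g where "adj f g" "f \<inter> g = e" using edge_face_pair[OF e(1) assms(1) e(3)] by metis
        then show "e \<in> (\<lambda>g. f \<inter> g) ` {g \<in> F. u \<in> g \<and> adj f g}"
          using e by (intro image_eqI[of _ _ g]) (auto simp: adj_def)
      qed
    qed
  qed
  from bij_betw_same_card[OF this] show ?thesis using card_face_edges_at[OF assms] by simp
qed

lemma sum_card_swap:
  assumes "finite A" "finite B"
  shows "(\<Sum>a\<in>A. card {b \<in> B. R a b}) = (\<Sum>b\<in>B. card {a \<in> A. R a b})"
proof -
  have "(\<Sum>a\<in>A. card {b \<in> B. R a b}) = (\<Sum>a\<in>A. \<Sum>b\<in>B. if R a b then 1 else 0)"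
    using assms by (simp add: sum.If_cases Int_def)
  also have "\<dots> = (\<Sum>b\<in>B. \<Sum>a\<in>A. if R a b then 1 else 0)" by (rule sum.swap)
  also have "\<dots> = (\<Sum>b\<in>B. card {a \<in> A. R a b})"
    using assms by (simp add: sum.If_cases Int_def)
  finally show ?thesis .
qed

text \<open>A neighbour shares exactly one edge with \<open>f\<close> and is therefore counted at
  the two ends of that edge. The factor 2 is the source of all parity arguments about faces.\<close>

lemma sum_adj_at:
  assumes "f \<in> F"
  shows "(\<Sum>u\<in>f \<inter> V. card {g \<in> F. u \<in> g \<and> adj f g \<and> Q g}) = 2 * card {g \<in> F. adj f g \<and> Q g}"
proof -
  have "(\<Sum>u\<in>f \<inter> V. card {g \<in> F. u \<in> g \<and> adj f g \<and> Q g}) =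
        (\<Sum>u\<in>f \<inter> V. card {g \<in> {g \<in> F. adj f g \<and> Q g}. u \<in> g})"
    by (intro sum.cong refl arg_cong[where f = card]) auto
  also have "\<dots> = (\<Sum>g\<in>{g \<in> F. adj f g \<and> Q g}. card {u \<in> f \<inter> V. u \<in> g})"
    by (rule sum_card_swap) auto
  also have "\<dots> = (\<Sum>g\<in>{g \<in> F. adj f g \<and> Q g}. 2)"
  proof (rule sum.cong[OF refl])
    fix g assume "g \<in> {g \<in> F. adj f g \<and> Q g}"
    then have "card (f \<inter> g \<inter> V) = 2" using adj_card by blast
    moreover have "{u \<in> f \<inter> V. u \<in> g} = f \<inter> g \<inter> V" by blast
    ultimately show "card {u \<in> f \<inter> V. u \<in> g} = 2" by simp
  qed
  finally show ?thesis by simp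
qed

end

locale semi_equivelar_map = poly_map +
  fixes l :: "nat list"
  assumes deg: "u \<in> V \<Longrightarrow> 3 \<le> card {e \<in> E. u \<in> e}"
    and fc: "u \<in> V \<Longrightarrow> \<exists>fs. distinct fs \<and> set fs = {f \<in> F. u \<in> f} \<and>
     (\<forall>i < length fs. \<exists>e \<in> E. u \<in> e \<and> e \<subseteq> fs ! i \<and> e \<subseteq> fs ! (Suc i mod length fs)) \<and>
     map gon fs = l"
    and V_ne: "V \<noteq> {}"
begin

lemma fcE:
  assumes u: "u \<in> V"
  obtains fs where "distinct fs" "set fs = {f \<in> F. u \<in> f}"
    "\<forall>i < length fs. \<exists>e \<in> E. u \<in> e \<and> e \<subseteq> fs ! i \<and> e \<subseteq> fs ! (Suc i mod length fs)" "map gon fs = l"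
  using fc[OF u] by (elim exE conjE) (rule that)

lemma card_faces_at:
  assumes u: "u \<in> V" shows "card {f \<in> F. u \<in> f} = length l"
proof -
  obtain fs where fs: "distinct fs" "set fs = {f \<in> F. u \<in> f}"
    "\<forall>i < length fs. \<exists>e \<in> E. u \<in> e \<and> e \<subseteq> fs ! i \<and> e \<subseteq> fs ! (Suc i mod length fs)" "map gon fs = l"
    by (rule fcE[OF u])
  have "length fs = length l" using fs(4) by (metis length_map)
  then show ?thesis using distinct_card[OF fs(1)] unfolding fs(2) by simp
qed

text \<open>Count the pairs of an edge and a face at \<open>u\<close> that are incident: each edge
  lies in two faces, and each face has two edges at \<open>u\<close>.\<close>

lemma degree:
  assumes u: "u \<in> V" shows "card {e \<in> E. u \<in> e} = length l"
proof -
  have "2 * card {e \<in> E. u \<in> e} = (\<Sum>e\<in>{e \<in> E. u \<in> e}. card {f \<in> {f \<in> F. u \<in> f}. e \<subseteq> f})"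
  proof -
    have "card {f \<in> {f \<in> F. u \<in> f}. e \<subseteq> f} = 2" if "e \<in> {e \<in> E. u \<in> e}" for e
      using edge_faces[of e] that by (smt (verit) Collect_cong mem_Collect_eq subset_iff)
    then show ?thesis by simp
  qed
  also have "\<dots> = (\<Sum>f\<in>{f \<in> F. u \<in> f}. card {e \<in> {e \<in> E. u \<in> e}. e \<subseteq> f})"
    by (rule sum_card_swap) auto
  also have "\<dots> = (\<Sum>f\<in>{f \<in> F. u \<in> f}. 2)"
    using card_face_edges_at[OF _ _ u] by (intro sum.cong) (auto simp: conj_assoc)
  finally show ?thesis using card_faces_at[OF u] by simp
qed

lemma length_ge_3: "3 \<le> length l"
proof -
  obtain u where "u \<in> V" using V_ne by blast
  from deg[OF this] degree[OF this] show ?thesis by simp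
qed

text \<open>Each face has only two neighbours at \<open>u\<close>, and its predecessor and its
  successor in the face-cycle are two distinct ones, as the length is at least 3. So no further pair
  of faces at \<open>u\<close> can share an edge.\<close>

lemma vertex_cycle:
  assumes u: "u \<in> V"
  obtains fs where "distinct fs" "set fs = {f \<in> F. u \<in> f}" "map gon fs = l"
    "\<forall>i < length l. adj (fs ! i) (fs ! (Suc i mod length l))"
    "\<forall>i < length l. \<forall>j < length l. adj (fs ! i) (fs ! j) \<longrightarrow>
      j = Suc i mod length l \<or> i = Suc j mod length l"
proof -
  let ?d = "length l"
  obtain fs where fs0: "distinct fs" "set fs = {f \<in> F. u \<in> f}"
    and ed: "\<forall>i < length fs. \<exists>e \<in> E. u \<in> e \<and> e \<subseteq> fs ! i \<and> e \<subseteq> fs ! (Suc i mod length fs)"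
    and fs1: "map gon fs = l"
    by (rule fcE[OF u])
  note fs = fs0 fs1
  have len: "length fs = ?d" unfolding fs(3)[symmetric] by simp
  have d: "?d \<ge> 3" by (rule length_ge_3)
  have nx: "Suc i mod ?d < ?d" for i using d by (intro mod_less_divisor) linarith
  have mem: "fs ! i \<in> F" "u \<in> fs ! i" if "i < ?d" for i
    using fs(2) that len nth_mem[of i fs] by auto
  have step: "adj (fs ! i) (fs ! (Suc i mod ?d))" if i: "i < ?d" for i
  proof -
    obtain e where e: "e \<in> E" "u \<in> e" "e \<subseteq> fs ! i" "e \<subseteq> fs ! (Suc i mod ?d)"
      using ed i len by metis
    obtain a b where ab: "a \<noteq> b" "e \<inter> V = {a, b}" using edge_ends[OF e(1)] by blast
    have "Suc i mod ?d \<noteq> i" using i d by (cases "Suc i = ?d") auto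
    then have ne: "fs ! i \<noteq> fs ! (Suc i mod ?d)" using fs(1) i nx[of i] len by (simp add: nth_eq_iff_index_eq)
    have "fs ! i \<inter> fs ! (Suc i mod ?d) \<in> E"
      by (rule faces_share_edge[of _ _ a b]) (use mem[OF i] mem[OF nx] ne ab e in auto)
    then show ?thesis using mem[OF i] mem[OF nx] ne by (simp add: adj_def)
  qed
  have ret: "j = Suc i mod ?d \<or> i = Suc j mod ?d"
    if ij: "i < ?d" "j < ?d" "adj (fs ! i) (fs ! j)" for i j
  proof -
    define p where "p = (if i = 0 then ?d - 1 else i - 1)"
    have p: "p < ?d" "Suc p mod ?d = i" using ij(1) d by (auto simp: p_def)
    have pn: "p \<noteq> Suc i mod ?d" using ij(1) d by (cases "Suc i = ?d") (auto simp: p_def)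
    let ?A = "{g \<in> F. u \<in> g \<and> adj (fs ! i) g}"
    have c: "card ?A = 2" using card_adj_at mem[OF ij(1)] u by blast
    have a: "fs ! p \<in> ?A" "fs ! (Suc i mod ?d) \<in> ?A" "fs ! j \<in> ?A"
      using step[OF ij(1)] adj_sym[OF step[OF p(1)]] ij(3) mem p nx ij by auto
    have "fs ! p \<noteq> fs ! (Suc i mod ?d)" using fs(1) pn p(1) nx[of i] len by (simp add: nth_eq_iff_index_eq)
    then have "card {fs ! p, fs ! (Suc i mod ?d)} = card ?A" using c by simp
    moreover have "{fs ! p, fs ! (Suc i mod ?d)} \<subseteq> ?A" using a by blast
    ultimately have "{fs ! p, fs ! (Suc i mod ?d)} = ?A" by (intro card_subset_eq) auto
    then have "fs ! j = fs ! p \<or> fs ! j = fs ! (Suc i mod ?d)" using a by blast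
    then have "j = p \<or> j = Suc i mod ?d" using fs(1) ij(2) p(1) nx[of i] len by (simp add: nth_eq_iff_index_eq)
    then show ?thesis using p by auto
  qed
  show ?thesis by (rule that[OF fs]) (use step ret in blast)+
qed

lemma card_at_gon:
  assumes u: "u \<in> V" shows "card {f \<in> F. u \<in> f \<and> gon f = q} = count_list l q"
proof -
  obtain fs where fs: "distinct fs" "set fs = {f \<in> F. u \<in> f}" "map gon fs = l"
    "\<forall>i < length l. adj (fs ! i) (fs ! (Suc i mod length l))"
    "\<forall>i < length l. \<forall>j < length l. adj (fs ! i) (fs ! j) \<longrightarrow>
      j = Suc i mod length l \<or> i = Suc j mod length l"
    by (rule vertex_cycle[OF u])
  have "{f \<in> F. u \<in> f \<and> gon f = q} = set (filter (\<lambda>f. gon f = q) fs)" using fs(2) by auto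
  then have "card {f \<in> F. u \<in> f \<and> gon f = q} = length (filter (\<lambda>f. gon f = q) fs)"
    using fs(1) distinct_card[of "filter (\<lambda>f. gon f = q) fs"] by simp
  also have "\<dots> = count_list (map gon fs) q" by (induction fs) auto
  finally show ?thesis using fs(3) by simp
qed

lemma window_at:
  assumes u: "u \<in> V" and f: "f \<in> F" "u \<in> f"
  obtains i g h where "i < length l" "g \<noteq> h" "{k \<in> F. u \<in> k \<and> adj f k} = {g, h}"
    "gon f = l ! i" "gon g = l ! ((i + length l - 1) mod length l)" "gon h = l ! (Suc i mod length l)"
proof -
  let ?d = "length l"
  obtain fs where fs: "distinct fs" "set fs = {f \<in> F. u \<in> f}" "map gon fs = l"
    and st: "\<forall>i < ?d. adj (fs ! i) (fs ! (Suc i mod ?d))"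
    and "\<forall>i < ?d. \<forall>j < ?d. adj (fs ! i) (fs ! j) \<longrightarrow> j = Suc i mod ?d \<or> i = Suc j mod ?d"
    by (rule vertex_cycle[OF u])
  have len: "length fs = ?d" unfolding fs(3)[symmetric] by simp
  have d: "?d \<ge> 3" by (rule length_ge_3)
  have nx: "Suc i mod ?d < ?d" "(i + ?d - 1) mod ?d < ?d" for i
    using d by (auto intro!: mod_less_divisor simp del: mod_less)
  have "f \<in> set fs" using f fs(2) by blast
  then obtain i where i: "i < ?d" "f = fs ! i" using len by (auto simp: in_set_conv_nth)
  let ?p = "(i + ?d - 1) mod ?d"
  have p': "?p = (if i = 0 then ?d - 1 else i - 1)"
  proof (cases "i = 0")
    case False
    then have "i + ?d - 1 = (i - 1) + ?d" by simp
    then have "?p = (i - 1) mod ?d" by (simp only: mod_add_self2)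
    then show ?thesis using False i(1) by simp
  qed (use d in simp)
  have sp: "Suc ?p mod ?d = i" unfolding p' using i(1) d by auto
  have pn: "?p \<noteq> Suc i mod ?d" unfolding p' using i(1) d by (cases "Suc i = ?d") auto
  have ne: "fs ! ?p \<noteq> fs ! (Suc i mod ?d)" using fs(1) pn nx[of i] len by (simp add: nth_eq_iff_index_eq)
  then have c2: "card {fs ! ?p, fs ! (Suc i mod ?d)} = card {k \<in> F. u \<in> k \<and> adj f k}"
    using card_adj_at[OF f u] by simp
  have "{k \<in> F. u \<in> k \<and> adj f k} = {fs ! ?p, fs ! (Suc i mod ?d)}"
  proof (rule sym, rule card_subset_eq[OF _ _ c2])
    have "adj f (fs ! ?p)" using adj_sym[OF st[rule_format, OF nx(2)[of i]]] sp i by simp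
    moreover have "adj f (fs ! (Suc i mod ?d))" using st i by simp
    moreover have "fs ! ?p \<in> set fs" "fs ! (Suc i mod ?d) \<in> set fs" using nx[of i] len by auto
    ultimately show "{fs ! ?p, fs ! (Suc i mod ?d)} \<subseteq> {k \<in> F. u \<in> k \<and> adj f k}"
      using fs(2) by auto
  qed simp
  moreover have "gon (fs ! j) = l ! j" if "j < ?d" for j using fs(3) that len by (metis nth_map)
  ultimately show ?thesis using that[OF i(1) ne] i nx[of i] by simp
qed

end

subsection \<open>Counting faces and neighbours\<close>

text \<open>The cyclically consecutive triples of a list, centred at each entry in turn; built from
  \<open>zip\<close> so that it can be evaluated.\<close>

definition windows :: "'b list \<Rightarrow> ('b \<times> 'b \<times> 'b) list" where
  "windows l = zip (last l # butlast l) (zip l (tl l @ [hd l]))"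

lemma windowsI:
  assumes "i < length l"
  shows "(l ! ((i + length l - 1) mod length l), l ! i, l ! (Suc i mod length l)) \<in> set (windows l)"
proof -
  let ?d = "length l"
  have ne: "l \<noteq> []" using assms by auto
  have len: "length (windows l) = ?d" using ne by (simp add: windows_def)
  have "windows l ! i = ((last l # butlast l) ! i, l ! i, (tl l @ [hd l]) ! i)"
    using assms by (simp add: windows_def)
  moreover have "(last l # butlast l) ! i = l ! ((i + ?d - 1) mod ?d)"
  proof (cases i)
    case 0 then show ?thesis using ne by (simp add: last_conv_nth)
  next
    case (Suc j)
    then have "i + ?d - 1 = j + ?d" by simp
    then have "(i + ?d - 1) mod ?d = j mod ?d" by (simp only: mod_add_self2)
    then show ?thesis using Suc assms by (simp add: nth_butlast)
  qed
  moreover have "(tl l @ [hd l]) ! i = l ! (Suc i mod ?d)"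
  proof (cases "Suc i = ?d")
    case True
    then have "i = length (tl l)" by simp
    then have "(tl l @ [hd l]) ! i = hd l" by (metis nth_append_length)
    then show ?thesis using True ne by (simp add: hd_conv_nth)
  next
    case False
    then have "Suc i < ?d" using assms by simp
    then have "i < length l - 1" by linarith
    then show ?thesis using \<open>Suc i < ?d\<close> by (simp add: nth_append nth_tl)
  qed
  ultimately show ?thesis using len assms by (metis nth_mem)
qed

context semi_equivelar_map
begin

lemma window_gonE:
  assumes u: "u \<in> V" and f: "f \<in> F" "u \<in> f"
  obtains g h where "g \<noteq> h" "{k \<in> F. u \<in> k \<and> adj f k} = {g, h}"
    "(gon g, gon f, gon h) \<in> set (windows l)"
proof -
  obtain i g h where i: "i < length l" and gh: "g \<noteq> h" "{k \<in> F. u \<in> k \<and> adj f k} = {g, h}"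
    "gon f = l ! i" "gon g = l ! ((i + length l - 1) mod length l)" "gon h = l ! (Suc i mod length l)"
    by (rule window_at[OF u f])
  show ?thesis by (rule that[OF gh(1,2)]) (simp only: gh(3-5) windowsI[OF i])
qed

lemma sum_at:
  assumes u: "u \<in> V"
  shows "(\<Sum>f\<in>{f \<in> F. u \<in> f}. w (gon f)) = (\<Sum>p\<leftarrow>l. w p)"
proof -
  obtain fs where fs: "distinct fs" "set fs = {f \<in> F. u \<in> f}"
    "\<forall>i < length fs. \<exists>e \<in> E. u \<in> e \<and> e \<subseteq> fs ! i \<and> e \<subseteq> fs ! (Suc i mod length fs)" "map gon fs = l"
    by (rule fcE[OF u])
  have "(\<Sum>f\<in>{f \<in> F. u \<in> f}. w (gon f)) = (\<Sum>f\<leftarrow>fs. w (gon f))"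
    using fs(1,2) by (metis sum_list_distinct_conv_sum_set)
  then show ?thesis unfolding fs(4)[symmetric] by (simp add: o_def)
qed

text \<open>Double counting of incident vertices and faces, with weights depending on the size of
  the face. An indicator as weight counts the \<open>q\<close>-gons, the reciprocal of the size
  counts all faces.\<close>

lemma sum_faces_vertices:
  fixes w :: "nat \<Rightarrow> 'c :: comm_semiring_1"
  shows "(\<Sum>f\<in>F. of_nat (gon f) * w (gon f)) = of_nat (card V) * (\<Sum>p\<leftarrow>l. w p)"
proof -
  have "(\<Sum>f\<in>F. of_nat (gon f) * w (gon f)) = (\<Sum>f\<in>F. \<Sum>u\<in>V. if u \<in> f then w (gon f) else 0)"
  proof (rule sum.cong[OF refl])
    fix f assume "f \<in> F"
    have "(\<Sum>u\<in>V. if u \<in> f then w (gon f) else 0) = (\<Sum>u\<in>{u \<in> V. u \<in> f}. w (gon f))"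
      using fin by (simp add: sum.If_cases Int_def)
    moreover have "{u \<in> V. u \<in> f} = f \<inter> V" by blast
    ultimately show "of_nat (gon f) * w (gon f) = (\<Sum>u\<in>V. if u \<in> f then w (gon f) else 0)"
      by (simp add: gon_def)
  qed
  also have "\<dots> = (\<Sum>u\<in>V. \<Sum>f\<in>F. if u \<in> f then w (gon f) else 0)" by (rule sum.swap)
  also have "\<dots> = (\<Sum>u\<in>V. \<Sum>f\<in>{f \<in> F. u \<in> f}. w (gon f))"
    using fin by (intro sum.cong[OF refl]) (simp add: sum.If_cases Int_def)
  also have "\<dots> = (\<Sum>u\<in>V. \<Sum>p\<leftarrow>l. w p)" by (intro sum.cong[OF refl] sum_at)
  finally show ?thesis by simp
qed

lemma card_gon: "q * card {f \<in> F. gon f = q} = card V * count_list l q"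
proof -
  have "q * card {f \<in> F. gon f = q} = (\<Sum>f\<in>{f \<in> F. gon f = q}. gon f)"
    by (simp add: mult.commute)
  also have "\<dots> = (\<Sum>f\<in>F. gon f * of_bool (gon f = q))"
    using fin by (simp add: sum.If_cases Int_def of_bool_def if_distrib[where f = "\<lambda>x. _ * x"] cong: if_cong)
  also have "\<dots> = card V * (\<Sum>p\<leftarrow>l. of_bool (p = q))"
    using sum_faces_vertices[of "\<lambda>p. of_bool (p = q) :: nat"] by simp
  also have "(\<Sum>p\<leftarrow>l. of_bool (p = q)) = count_list l q" by (induction l) auto
  finally show ?thesis .
qed

lemma card_F: "real (card F) = real (card V) * (\<Sum>p\<leftarrow>l. 1 / real p)"
proof -
  have "real (gon f) * (1 / real (gon f)) = 1" if "f \<in> F" for f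
    using gon_ge_3[OF that] by simp
  then have "(\<Sum>f\<in>F. real (gon f) * (1 / real (gon f))) = (\<Sum>f\<in>F. 1)"
    by (intro sum.cong refl) blast
  then show ?thesis using sum_faces_vertices[of "\<lambda>p. 1 / real p"] by simp
qed

lemma card_E: "2 * card E = card V * length l"
proof -
  have "2 * card E = (\<Sum>e\<in>E. card {u \<in> V. u \<in> e})"
  proof -
    have "card {u \<in> V. u \<in> e} = 2" if e: "e \<in> E" for e
    proof -
      obtain a b where "a \<noteq> b" "e \<inter> V = {a, b}" using edge_ends[OF e] by blast
      moreover have "{u \<in> V. u \<in> e} = e \<inter> V" by blast
      ultimately show ?thesis by simp
    qed
    then show ?thesis by simp
  qed
  also have "\<dots> = (\<Sum>u\<in>V. card {e \<in> E. u \<in> e})"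
    using sum_card_swap[OF fin(2,1), of "\<lambda>e u. u \<in> e"] .
  finally show ?thesis using degree by simp
qed

lemma gon_in_type:
  assumes "f \<in> F" shows "gon f \<in> set l"
proof -
  have "f \<inter> V \<noteq> {}" using gon_ge_3[OF assms] by (auto simp: gon_def)
  then obtain u where "u \<in> V" "u \<in> f" by blast
  then have "f \<in> {g \<in> F. u \<in> g \<and> gon g = gon f}" using assms by simp
  then have "card {g \<in> F. u \<in> g \<and> gon g = gon f} \<noteq> 0" by (subst card_0_eq) auto
  then have "count_list l (gon f) \<noteq> 0" using card_at_gon[OF \<open>u \<in> V\<close>] by simp
  then show ?thesis by (metis count_list_0_iff)
qed

lemma exists_gon:
  assumes "p \<in> set l" "u \<in> V" obtains f where "f \<in> F" "u \<in> f" "gon f = p"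
proof -
  have "card {f \<in> F. u \<in> f \<and> gon f = p} \<noteq> 0"
    using card_at_gon[OF assms(2)] assms(1) by (metis count_list_0_iff)
  then have "{f \<in> F. u \<in> f \<and> gon f = p} \<noteq> {}" by (metis card.empty)
  then show ?thesis using that by blast
qed

lemma exists_gon':
  assumes "p \<in> set l" obtains f where "f \<in> F" "gon f = p"
proof -
  obtain u where "u \<in> V" using V_ne by blast
  then obtain f where "f \<in> F" "u \<in> f" "gon f = p" by (rule exists_gon[OF assms])
  then show ?thesis using that by blast
qed

lemma type_ge_3: assumes "p \<in> set l" shows "3 \<le> p"
  by (rule exists_gon'[OF assms]) (use gon_ge_3 in blast)

text \<open>The vertices of the faces at \<open>u\<close>, each face with the edge it shares with the next one
  left out, are disjoint.\<close>

lemma card_V_ge: "1 + (\<Sum>p\<leftarrow>l. p - 2) \<le> card V"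
proof -
  obtain u where u: "u \<in> V" using V_ne by blast
  let ?d = "length l"
  obtain fs where fs: "distinct fs" "set fs = {f \<in> F. u \<in> f}" "map gon fs = l"
    and st: "\<forall>i < ?d. adj (fs ! i) (fs ! (Suc i mod ?d))"
    and un: "\<forall>i < ?d. \<forall>j < ?d. adj (fs ! i) (fs ! j) \<longrightarrow> j = Suc i mod ?d \<or> i = Suc j mod ?d"
    by (rule vertex_cycle[OF u])
  have len: "length fs = ?d" unfolding fs(3)[symmetric] by simp
  have d: "?d \<ge> 3" by (rule length_ge_3)
  have nx: "Suc i mod ?d < ?d" for i using d by (intro mod_less_divisor) linarith
  have mem: "fs ! i \<in> F" "u \<in> fs ! i" if "i < ?d" for i
    using fs(2) that len nth_mem[of i fs] by auto
  define W where "W i = (fs ! i \<inter> V) - fs ! (Suc i mod ?d)" for i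
  have cW: "card (W i) = l ! i - 2" if i: "i < ?d" for i
  proof -
    have "card (fs ! i \<inter> V - fs ! i \<inter> fs ! (Suc i mod ?d) \<inter> V) = card (fs ! i \<inter> V) - card (fs ! i \<inter> fs ! (Suc i mod ?d) \<inter> V)"
      by (rule card_Diff_subset) (auto simp: fin)
    moreover have "W i = fs ! i \<inter> V - fs ! i \<inter> fs ! (Suc i mod ?d) \<inter> V" by (auto simp: W_def)
    moreover have "card (fs ! i \<inter> fs ! (Suc i mod ?d) \<inter> V) = 2" using st i adj_card by blast
    moreover have "card (fs ! i \<inter> V) = l ! i" unfolding fs(3)[symmetric] gon_def[symmetric] using i len by simp
    ultimately show ?thesis by simp
  qed
  have uW: "u \<notin> W i" for i using mem(2)[OF nx[of i]] by (simp add: W_def)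
  \<comment> \<open>Two faces that share \<open>u\<close> and another vertex share an edge, so they
    are consecutive at \<open>u\<close>; but then the earlier of the two has lost all its points in
    the later one.\<close>
  have disj: "W i \<inter> W j = {}" if ij: "i < ?d" "j < ?d" "i \<noteq> j" for i j
  proof (rule ccontr)
    assume "W i \<inter> W j \<noteq> {}"
    then obtain x where x: "x \<in> W i" "x \<in> W j" by blast
    have ne: "fs ! i \<noteq> fs ! j" using fs(1) ij len by (simp add: nth_eq_iff_index_eq)
    have "fs ! i \<inter> fs ! j \<in> E"
    proof (rule faces_share_edge[OF mem(1)[OF ij(1)] mem(1)[OF ij(2)] ne])
      show "x \<in> fs ! i \<inter> fs ! j" using x by (simp add: W_def)
      show "u \<in> fs ! i \<inter> fs ! j" using mem ij by simp
      show "x \<noteq> u" using x uW by blast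
    qed
    then have "adj (fs ! i) (fs ! j)" using mem ij ne by (simp add: adj_def)
    then have "j = Suc i mod ?d \<or> i = Suc j mod ?d" using un ij by blast
    then show False using x by (auto simp: W_def)
  qed
  have "card (\<Union>i<?d. W i) = (\<Sum>i<?d. card (W i))"
    by (rule card_UN_disjoint) (use disj fin in \<open>auto simp: W_def\<close>)
  also have "\<dots> = (\<Sum>i<?d. l ! i - 2)" using cW by simp
  also have "\<dots> = (\<Sum>p\<leftarrow>l. p - 2)" by (simp add: sum_list_sum_nth atLeast0LessThan)
  finally have "card (insert u (\<Union>i<?d. W i)) = 1 + (\<Sum>p\<leftarrow>l. p - 2)"
    using uW fin by (subst card_insert_disjoint) (auto simp: W_def)
  moreover have "card (insert u (\<Union>i<?d. W i)) \<le> card V"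
    by (rule card_mono) (use u fin in \<open>auto simp: W_def\<close>)
  ultimately show ?thesis by simp
qed

lemma card_adj_at_gon:
  assumes u: "u \<in> V" and f: "f \<in> F" "u \<in> f"
  obtains a b where "(a, gon f, b) \<in> set (windows l)"
    "\<forall>Q. card {k \<in> F. u \<in> k \<and> adj f k \<and> Q (gon k)} = of_bool (Q a) + of_bool (Q b)"
proof -
  obtain g h where gh: "g \<noteq> h" "{k \<in> F. u \<in> k \<and> adj f k} = {g, h}"
    "(gon g, gon f, gon h) \<in> set (windows l)" by (rule window_gonE[OF u f])
  have "card {k \<in> F. u \<in> k \<and> adj f k \<and> Q (gon k)} = of_bool (Q (gon g)) + of_bool (Q (gon h))" for Q
  proof -
    have "{k \<in> F. u \<in> k \<and> adj f k \<and> Q (gon k)} = {k \<in> {g, h}. Q (gon k)}"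
      unfolding gh(2)[symmetric] by blast
    also have "\<dots> = (if Q (gon g) then {g} else {}) \<union> (if Q (gon h) then {h} else {})" by auto
    finally show ?thesis using gh(1) by auto
  qed
  then show ?thesis using that gh(3) by blast
qed

text \<open>Around a face of odd length the neighbours of a given size cannot alternate with the others.\<close>

lemma odd_face_window:
  assumes p: "p \<in> set l" "odd p"
  shows "\<exists>(x, y, z) \<in> set (windows l). y = p \<and> (x = a \<longleftrightarrow> z = a)"
proof (rule ccontr)
  assume A: "\<not> ?thesis"
  obtain f where f: "f \<in> F" "gon f = p" by (rule exists_gon'[OF p(1)])
  have "card {k \<in> F. u \<in> k \<and> adj f k \<and> gon k = a} = 1" if u: "u \<in> f \<inter> V" for u
  proof -
    have "u \<in> V" "u \<in> f" using u by auto
    from card_adj_at_gon[OF this(1) f(1) this(2)]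
    obtain x z where xz: "(x, gon f, z) \<in> set (windows l)"
      "\<forall>Q. card {k \<in> F. u \<in> k \<and> adj f k \<and> Q (gon k)} = of_bool (Q x) + of_bool (Q z)" .
    have "(x = a) \<noteq> (z = a)" using A xz(1) f(2) by fast
    then show ?thesis using spec[OF xz(2), of "\<lambda>y. y = a"] by auto
  qed
  then have "(\<Sum>u\<in>f \<inter> V. card {k \<in> F. u \<in> k \<and> adj f k \<and> gon k = a}) = (\<Sum>u\<in>f \<inter> V. 1)"
    by (rule sum.cong[OF refl])
  also have "\<dots> = p" using f(2) by (simp add: gon_def)
  \<comment> \<open>One such neighbour at every vertex gives the total \<open>p\<close>, which is
    odd, while each neighbour is counted twice.\<close>
  finally show False using sum_adj_at[OF f(1), of "\<lambda>k. gon k = a"] p(2) by (metis dvd_triv_left)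
qed

text \<open>Each of the \<open>q\<close>-gons that meet a given \<open>p\<close>-gon contains one of its vertices, or two if
  it shares an edge with it.\<close>

lemma incidence_bound:
  assumes p: "p \<in> set l" and c: "\<forall>(x, y, z) \<in> set (windows l). y = p \<longrightarrow> of_bool (x = q) + of_bool (z = q) \<le> c"
  shows "2 * p * (count_list l q - of_bool (p = q)) \<le> 2 * (card {f \<in> F. gon f = q} - of_bool (p = q)) + p * c"
proof -
  obtain f where f: "f \<in> F" "gon f = p" by (rule exists_gon'[OF p])
  let ?G = "{g \<in> F. gon g = q \<and> g \<noteq> f}"
  \<comment> \<open>For \<open>p = q\<close> the face \<open>f\<close> itself is among the
    \<open>q\<close>-gons and must not be counted as meeting itself; this is the origin of the
    corrections \<open>of_bool (p = q)\<close>.\<close>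
  have minus: "card {g \<in> F. P g \<and> gon g = q \<and> g \<noteq> f} = card {g \<in> F. P g \<and> gon g = q} - of_bool (p = q)"
    if Pf: "P f" for P
  proof (cases "p = q")
    case True
    have "{g \<in> F. P g \<and> gon g = q \<and> g \<noteq> f} = {g \<in> F. P g \<and> gon g = q} - {f}" by blast
    moreover have "f \<in> {g \<in> F. P g \<and> gon g = q}" using True f Pf by simp
    ultimately show ?thesis using True by (simp add: card_Diff_singleton)
  next
    case False
    then have "{g \<in> F. P g \<and> gon g = q \<and> g \<noteq> f} = {g \<in> F. P g \<and> gon g = q}" using f by auto
    then show ?thesis using False by simp
  qed
  have "p * (count_list l q - of_bool (p = q)) = (\<Sum>u\<in>f \<inter> V. card {g \<in> ?G. u \<in> g})"
  proof -
    have "card {g \<in> ?G. u \<in> g} = count_list l q - of_bool (p = q)" if "u \<in> f \<inter> V" for u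
    proof -
      have "{g \<in> ?G. u \<in> g} = {g \<in> F. u \<in> g \<and> gon g = q \<and> g \<noteq> f}" by blast
      then show ?thesis using minus[of "\<lambda>g. u \<in> g"] card_at_gon[of u q] that by simp
    qed
    then show ?thesis using f(2) by (simp add: gon_def)
  qed
  also have "\<dots> = (\<Sum>g\<in>?G. card {u \<in> f \<inter> V. u \<in> g})" by (rule sum_card_swap) auto
  also have "\<dots> \<le> (\<Sum>g\<in>?G. 1 + of_bool (adj f g))"
  proof (rule sum_mono)
    fix g assume g: "g \<in> ?G"
    have "{u \<in> f \<inter> V. u \<in> g} = f \<inter> g \<inter> V" by blast
    then show "card {u \<in> f \<inter> V. u \<in> g} \<le> 1 + of_bool (adj f g)"
      using adj_card[of f g] not_adj_card[OF f(1), of g] g by (cases "adj f g") auto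
  qed
  also have "\<dots> = card ?G + card {g \<in> ?G. adj f g}"
    using fin by (simp only: sum.distrib) (simp add: of_bool_def sum.If_cases Int_def conj_assoc)
  also have "\<dots> \<le> card {g \<in> F. gon g = q} - of_bool (p = q) + card {g \<in> F. adj f g \<and> gon g = q}"
    using minus[of "\<lambda>_. True"] by (intro add_mono card_mono) auto
  finally have 1: "p * (count_list l q - of_bool (p = q)) \<le>
    card {g \<in> F. gon g = q} - of_bool (p = q) + card {g \<in> F. adj f g \<and> gon g = q}" .
  have "2 * card {g \<in> F. adj f g \<and> gon g = q} = (\<Sum>u\<in>f \<inter> V. card {k \<in> F. u \<in> k \<and> adj f k \<and> gon k = q})"
    using sum_adj_at[OF f(1), of "\<lambda>k. gon k = q"] by simp
  also have "\<dots> \<le> (\<Sum>u\<in>f \<inter> V. c)"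
  proof (rule sum_mono)
    fix u assume u: "u \<in> f \<inter> V"
    then have "u \<in> V" "u \<in> f" by auto
    from card_adj_at_gon[OF this(1) f(1) this(2)]
    obtain x z where xz: "(x, gon f, z) \<in> set (windows l)"
      "\<forall>Q. card {k \<in> F. u \<in> k \<and> adj f k \<and> Q (gon k)} = of_bool (Q x) + of_bool (Q z)" .
    have "of_bool (x = q) + of_bool (z = q) \<le> c" using c xz(1) f(2) by fast
    then show "card {k \<in> F. u \<in> k \<and> adj f k \<and> gon k = q} \<le> c"
      using spec[OF xz(2), of "\<lambda>y. y = q"] by simp
  qed
  also have "\<dots> = p * c" using f(2) by (simp add: gon_def)
  finally have "2 * card {g \<in> F. adj f g \<and> gon g = q} \<le> p * c" .
  then show ?thesis using 1 by simp
qed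

end

subsection \<open>The types allowed by counting\<close>

text \<open>An evaluable list of the rearrangements of a multiset; \<open>remdups\<close> avoids
  trying equal heads repeatedly.\<close>

fun perms :: "nat \<Rightarrow> 'b list \<Rightarrow> 'b list list" where
  "perms 0 xs = [[]]"
| "perms (Suc n) xs = concat (map (\<lambda>x. map ((#) x) (perms n (remove1 x xs))) (remdups xs))"

lemma in_perms: "length ys = n \<Longrightarrow> mset ys = mset xs \<Longrightarrow> ys \<in> set (perms n xs)"
proof (induction n arbitrary: xs ys)
  case (Suc n)
  obtain y zs where ys: "ys = y # zs" using Suc.prems(1) by (metis length_Suc_conv)
  have "y \<in> set xs" using Suc.prems ys by (metis list.set_intros(1) set_mset_mset)
  moreover have "mset zs = mset (remove1 y xs)"
    using Suc.prems ys by (metis add_mset_remove_trivial mset.simps(2) mset_remove1)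
  ultimately show ?case using Suc.IH[of zs "remove1 y xs"] Suc.prems ys by auto
qed auto

text \<open>Evaluable form of \<open>odd_face_window\<close>. The checks are over the integers,
  where the subtractions of \<open>incidence_ok\<close> and \<open>search\<close> do not
  truncate.\<close>

definition parity_ok :: "int list \<Rightarrow> bool" where
  "parity_ok l \<longleftrightarrow> (\<forall>p \<in> set l. odd p \<longrightarrow> (\<forall>a \<in> set l.
     \<exists>(x, y, z) \<in> set (windows l). y = p \<and> (x = a \<longleftrightarrow> z = a)))"

text \<open>The best constant \<open>c\<close> for \<open>incidence_bound\<close>: the most
  \<open>q\<close>-gons next to a \<open>p\<close>-gon at a single vertex.\<close>

definition nbr_max :: "'b list \<Rightarrow> 'b \<Rightarrow> 'b \<Rightarrow> int" where
  "nbr_max l p q = foldr (\<lambda>(x, y, z) b. if y = p then max (of_bool (x = q) + of_bool (z = q)) b else b) (windows l) 0"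

text \<open>There are \<open>n * count_list l q div q\<close> faces of size \<open>q\<close>, which
  must be an integer; the inequality is \<open>incidence_bound\<close> for this number.\<close>

definition incidence_ok :: "int \<Rightarrow> int list \<Rightarrow> bool" where
  "incidence_ok n l \<longleftrightarrow> (\<forall>q \<in> set l. q dvd n * int (count_list l q) \<and> (\<forall>p \<in> set l.
     2 * p * (int (count_list l q) - of_bool (p = q)) \<le>
     2 * (n * int (count_list l q) div q - of_bool (p = q)) + p * nbr_max l p q))"

definition dihedral_images :: "'b list \<Rightarrow> 'b list list" where
  "dihedral_images l = map (\<lambda>k. rotate k l) [0..<length l] @ map (\<lambda>k. rotate k (rev l)) [0..<length l]"

text \<open>Each figure is paired with its number of vertices, the reciprocal of d/2 - 1 minus the
  sum of the 1/p. The ten types of the theorem come before the five figures that are refuted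
  separately.\<close>

definition candidates :: "(int \<times> int list) list" where
  "candidates = [(12, [3,4,3,4,4]), (12, [3,3,3,3,3,4]), (24, [3,4,8,4]), (48, [4,6,16]),
     (24, [6,6,8]), (20, [4,4,4,5]), (42, [6,6,7]), (42, [3,4,7,4]), (84, [4,6,14]), (40, [4,8,10]),
     (20, [5,8,8]), (15, [3,5,5,5]), (42, [3,3,3,3,7]), (24, [3,3,3,3,8]), (20, [3,3,4,3,5])]"

definition type_ok :: "int \<Rightarrow> int list \<Rightarrow> bool" where
  "type_ok n l \<longleftrightarrow> (parity_ok l \<longrightarrow> incidence_ok n l \<longrightarrow>
     (\<exists>(m, t) \<in> set candidates. m = n \<and> l \<in> set (dihedral_images t)))"

text \<open>\<open>search m k p N D C ps\<close> handles the choice of \<open>k\<close> further sizes \<open>q \<ge> p\<close> after \<open>ps\<close>, where the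
  \<open>1/q\<close> together with \<open>1/n\<close> must add up to \<open>N/D\<close>, and \<open>m\<close> is fuel. As \<open>n\<close> is at least \<open>C\<close> plus the
  sum of the \<open>q - 2\<close>, the sum is at most \<open>k/p + 1/(C + k(p - 2))\<close>, which stops the search.\<close>

fun search :: "nat \<Rightarrow> nat \<Rightarrow> int \<Rightarrow> int \<Rightarrow> int \<Rightarrow> int \<Rightarrow> int list \<Rightarrow> bool" where
  "search 0 k p N D C ps = False"
| "search (Suc m) k p N D C ps =
    (if k = 0 then (N > 0 \<and> N dvd D \<longrightarrow> (\<forall>l \<in> set (perms (length ps) ps). type_ok (D div N) l))
     else if N \<le> 0 \<or> int k * D * (C + int k * (p - 2)) + p * D < N * p * (C + int k * (p - 2)) then True
     else search m k (p + 1) N D C ps \<and> search m (k - 1) p (N * p - D) (D * p) (C + p - 2) (p # ps))"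

text \<open>For degree d the reciprocals of the sizes and of \<open>n\<close> add up to (d - 2)/2,
  and the lower bound for \<open>n\<close> starts at 1, for the vertex itself. The fuel 200 suffices
  in all four cases.\<close>

lemma search_3: "search 200 3 3 1 2 1 []" by code_simp
lemma search_4: "search 200 4 3 2 2 1 []" by code_simp
lemma search_5: "search 200 5 3 3 2 1 []" by code_simp
lemma search_6: "search 200 6 3 4 2 1 []" by code_simp

text \<open>Here \<open>r\<close> is the sorted list of sizes still to be chosen. The assumptions
  are the invariant of the search: \<open>N/D\<close> is what the reciprocals of \<open>r\<close>
  and of \<open>n\<close> must add up to, and \<open>C\<close> collects the chosen part of the lower
  bound for \<open>n\<close>. Either the least entry of \<open>r\<close> is \<open>p\<close> and
  moves to \<open>ps\<close>, or all entries exceed \<open>p\<close>.\<close>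

lemma search_sound:
  assumes "search m k p N D C ps" "p \<ge> 3" "D > 0" "n > 0" "length r = k" "sorted r" "\<forall>q \<in> set r. p \<le> q"
    "real_of_int N / real_of_int D = (\<Sum>q\<leftarrow>r. 1 / real_of_int q) + 1 / real_of_int n"
    "C + (\<Sum>q\<leftarrow>r. q - 2) \<le> n" "C > 0" "mset l = mset (r @ ps)"
  shows "type_ok n l"
  using assms
proof (induction m k p N D C ps arbitrary: r rule: search.induct)
  case (2 m k p N D C ps)
  note P = "2.prems"(2-)
  have srch: "search (Suc m) k p N D C ps" by (rule "2.prems"(1))
  show ?case
  proof (cases "k = 0")
    case True
    then have r: "r = []" using P by simp
    then have "real_of_int N / real_of_int D = 1 / real_of_int n" using P by simp
    then have "real_of_int (N * n) = real_of_int D" using P by (simp add: field_simps)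
    then have D: "D = N * n" by (simp only: of_int_eq_iff)
    then have "N > 0" using P by (simp add: zero_less_mult_iff)
    moreover have "l \<in> set (perms (length ps) ps)"
      using P r by (intro in_perms) (auto dest: mset_eq_length)
    ultimately show ?thesis using srch True D by simp
  next
    case False
    then obtain q r' where r: "r = q # r'" using P by (cases r) auto
    have rp: "p \<le> x" if "x \<in> set r" for x using P that by blast
    define W where "W = C + int k * (p - 2)"
    have sum1: "(\<Sum>q\<leftarrow>r. 1 / real_of_int q) \<le> (\<Sum>q\<leftarrow>r. 1 / real_of_int p)"
      using rp \<open>3 \<le> p\<close> by (intro sum_list_mono) (simp add: frac_le)
    have sum1': "(\<Sum>q\<leftarrow>r. 1 / real_of_int p) = real k / real_of_int p"
      using P by (simp add: sum_list_triv)
    have sum0: "0 \<le> (\<Sum>q\<leftarrow>r. 1 / real_of_int q)"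
      using rp \<open>3 \<le> p\<close> by (intro sum_list_nonneg) force
    have sum2: "(\<Sum>q\<leftarrow>r. p - 2) \<le> (\<Sum>q\<leftarrow>r. q - 2)" using rp by (intro sum_list_mono) auto
    then have W: "W \<le> n" using P by (simp add: W_def sum_list_triv)
    have W0: "W > 0" using P by (simp add: W_def add_pos_nonneg)
    have "1 / real_of_int n \<le> 1 / real_of_int W" using W W0 by (simp add: frac_le)
    then have le: "real_of_int N / real_of_int D \<le> real k / real_of_int p + 1 / real_of_int W"
      using P sum1 sum1' by linarith
    have "real_of_int N / real_of_int D > 0" using P sum0 by (simp add: add_nonneg_pos)
    then have N: "N > 0" using P(2) by (simp add: zero_less_divide_iff)
    \<comment> \<open>Multiplying the bound \<open>le\<close> by the positive denominators gives the
      integer inequality whose failure makes \<open>search\<close> stop.\<close>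
    have "real_of_int (N * p * W) = real_of_int N / real_of_int D * (D * p * W)"
      using P(2) by simp
    also have "\<dots> \<le> (real k / real_of_int p + 1 / real_of_int W) * (D * p * W)"
      using P(1,2) W0 by (intro mult_right_mono[OF le]) auto
    also have "\<dots> = real_of_int (int k * D * W + p * D)"
      using P(1,2) W0 by (simp add: field_simps)
    finally have "N * p * W \<le> int k * D * W + p * D" by (simp only: of_int_le_iff)
    then have rec: "search m k (p + 1) N D C ps" "search m (k - 1) p (N * p - D) (D * p) (C + p - 2) (p # ps)"
      and np: "\<not> (N \<le> 0 \<or> int k * D * (C + int k * (p - 2)) + p * D < N * p * (C + int k * (p - 2)))"
      using srch False N by (auto simp: W_def split: if_splits)
    show ?thesis
    proof (cases "q = p")
      case True
      have "real_of_int (N * p - D) / real_of_int (D * p) = real_of_int N / real_of_int D - 1 / real_of_int p"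
        using P(1,2) by (simp add: field_simps)
      also have "\<dots> = (\<Sum>q\<leftarrow>r'. 1 / real_of_int q) + 1 / real_of_int n"
        using P(7) r True by simp
      finally have eq: "real_of_int (N * p - D) / real_of_int (D * p) = \<dots>" .
      show ?thesis
        by (rule "2.IH"(2)[OF False np rec(2), of r']) (use P(1-6,8-10) r True eq in auto)
    next
      case False': False
      have "p + 1 \<le> x" if x: "x \<in> set r" for x
      proof -
        have "p + 1 \<le> q" using rp[of q] r False' by simp
        moreover have "q \<le> x" using x P(5) r by auto
        ultimately show ?thesis by simp
      qed
      then show ?thesis
        by (intro "2.IH"(1)[OF False np rec(1), of r]) (use P in auto)
    qed
  qed
qed simp

section \<open>Applying the search to an actual map\<close>

lemma windows_map: "windows (map g l) = map (\<lambda>(x, y, z). (g x, g y, g z)) (windows l)"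
proof (cases "l = []")
  case False
  then have "windows (map g l) = zip (map g (last l # butlast l)) (zip (map g l) (map g (tl l @ [hd l])))"
    by (simp add: windows_def last_map map_butlast hd_map map_tl)
  also have "\<dots> = map (\<lambda>(x, y, z). (g x, g y, g z)) (windows l)"
    unfolding windows_def zip_map_map by (simp add: case_prod_unfold)
  finally show ?thesis .
qed (simp add: windows_def)

lemma nbr_max_ge:
  assumes "(x, p, z) \<in> set (windows l)"
  shows "of_bool (x = q) + of_bool (z = q) \<le> nbr_max l p q"
proof -
  have "(x, p, z) \<in> set ws \<Longrightarrow> of_bool (x = q) + of_bool (z = q) \<le>
    foldr (\<lambda>(x, y, z) b. if y = p then max (of_bool (x = q) + of_bool (z = q) :: int) b else b) ws 0" for ws
    by (induction ws) (auto simp del: of_bool_eq_iff intro: max.coboundedI1 max.coboundedI2)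
  then show ?thesis using assms unfolding nbr_max_def by blast
qed

lemma nbr_max_nonneg: "0 \<le> nbr_max l p q"
proof -
  have "(0::int) \<le> foldr (\<lambda>(x, y, z) b. if y = p then max (of_bool (x = q) + of_bool (z = q)) b else b) ws 0" for ws
    by (induction ws) (auto simp del: of_bool_eq_iff intro: max.coboundedI2)
  then show ?thesis unfolding nbr_max_def .
qed

lemma count_list_map_int: "count_list (map int l) (int q) = count_list l q"
  by (induction l) auto

lemma sum_list_sort: "(\<Sum>q\<leftarrow>sort l. w q) = (\<Sum>q\<leftarrow>l. w q :: 'b :: comm_monoid_add)"
  unfolding sum_mset_sum_list[symmetric] by simp

locale euler_map = semi_equivelar_map +
  assumes euler: "int (card V) - int (card E) + int (card F) = -1"
begin

lemma euler_real: "real (card V) * (real (length l) / 2 - 1 - (\<Sum>p\<leftarrow>l. 1 / real p)) = 1"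
proof -
  have "real (card V) - real (card E) + real (card F) = -1" using euler by linarith
  moreover have "2 * real (card E) = real (card V) * real (length l)"
    using card_E by (metis of_nat_mult of_nat_numeral)
  ultimately show ?thesis using card_F by (simp add: algebra_simps)
qed

lemma card_V_pos: "card V > 0"
  using V_ne fin by (simp add: card_gt_0_iff)

text \<open>For degree d at least 7, all sizes being at least 3, the factor in Euler's formula is at
  least d/6 - 1, so at least 1/6, while there are at least 8 vertices; the product exceeds
  1.\<close>

lemma length_le_6: "length l \<le> 6"
proof (rule ccontr)
  let ?d = "real (length l)" and ?n = "real (card V)"
  assume "\<not> ?thesis"
  then have d: "?d \<ge> 7" by simp
  have "(\<Sum>p\<leftarrow>l. 1 / real p) \<le> (\<Sum>p\<leftarrow>l. 1 / 3)"
    using type_ge_3 by (intro sum_list_mono) (force simp: field_simps)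
  then have s: "(\<Sum>p\<leftarrow>l. 1 / real p) \<le> ?d / 3" by (simp add: sum_list_triv)
  have "(\<Sum>p\<leftarrow>l. 1) \<le> (\<Sum>p\<leftarrow>l. p - 2)"
    using type_ge_3 by (intro sum_list_mono) force
  then have "1 + length l \<le> card V" using card_V_ge by (simp add: sum_list_triv)
  then have n: "?n \<ge> 8" using d by linarith
  have "8 * (1 / 6) \<le> ?n * (?d / 2 - 1 - (\<Sum>p\<leftarrow>l. 1 / real p))"
    using n d s by (intro mult_mono) auto
  then show False using euler_real by simp
qed

lemma search_type:
  assumes "search m (length l) 3 (int (length l) - 2) 2 1 []"
  shows "type_ok (int (card V)) (map int l)"
proof (rule search_sound[OF assms])
  \<comment> \<open>The search chooses sizes in increasing order, and restores the cyclic order only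
    at its leaves through \<open>perms\<close>.\<close>
  let ?r = "map int (sort l)"
  show "sorted ?r" by (simp add: sorted_map)
  show "\<forall>q \<in> set ?r. 3 \<le> q" using type_ge_3 by auto
  have 1: "(\<Sum>q\<leftarrow>?r. 1 / real_of_int q) = (\<Sum>q\<leftarrow>l. 1 / real q)"
    using sum_list_sort[of "\<lambda>q. 1 / real q" l] by (simp add: o_def)
  have "real (length l) / 2 - 1 - (\<Sum>p\<leftarrow>l. 1 / real p) = 1 / real (card V)"
    using euler_real card_V_pos by (simp add: field_simps)
  then show "real_of_int (int (length l) - 2) / real_of_int 2 =
    (\<Sum>q\<leftarrow>?r. 1 / real_of_int q) + 1 / real_of_int (int (card V))"
    unfolding 1 by (simp add: field_simps)
  have "(\<Sum>q\<leftarrow>?r. q - 2) = (\<Sum>q\<leftarrow>l. int q - 2)"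
    using sum_list_sort[of "\<lambda>q. int q - 2" l] by (simp add: o_def)
  also have "\<dots> = (\<Sum>q\<leftarrow>l. int (q - 2))"
    by (rule arg_cong[where f = sum_list]) (auto intro!: map_cong dest!: type_ge_3)
  also have "\<dots> = int (\<Sum>q\<leftarrow>l. q - 2)" by (induction l) auto
  finally show "1 + (\<Sum>q\<leftarrow>?r. q - 2) \<le> int (card V)" using card_V_ge by linarith
  show "mset (map int l) = mset (?r @ [])" by simp
qed (use card_V_pos in auto)

lemma type_parity: "parity_ok (map int l)"
proof -
  have "\<exists>(x, y, z) \<in> set (windows (map int l)). y = int p \<and> (x = int a \<longleftrightarrow> z = int a)"
    if p: "p \<in> set l" "odd p" for p a
    using odd_face_window[OF p, of a] unfolding windows_map by force
  then show ?thesis by (auto simp: parity_ok_def)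
qed

lemma type_incidence: "incidence_ok (int (card V)) (map int l)"
proof -
  have "int q dvd int (card V) * int (count_list l q) \<and>
     2 * int p * (int (count_list l q) - of_bool (p = q)) \<le>
     2 * (int (card V) * int (count_list l q) div int q - of_bool (p = q)) + int p * nbr_max (map int l) (int p) (int q)"
    if p: "p \<in> set l" and q: "q \<in> set l" for p q
  proof -
    let ?N = "card {f \<in> F. gon f = q}" and ?c = "nat (nbr_max (map int l) (int p) (int q))"
    have eq: "int (card V) * int (count_list l q) = int q * int ?N"
      using card_gon[of q] by (metis of_nat_mult)
    have q3: "q > 0" using type_ge_3[OF q] by simp
    \<comment> \<open>Since this count and \<open>?N\<close> are positive, subtracting
      \<open>of_bool (p = q)\<close> does not truncate and the inequality carries over to the
      integers.\<close>
    have cnt: "count_list l q \<ge> 1" using q by (metis count_list_0_iff less_one not_le)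
    have "q * ?N \<noteq> 0" using card_gon[of q] cnt card_V_pos by auto
    then have "1 \<le> ?N" by (metis mult_0_right less_one not_le)
    moreover have "2 * p * (count_list l q - of_bool (p = q)) \<le> 2 * (?N - of_bool (p = q)) + p * ?c"
    proof (rule incidence_bound[OF p], clarify)
      fix x z assume "(x, p, z) \<in> set (windows l)"
      then have "(int x, int p, int z) \<in> set (windows (map int l))" unfolding windows_map by force
      from nbr_max_ge[OF this, of "int q"]
      show "of_bool (x = q) + of_bool (z = q) \<le> ?c"
        by (simp add: of_bool_def split: if_splits)
    qed
    then have "int (2 * p * (count_list l q - of_bool (p = q))) \<le> int (2 * (?N - of_bool (p = q)) + p * ?c)"
      by (simp only: of_nat_le_iff)
    ultimately have "2 * int p * (int (count_list l q) - of_bool (p = q)) \<le>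
       2 * (int ?N - of_bool (p = q)) + int p * nbr_max (map int l) (int p) (int q)"
      using cnt nbr_max_nonneg[of "map int l" "int p" "int q"]
      by (cases "p = q") (simp_all add: of_nat_diff del: card_0_eq One_nat_def)
    then show ?thesis using q3 unfolding eq by simp
  qed
  then show ?thesis unfolding incidence_ok_def by (auto simp: count_list_map_int)
qed

lemma type_candidate:
  "\<exists>(m, t) \<in> set candidates. m = int (card V) \<and> map int l \<in> set (dihedral_images t)"
proof -
  consider "length l = 3" | "length l = 4" | "length l = 5" | "length l = 6"
    using length_ge_3 length_le_6 by linarith
  then have "\<exists>m. search m (length l) 3 (int (length l) - 2) 2 1 []"
    by cases (use search_3 search_4 search_5 search_6 in \<open>fastforce simp del: search.simps\<close>)+
  then obtain m where "search m (length l) 3 (int (length l) - 2) 2 1 []" by blast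
  from search_type[OF this] show ?thesis
    using type_parity type_incidence unfolding type_ok_def by blast
qed

end

subsection \<open>Signs of rotations\<close>

lemma sign_cycle_of_list:
  assumes "distinct cs" shows "sign (cycle_of_list cs) = (- 1) ^ (length cs - 1)"
  using assms
proof (induction cs rule: cycle_of_list.induct)
  case (1 i j cs)
  then have "sign (Transposition.transpose i j \<circ> cycle_of_list (j # cs)) = - 1 * (- 1) ^ length cs"
    by (subst sign_compose) (auto simp: permutation_swap_id permutation_of_cycle sign_swap_id)
  then show ?case by (simp add: comp_def)
qed simp_all

text \<open>List the iterates of one point of \<open>A\<close>. Both \<open>q\<close> and
  \<open>cycle_of_list\<close> of this list rotate it by one place and fix everything else, so they
  coincide.\<close>

lemma sign_cyclic_on:
  assumes q: "q permutes A" "finite A" and c: "cyclic_on q A"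
  shows "sign q = (- 1) ^ (card A - 1)"
proof -
  obtain v where v: "v \<in> A" "orbit q v = A" using c by (auto simp: cyclic_on_def)
  define m where "m = funpow_dist1 q v v"
  let ?cs = "map (\<lambda>n. (q ^^ n) v) [0..<m]"
  have self: "v \<in> orbit q v" using v by simp
  have set: "set ?cs = A" using orbit_conv_funpow_dist1[OF self] v(2) by (simp add: m_def del: upt_Suc)
  have dist: "distinct ?cs" using inj_on_funpow_dist1[OF self] by (simp add: distinct_map m_def del: upt_Suc)
  have len: "length ?cs = card A" using distinct_card[OF dist] set by simp
  have m: "m > 0" "(q ^^ m) v = v" using funpow_dist1_prop[OF self] by (simp_all add: m_def)
  have "map (cycle_of_list ?cs) ?cs = rotate1 ?cs"
    using cyclic_rotation[OF dist, of 1] by simp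
  moreover have "rotate1 ?cs = map q ?cs"
  proof (rule nth_equalityI)
    fix i assume "i < length (rotate1 ?cs)"
    then have i: "i < m" by simp
    show "rotate1 ?cs ! i = map q ?cs ! i"
    proof (cases "Suc i = m")
      case True
      then have "q ((q ^^ i) v) = v" using m(2) by (metis funpow.simps(2) o_apply)
      then show ?thesis using i True m(1) by (simp add: nth_rotate1)
    next
      case False
      then show ?thesis using i by (simp add: nth_rotate1)
    qed
  qed simp
  ultimately have "map (cycle_of_list ?cs) ?cs = map q ?cs" by simp
  then have "cycle_of_list ?cs x = q x" if "x \<in> A" for x
    using that unfolding map_eq_conv set by blast
  moreover have "cycle_of_list ?cs x = q x" if "x \<notin> A" for x
    using that id_outside_supp[of x ?cs] q(1) unfolding set by (simp add: permutes_def)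
  ultimately have "cycle_of_list ?cs = q" by (intro ext) blast
  then show ?thesis using sign_cycle_of_list[OF dist] len by simp
qed

text \<open>Split off one orbit: \<open>q\<close> is the product of its restrictions to the orbit
  and to the rest. Each orbit contributes a cycle of length \<open>m\<close>, and there are
  \<open>card A div m\<close> of them.\<close>

lemma sign_equal_orbits:
  assumes "finite A" "q permutes A" "\<forall>v \<in> A. card (orbit q v) = m"
  shows "m dvd card A \<and> sign q = (- 1) ^ ((m - 1) * (card A div m))"
  using assms
proof (induction A arbitrary: q rule: finite_psubset_induct)
  case (psubset A)
  show ?case
  proof (cases "A = {}")
    case True
    then show ?thesis using psubset.prems by simp
  next
    case False
    then obtain v where v: "v \<in> A" by blast
    let ?O = "orbit q v" and ?r = "perm_restrict q (A - orbit q v)"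
    have cyc: "cyclic_on q ?O" by (rule cyclic_on_orbit[OF psubset.prems(1) psubset.hyps(1)])
    have OA: "?O \<subseteq> A" using permutes_orbit_subset[OF psubset.prems(1) v] .
    have vO: "v \<in> ?O"
      by (rule permutation_self_in_orbit[OF permutes_imp_permutation[OF psubset.hyps(1) psubset.prems(1)]])
    have finO: "finite ?O" by (rule finite_subset[OF OA psubset.hyps(1)])
    have r: "?r permutes (A - ?O)" by (rule perm_restrict_diff_cyclic[OF psubset.prems(1) cyc])
    have "perm_restrict q (A - (A - ?O)) permutes (A - (A - ?O))"
    proof (rule bij_imp_permutes)
      have OO: "A - (A - ?O) = ?O" using OA by blast
      have "q ` ?O = ?O"
      proof (rule card_subset_eq[OF finO])
        show "q ` ?O \<subseteq> ?O" by (auto intro: cyclic_on_inI[OF cyc])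
        show "card (q ` ?O) = card ?O"
          by (rule card_image) (rule inj_on_subset[OF permutes_inj[OF psubset.prems(1)] subset_UNIV])
      qed
      then have "bij_betw q ?O ?O"
        unfolding bij_betw_def by (intro conjI inj_on_subset[OF permutes_inj[OF psubset.prems(1)] subset_UNIV])
      then show "bij_betw (perm_restrict q (A - (A - ?O))) (A - (A - ?O)) (A - (A - ?O))"
        unfolding OO by (subst bij_betw_cong[of _ _ q]) (auto simp: perm_restrict_def)
    qed (simp add: perm_restrict_def)
    then have o: "perm_restrict q ?O permutes ?O" using OA by (simp add: double_diff)
    have "perm_restrict q ?O \<circ> ?r = perm_restrict q (?O \<union> (A - ?O))"
      by (rule perm_restrict_union[OF o r]) blast
    also have "?O \<union> (A - ?O) = A" using OA by blast
    also have "perm_restrict q A = q" using psubset.prems(1) by simp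
    finally have eq: "q = perm_restrict q ?O \<circ> ?r" ..
    have "sign q = sign (perm_restrict q ?O) * sign ?r"
      by (subst eq, rule sign_compose)
         (rule permutes_imp_permutation[OF finO o] permutes_imp_permutation[OF finite_Diff[OF psubset.hyps(1)] r])+
    moreover have "sign (perm_restrict q ?O) = (- 1) ^ (m - 1)"
      using cyc psubset.prems(2) v by (subst sign_cyclic_on[OF o finO]) (simp_all add: cyclic_on_perm_restrict)
    moreover have IH: "m dvd card (A - ?O) \<and> sign ?r = (- 1) ^ ((m - 1) * (card (A - ?O) div m))"
    proof (rule psubset.IH[OF _ r])
      show "A - ?O \<subset> A" using v vO by blast
      show "\<forall>w \<in> A - ?O. card (orbit ?r w) = m"
      proof
        fix w assume w: "w \<in> A - ?O"
        have "w \<in> orbit ?r w"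
          by (rule permutation_self_in_orbit[OF permutes_imp_permutation[OF finite_Diff[OF psubset.hyps(1)] r]])
        then have eq: "orbit q w = orbit ?r w"
          by (rule orbit_cong) (use permutes_orbit_subset[OF r w] in \<open>auto simp: perm_restrict_def\<close>)
        have "card (orbit q w) = m" using psubset.prems(2) w by blast
        then show "card (orbit ?r w) = m" unfolding eq .
      qed
    qed
    moreover have m: "card A = m + card (A - ?O)" "m > 0"
    proof -
      have "card (A - ?O) = card A - card ?O" by (rule card_Diff_subset[OF finO OA])
      moreover have "card ?O \<le> card A" by (rule card_mono[OF psubset.hyps(1) OA])
      ultimately show "card A = m + card (A - ?O)" using psubset.prems(2) v by simp
      have "card ?O > 0" using finO vO by (auto simp: card_gt_0_iff)
      then show "m > 0" using psubset.prems(2) v by simp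
    qed
    ultimately have s: "sign q = (- 1) ^ (m - 1) * (- 1) ^ ((m - 1) * (card (A - ?O) div m))" by simp
    have "card A div m = Suc (card (A - ?O) div m)" using m by simp
    then have "(m - 1) * (card A div m) = (m - 1) + (m - 1) * (card (A - ?O) div m)" by simp
    then have "sign q = (- 1) ^ ((m - 1) * (card A div m))" unfolding s by (simp only: power_add)
    moreover have "m dvd card A" using IH m(1) by simp
    ultimately show ?thesis by blast
  qed
qed

section \<open>Rotations of faces and tools for local configurations\<close>

context poly_map
begin

text \<open>The map moves each vertex along an edge of its face. Because
  \<open>\<rho> (\<rho> v) \<noteq> v\<close>, the edges towards the image and from the preimage are
  different, so they are both boundary edges at that vertex. Hence the orbit is closed under
  boundary edges and \<open>face_boundary_connected\<close> applies.\<close>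

lemma rotation_orbit:
  assumes \<rho>: "\<rho> permutes V"
    and G: "\<forall>v \<in> V. G v \<in> F \<and> v \<in> G v \<and> G (\<rho> v) = G v"
    and ed: "\<forall>v \<in> V. \<exists>e \<in> E. e \<subseteq> G v \<and> e \<inter> V = {v, \<rho> v}"
    and no2: "\<forall>v \<in> V. \<rho> v \<noteq> v \<and> \<rho> (\<rho> v) \<noteq> v"
    and v: "v \<in> V"
  shows "orbit \<rho> v = G v \<inter> V"
proof (rule face_boundary_connected)
  have perm: "permutation \<rho>" by (rule permutes_imp_permutation[OF fin(1) \<rho>])
  have OV: "orbit \<rho> v \<subseteq> V" by (rule permutes_orbit_subset[OF \<rho> v])
  have GO: "G y = G v" if "y \<in> orbit \<rho> v" for y
    using that
  proof induction
    case base then show ?case using G v by simp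
  next
    case (step y) then show ?case using G OV by auto
  qed
  show "G v \<in> F" using G v by blast
  show "orbit \<rho> v \<subseteq> G v \<inter> V" using GO G OV by blast
  show "orbit \<rho> v \<noteq> {}" by (rule orbit_nonempty)
  fix e assume e: "e \<in> E" "e \<subseteq> G v" "e \<inter> orbit \<rho> v \<noteq> {}"
  then obtain y where y: "y \<in> e" "y \<in> orbit \<rho> v" by blast
  define z where "z = inv \<rho> y"
  have z: "\<rho> z = y" unfolding z_def using \<rho> by (simp add: permutes_inverses)
  have zO: "z \<in> orbit \<rho> v"
  proof -
    have "z \<in> orbit (inv \<rho>) y" unfolding z_def by (rule orbit.base)
    then have "z \<in> orbit \<rho> y" by (simp add: orbit_inv_eq[OF perm])
    then show ?thesis using y(2) by (rule orbit_trans)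
  qed
  have yV: "y \<in> V" "z \<in> V" using y zO OV by auto
  obtain e1 where e1: "e1 \<in> E" "e1 \<subseteq> G v" "e1 \<inter> V = {y, \<rho> y}" using ed yV GO[OF y(2)] by metis
  obtain e2 where e2: "e2 \<in> E" "e2 \<subseteq> G v" "e2 \<inter> V = {z, y}" using ed yV GO[OF zO] z by metis
  have "\<rho> y \<noteq> z" using no2 yV z by metis
  then have ne: "e1 \<noteq> e2" using e1 e2 no2 yV by (metis doubleton_eq_iff)
  have "card {e \<in> E. y \<in> e \<and> e \<subseteq> G v} = 2"
    by (rule card_face_edges_at) (use G v GO[OF y(2)] yV in auto)
  moreover have sub: "{e1, e2} \<subseteq> {e \<in> E. y \<in> e \<and> e \<subseteq> G v}" using e1 e2 by auto
  ultimately have "{e1, e2} = {e \<in> E. y \<in> e \<and> e \<subseteq> G v}"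
    using ne by (intro card_subset_eq) auto
  then have "e \<in> {e1, e2}" using e y by blast
  moreover have "\<rho> y \<in> orbit \<rho> v" using y(2) by (rule orbit.step)
  moreover from calculation(1) have "e \<inter> V = {y, \<rho> y} \<or> e \<inter> V = {z, y}" using e1(3) e2(3) by blast
  ultimately show "e \<inter> V \<subseteq> orbit \<rho> v" using y(2) zO by auto
qed

lemma adjD: assumes "adj f g" shows "f \<in> F" "g \<in> F" "f \<noteq> g"
  using assms by (simp_all add: adj_def)

lemma adj_edgeE:
  assumes "adj f g" "u \<in> f" "u \<in> g" "u \<in> V"
  obtains y where "y \<noteq> u" "f \<inter> g \<inter> V = {u, y}" "y \<in> V" "y \<in> f" "y \<in> g"
proof -
  have "f \<inter> g \<in> E" using assms by (simp add: adj_def)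
  from edge_ends[OF this] obtain a b where ab: "a \<noteq> b" "f \<inter> g \<inter> V = {a, b}" by blast
  have "u \<in> {a, b}" using ab(2) assms by blast
  then have "\<exists>y. y \<noteq> u \<and> f \<inter> g \<inter> V = {u, y}" using ab by auto
  then obtain y where "y \<noteq> u" "f \<inter> g \<inter> V = {u, y}" by blast
  then show ?thesis using that by blast
qed

lemma adj_edge_unique':
  assumes "adj f g" "adj f h" "f \<inter> g \<inter> V = f \<inter> h \<inter> V" shows "g = h"
proof (rule adj_edge_unique[OF assms(1,2)])
  have "f \<inter> g \<in> E" "f \<inter> h \<in> E" using assms(1,2) by (simp_all add: adj_def)
  then show "f \<inter> g = f \<inter> h" using assms(3) by (rule edge_eqI)
qed

lemma adjI:
  assumes "f \<in> F" "g \<in> F" "f \<noteq> g" "a \<in> f" "a \<in> g" "b \<in> f" "b \<in> g" "a \<noteq> b"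
  shows "adj f g"
  using faces_share_edge[of f g a b] assms by (simp add: adj_def)

lemma triangle_eq:
  assumes "gon T = 3" "a \<in> T" "b \<in> T" "c \<in> T" "a \<in> V" "b \<in> V" "c \<in> V" "a \<noteq> b" "a \<noteq> c" "b \<noteq> c"
  shows "T \<inter> V = {a, b, c}"
proof (rule sym, rule card_subset_eq)
  show "{a, b, c} \<subseteq> T \<inter> V" using assms by blast
  show "card {a, b, c} = card (T \<inter> V)" using assms(1,8-10) by (simp add: gon_def)
qed simp

lemma triangle_thirdE:
  assumes "gon T = 3" "a \<in> T" "b \<in> T" "a \<in> V" "b \<in> V" "a \<noteq> b"
  obtains c where "T \<inter> V = {a, b, c}" "c \<noteq> a" "c \<noteq> b" "c \<in> V" "c \<in> T"
proof -
  have "card (T \<inter> V - {a, b}) = 1" using assms by (subst card_Diff_subset) (auto simp: gon_def)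
  then obtain c where c: "T \<inter> V - {a, b} = {c}" by (auto simp: card_1_singleton_iff)
  then have "c \<in> T \<inter> V - {a, b}" by simp
  then show ?thesis using that[of c] c assms by blast
qed

end

context semi_equivelar_map
begin

lemma five_cycleE:
  assumes len: "length l = 5" and u: "u \<in> V"
  obtains f0 f1 f2 f3 f4 where "distinct [f0, f1, f2, f3, f4]" "{f \<in> F. u \<in> f} = {f0, f1, f2, f3, f4}"
    "l = [gon f0, gon f1, gon f2, gon f3, gon f4]"
    "adj f0 f1" "adj f1 f2" "adj f2 f3" "adj f3 f4" "adj f4 f0"
    "\<not> adj f0 f2" "\<not> adj f0 f3" "\<not> adj f1 f3" "\<not> adj f1 f4" "\<not> adj f2 f4"
proof -
  obtain fs where fs: "distinct fs" "set fs = {f \<in> F. u \<in> f}" "map gon fs = l"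
    and st: "\<forall>i < length l. adj (fs ! i) (fs ! (Suc i mod length l))"
    and un: "\<forall>i < length l. \<forall>j < length l. adj (fs ! i) (fs ! j) \<longrightarrow> j = Suc i mod length l \<or> i = Suc j mod length l"
    by (rule vertex_cycle[OF u])
  have "length fs = 5" using fs(3) len by (metis length_map)
  then obtain f0 f1 f2 f3 f4 where f: "fs = [f0, f1, f2, f3, f4]"
    by (auto simp: length_Suc_conv eval_nat_numeral)
  show ?thesis
  proof (rule that)
    show "distinct [f0, f1, f2, f3, f4]" using fs(1) f by simp
    show "{f \<in> F. u \<in> f} = {f0, f1, f2, f3, f4}" using fs(2) f by simp
    show "l = [gon f0, gon f1, gon f2, gon f3, gon f4]" using fs(3) f by simp
    note st' = st[unfolded len f, rule_format]
    show "adj f0 f1" "adj f1 f2" "adj f2 f3" "adj f3 f4" "adj f4 f0"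
      using st'[of 0] st'[of 1] st'[of 2] st'[of 3] st'[of 4] by simp_all
    note un' = un[unfolded len f, rule_format]
    show "\<not> adj f0 f2" "\<not> adj f0 f3" "\<not> adj f1 f3" "\<not> adj f1 f4" "\<not> adj f2 f4"
      using un'[of 0 2] un'[of 0 3] un'[of 1 3] un'[of 1 4] un'[of 2 4] by auto
  qed
qed

end

subsection \<open>The types $[3,3,3,3,p]$\<close>

text \<open>A vertex figure \<open>[3,3,3,3,p]\<close> turns out to be chiral: exactly one of the two triangles that
  are not next to the \<open>p\<close>-gon shares an edge with another \<open>p\<close>-gon. This orients every \<open>p\<close>-gon, and
  with \<open>\<sigma>\<close> the rotation of the \<open>p\<close>-gons and \<open>\<alpha>\<close> the involution pairing the ends of the
  diagonals, \<open>\<sigma> \<circ> \<alpha>\<close> rotates the remaining triangles. Signs of permutations give a contradiction.\<close>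

locale snub_map = euler_map +
  fixes p :: nat
  assumes l: "l = [3, 3, 3, 3, p]" and p3: "3 < p"
begin

definition near :: "'a set \<Rightarrow> bool" where
  "near T \<longleftrightarrow> gon T = 3 \<and> (\<exists>B. adj T B \<and> gon B = p)"

lemma gon_cases: "f \<in> F \<Longrightarrow> gon f = 3 \<or> gon f = p"
  using gon_in_type l by auto

lemma pgon_unique:
  assumes "u \<in> V" "B \<in> F" "B' \<in> F" "u \<in> B" "u \<in> B'" "gon B = p" "gon B' = p"
  shows "B = B'"
proof -
  have "card {f \<in> F. u \<in> f \<and> gon f = p} = 1" using card_at_gon[OF assms(1), of p] l p3 by simp
  then obtain C where C: "{f \<in> F. u \<in> f \<and> gon f = p} = {C}" by (auto simp: card_1_singleton_iff)
  have "B \<in> {f \<in> F. u \<in> f \<and> gon f = p}" "B' \<in> {f \<in> F. u \<in> f \<and> gon f = p}" using assms by auto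
  then show ?thesis unfolding C by simp
qed

text \<open>Any two sides of a triangle have a common corner, and only one \<open>p\<close>-gon
  passes through a vertex.\<close>

lemma near_pgon_unique:
  assumes "gon T = 3" "adj T B" "adj T B'" "gon B = p" "gon B' = p" shows "B = B'"
proof -
  have "(T \<inter> B \<inter> V) \<inter> (T \<inter> B' \<inter> V) \<noteq> {}"
  proof
    assume "(T \<inter> B \<inter> V) \<inter> (T \<inter> B' \<inter> V) = {}"
    then have "card (T \<inter> B \<inter> V \<union> T \<inter> B' \<inter> V) = 4"
      using adj_card[OF assms(2)] adj_card[OF assms(3)] fin by (subst card_Un_disjoint) auto
    moreover have "card (T \<inter> B \<inter> V \<union> T \<inter> B' \<inter> V) \<le> card (T \<inter> V)"
      by (rule card_mono) auto
    ultimately show False using assms(1) by (simp add: gon_def)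
  qed
  then obtain z where z: "z \<in> B" "z \<in> B'" "z \<in> V" by blast
  show ?thesis by (rule pgon_unique[OF z(3) adjD(2)[OF assms(2)] adjD(2)[OF assms(3)] z(1,2) assms(4,5)])
qed

lemma pgon_nbr:
  assumes B: "gon B = p" and a: "adj B T" shows "gon T = 3"
proof (rule ccontr)
  assume "gon T \<noteq> 3"
  then have Tp: "gon T = p" using gon_cases a by (auto simp: adj_def)
  have "card (B \<inter> T \<inter> V) \<noteq> 0" using adj_card[OF a] by simp
  then have "B \<inter> T \<inter> V \<noteq> {}" by (metis card.empty)
  then obtain u where u: "u \<in> B" "u \<in> T" "u \<in> V" by blast
  have "B = T" by (rule pgon_unique[OF u(3) adjD(1,2)[OF a] u(1,2) B Tp])
  then show False using adjD(3)[OF a] by simp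
qed

lemma card_nbrs_pgon:
  assumes "B \<in> F" "gon B = p" shows "card {T \<in> F. adj B T} = p"
proof -
  have "2 * card {T \<in> F. adj B T} = (\<Sum>u\<in>B \<inter> V. card {g \<in> F. u \<in> g \<and> adj B g})"
    using sum_adj_at[OF assms(1), of "\<lambda>_. True"] by simp
  also have "\<dots> = (\<Sum>u\<in>B \<inter> V. 2)"
    using card_adj_at[OF assms(1)] by (intro sum.cong refl) blast
  finally show ?thesis using assms(2) by (simp add: gon_def)
qed

text \<open>Every \<open>p\<close>-gon is bordered by \<open>p\<close> triangles, none of which
  borders another \<open>p\<close>-gon, and \<open>p\<close> times the number of
  \<open>p\<close>-gons is the number of vertices.\<close>

lemma card_near: "card {T \<in> F. near T} = card V"
proof -
  have "card {T \<in> F. near T} = (\<Sum>T\<in>{T \<in> F. near T}. card {B \<in> {B \<in> F. gon B = p}. adj T B})"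
  proof -
    have "card {B \<in> {B \<in> F. gon B = p}. adj T B} = 1" if T: "T \<in> {T \<in> F. near T}" for T
    proof -
      obtain B where B: "adj T B" "gon B = p" "gon T = 3" using T by (auto simp: near_def)
      then have "{B \<in> {B \<in> F. gon B = p}. adj T B} = {B}"
        using near_pgon_unique by (auto simp: adj_def)
      then show ?thesis by simp
    qed
    then show ?thesis by simp
  qed
  also have "\<dots> = (\<Sum>B\<in>{B \<in> F. gon B = p}. card {T \<in> {T \<in> F. near T}. adj T B})"
    by (rule sum_card_swap) auto
  also have "\<dots> = (\<Sum>B\<in>{B \<in> F. gon B = p}. p)"
  proof (rule sum.cong[OF refl])
    fix B assume B: "B \<in> {B \<in> F. gon B = p}"
    have "{T \<in> {T \<in> F. near T}. adj T B} = {T \<in> F. adj B T}"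
      using pgon_nbr[of B] B adj_sym by (auto simp: near_def)
    then show "card {T \<in> {T \<in> F. near T}. adj T B} = p" using card_nbrs_pgon B by simp
  qed
  also have "\<dots> = card V" using card_gon[of p] l p3 by (simp add: mult.commute)
  finally show ?thesis .
qed

text \<open>Geometrically, \<open>u\<close> is the corner of \<open>T\<close> opposite to the side
  that \<open>T\<close> shares with a \<open>p\<close>-gon.\<close>

abbreviation mid :: "'a \<Rightarrow> 'a set \<Rightarrow> bool" where
  "mid u T \<equiv> u \<in> T \<and> near T \<and> (\<forall>B. adj T B \<longrightarrow> gon B = p \<longrightarrow> u \<notin> B)"

lemma card_mid_vertices:
  assumes T: "T \<in> F" "near T" shows "card {u \<in> V. mid u T} = 1"
proof -
  obtain B where B: "adj T B" "gon B = p" "gon T = 3" using T by (auto simp: near_def)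
  have "{u \<in> V. mid u T} = T \<inter> V - T \<inter> B \<inter> V"
    using near_pgon_unique[OF B(3,1) _ B(2)] B T by blast
  moreover have "card (T \<inter> V - T \<inter> B \<inter> V) = card (T \<inter> V) - card (T \<inter> B \<inter> V)"
    by (rule card_Diff_subset) (auto simp: fin)
  ultimately show ?thesis using adj_card[OF B(1)] B(3) by (simp add: gon_def)
qed

text \<open>Let \<open>u x\<close> be the edge between \<open>M\<close> and \<open>N\<close>. The
  sides opposite to \<open>u\<close> both contain \<open>x\<close>, so they lie on the one
  \<open>p\<close>-gon at \<open>x\<close>. This \<open>p\<close>-gon, \<open>M\<close> and
  \<open>N\<close> are then pairwise adjacent at \<open>x\<close>, which is impossible in a cycle of
  five faces.\<close>

lemma near_adj_mid_False:
  assumes u: "u \<in> V" "u \<in> M" "u \<in> N" and a: "adj M N" and m: "mid u M" "mid u N"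
  shows False
proof -
  obtain B where B: "adj M B" "gon B = p" "gon M = 3" "u \<notin> B" using m(1) by (auto simp: near_def)
  obtain C where C: "adj N C" "gon C = p" "gon N = 3" "u \<notin> C" using m(2) by (auto simp: near_def)
  obtain x where x: "x \<noteq> u" "M \<inter> N \<inter> V = {u, x}" "x \<in> V" "x \<in> M" "x \<in> N"
    by (rule adj_edgeE[OF a u(2,3,1)])
  have inB: "x \<in> Z" if "adj T Z" "gon T = 3" "u \<in> T" "x \<in> T" "u \<notin> Z" for T Z
  proof (rule ccontr)
    assume "x \<notin> Z"
    then have "T \<inter> Z \<inter> V \<subseteq> T \<inter> V - {u, x}" using that by blast
    then have "card (T \<inter> Z \<inter> V) \<le> card (T \<inter> V - {u, x})" by (rule card_mono[rotated]) auto
    also have "\<dots> = 1" using that x u by (subst card_Diff_subset) (auto simp: gon_def)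
    finally show False using adj_card[OF that(1)] by simp
  qed
  have "x \<in> B" "x \<in> C" using inB[OF B(1,3)] inB[OF C(1,3)] u x B C by auto
  then have "B = C" by (intro pgon_unique[OF x(3) adjD(2)[OF B(1)] adjD(2)[OF C(1)] _ _ B(2) C(2)])
  then have aa: "adj B M" "adj B N" using adj_sym[OF B(1)] adj_sym[OF C(1)] by simp_all
  obtain f0 f1 f2 f3 f4 where f: "distinct [f0, f1, f2, f3, f4]" "{f \<in> F. x \<in> f} = {f0, f1, f2, f3, f4}"
    "l = [gon f0, gon f1, gon f2, gon f3, gon f4]"
    "adj f0 f1" "adj f1 f2" "adj f2 f3" "adj f3 f4" "adj f4 f0"
    "\<not> adj f0 f2" "\<not> adj f0 f3" "\<not> adj f1 f3" "\<not> adj f1 f4" "\<not> adj f2 f4"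
    by (rule five_cycleE[OF _ x(3)]) (simp add: l)
  have "B \<in> {f0, f1, f2, f3, f4}" "M \<in> {f0, f1, f2, f3, f4}" "N \<in> {f0, f1, f2, f3, f4}"
    unfolding f(2)[symmetric] using \<open>x \<in> B\<close> x(4,5) adjD(1,2)[OF aa(1)] adjD(2)[OF aa(2)] by simp_all
  note mem = this
  have "gon f0 = 3" "gon f1 = 3" "gon f2 = 3" "gon f3 = 3" using f(3) l by simp_all
  then have B4: "B = f4" using mem(1) B(2) p3 by auto
  have nb: "T = f0 \<or> T = f3" if "adj f4 T" "T \<in> {f0, f1, f2, f3, f4}" for T
    using that f(12,13) adj_sym[of f4] adjD(3)[OF that(1)] by blast
  have "\<not> adj f0 f3" "\<not> adj f3 f0" using f(10) adj_sym by blast+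
  then show False using nb[OF _ mem(2)] nb[OF _ mem(3)] aa a adjD(3)[OF a] unfolding B4 by blast
qed

text \<open>The faces in cyclic order around \<open>u\<close>: the \<open>p\<close>-gon
  \<open>P\<close>, its neighbours \<open>S\<close> and \<open>R\<close> at the two ends, and
  between them \<open>M\<close> next to \<open>S\<close> and \<open>N\<close> next to
  \<open>R\<close>.\<close>

definition config :: "'a \<Rightarrow> 'a set \<Rightarrow> 'a set \<Rightarrow> 'a set \<Rightarrow> 'a set \<Rightarrow> 'a set \<Rightarrow> bool" where
  "config u P S M N R \<longleftrightarrow> distinct [P, S, M, N, R] \<and> {f \<in> F. u \<in> f} = {P, S, M, N, R} \<and>
     gon P = p \<and> gon S = 3 \<and> gon M = 3 \<and> gon N = 3 \<and> gon R = 3 \<and>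
     adj P S \<and> adj S M \<and> adj M N \<and> adj N R \<and> adj R P \<and>
     \<not> adj P M \<and> \<not> adj P N \<and> \<not> adj S N \<and> \<not> adj S R \<and> \<not> adj M R"

lemma configD:
  assumes "config u P S M N R"
  shows "{f \<in> F. u \<in> f} = {P, S, M, N, R}" "distinct [P, S, M, N, R]"
    "P \<in> F" "S \<in> F" "M \<in> F" "N \<in> F" "R \<in> F" "u \<in> P" "u \<in> S" "u \<in> M" "u \<in> N" "u \<in> R"
    "gon P = p" "gon S = 3" "gon M = 3" "gon N = 3" "gon R = 3" "adj P S" "adj S M" "adj M N" "adj N R" "adj R P" "\<not> adj P M" "\<not> adj P N" "\<not> adj S N" "\<not> adj S R" "\<not> adj M R"
proof -
  note c = assms[unfolded config_def]
  show eq: "{f \<in> F. u \<in> f} = {P, S, M, N, R}" using c by (elim conjE)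
  have "{P, S, M, N, R} \<subseteq> {f \<in> F. u \<in> f}" unfolding eq ..
  then show "P \<in> F" "S \<in> F" "M \<in> F" "N \<in> F" "R \<in> F" "u \<in> P" "u \<in> S" "u \<in> M" "u \<in> N" "u \<in> R"
    by simp_all
  show "distinct [P, S, M, N, R]" using c by (elim conjE)
  show "gon P = p" using c by (elim conjE)
  show "gon S = 3" using c by (elim conjE)
  show "gon M = 3" using c by (elim conjE)
  show "gon N = 3" using c by (elim conjE)
  show "gon R = 3" using c by (elim conjE)
  show "adj P S" using c by (elim conjE)
  show "adj S M" using c by (elim conjE)
  show "adj M N" using c by (elim conjE)
  show "adj N R" using c by (elim conjE)
  show "adj R P" using c by (elim conjE)
  show "\<not> adj P M" using c by (elim conjE)
  show "\<not> adj P N" using c by (elim conjE)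
  show "\<not> adj S N" using c by (elim conjE)
  show "\<not> adj S R" using c by (elim conjE)
  show "\<not> adj M R" using c by (elim conjE)
qed

lemma config_mid_iff:
  assumes c: "config u P S M N R" and u: "u \<in> V"
  shows "mid u T \<and> T \<in> F \<longleftrightarrow> (T = M \<or> T = N) \<and> near T"
proof
  have m: "P \<in> F" "S \<in> F" "M \<in> F" "N \<in> F" "R \<in> F" "u \<in> P" "u \<in> S" "u \<in> M" "u \<in> N" "u \<in> R"
    using c unfolding config_def by blast+
  have g: "gon P = p" "adj S P" "adj R P" "\<not> adj M P" "\<not> adj N P"
    using c adj_sym unfolding config_def by blast+
  {
    assume T: "mid u T \<and> T \<in> F"
    then have "T \<in> {P, S, M, N, R}" using c unfolding config_def by blast
    moreover have "T \<noteq> P" using T g p3 by (auto simp: near_def)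
    moreover have "T \<noteq> S" "T \<noteq> R" using T g m by blast+
    ultimately show "(T = M \<or> T = N) \<and> near T" using T by blast
  }
  assume T: "(T = M \<or> T = N) \<and> near T"
  have "u \<notin> B" if "adj T B" "gon B = p" for B
  proof
    assume "u \<in> B"
    then have "B = P" using pgon_unique[OF u _ m(1) _ m(6) that(2) g(1)] that by (simp add: adj_def)
    then show False using T that g by blast
  qed
  then show "mid u T \<and> T \<in> F" using T m by blast
qed

text \<open>By \<open>near_adj_mid_False\<close> at most one of the two middle triangles is near.
  Each near triangle is a middle one at just one vertex, and there are as many near triangles as
  vertices, so equality holds at every vertex.\<close>

lemma config_exists:
  assumes u: "u \<in> V" obtains P S M N R where "config u P S M N R" "near M" "\<not> near N"
proof -
  have ex: "\<exists>P S M N R. config v P S M N R" if v: "v \<in> V" for v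
  proof -
    obtain f0 f1 f2 f3 f4 where f: "distinct [f0, f1, f2, f3, f4]" "{f \<in> F. v \<in> f} = {f0, f1, f2, f3, f4}"
    "l = [gon f0, gon f1, gon f2, gon f3, gon f4]"
    "adj f0 f1" "adj f1 f2" "adj f2 f3" "adj f3 f4" "adj f4 f0"
    "\<not> adj f0 f2" "\<not> adj f0 f3" "\<not> adj f1 f3" "\<not> adj f1 f4" "\<not> adj f2 f4"
      by (rule five_cycleE[OF _ v]) (simp add: l)
    have "gon f0 = 3" "gon f1 = 3" "gon f2 = 3" "gon f3 = 3" "gon f4 = p" using f(3) l by simp_all
    moreover have "\<not> adj f4 f1" "\<not> adj f4 f2" using f(12,13) adj_sym by blast+
    moreover have "distinct [f4, f0, f1, f2, f3]" using f(1) by (simp, blast)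
    moreover have "{f0, f1, f2, f3, f4} = {f4, f0, f1, f2, f3}" by blast
    ultimately have "config v f4 f0 f1 f2 f3" unfolding config_def f(2)
      using f(4-11) by (intro conjI)
    then show ?thesis by blast
  qed
  have le: "card {T \<in> F. mid v T} \<le> 1" if v: "v \<in> V" for v
  proof (rule ccontr)
    assume A: "\<not> ?thesis"
    obtain P S M N R where c: "config v P S M N R" using ex[OF v] by blast
    have sub: "{T \<in> F. mid v T} \<subseteq> {M, N}" using config_mid_iff[OF c v] by blast
    have "card {M, N} = 2" using c by (simp add: config_def)
    moreover have "card {T \<in> F. mid v T} \<le> card {M, N}" by (rule card_mono[OF _ sub]) simp
    ultimately have "{T \<in> F. mid v T} = {M, N}" using A by (intro card_subset_eq[OF _ sub]) auto
    then have "M \<in> {T \<in> F. mid v T}" "N \<in> {T \<in> F. mid v T}" by blast+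
    then show False using near_adj_mid_False[OF v, of M N] c unfolding config_def by blast
  qed
  have "(\<Sum>v\<in>V. card {T \<in> {T \<in> F. near T}. mid v T}) = (\<Sum>T\<in>{T \<in> F. near T}. card {v \<in> V. mid v T})"
    by (rule sum_card_swap) (auto simp: fin)
  also have "\<dots> = (\<Sum>T\<in>{T \<in> F. near T}. 1)"
    by (intro sum.cong[OF refl]) (use card_mid_vertices in blast)
  also have "\<dots> = (\<Sum>v\<in>V. 1)" using card_near by simp
  also have "(\<Sum>v\<in>V. card {T \<in> {T \<in> F. near T}. mid v T}) = (\<Sum>v\<in>V. card {T \<in> F. mid v T})"
    by (intro sum.cong[OF refl] arg_cong[where f = card]) blast
  finally have s: "(\<Sum>v\<in>V. card {T \<in> F. mid v T}) = (\<Sum>v\<in>V. 1)" .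
  have "card {T \<in> F. mid u T} = 1"
  proof (rule ccontr)
    assume "card {T \<in> F. mid u T} \<noteq> 1"
    then have "card {T \<in> F. mid u T} < 1" using le[OF u] by linarith
    then have "(\<Sum>v\<in>V. card {T \<in> F. mid v T}) < (\<Sum>v\<in>V. 1)"
      using le u fin by (intro sum_strict_mono_ex1) auto
    then show False using s by simp
  qed
  then obtain T where T: "{T \<in> F. mid u T} = {T}" by (auto simp: card_1_singleton_iff)
  obtain P S M N R where c: "config u P S M N R" using ex[OF u] by blast
  \<comment> \<open>Reading the face-cycle in the other direction exchanges \<open>M\<close> and
    \<open>N\<close>; the direction is chosen so that \<open>M\<close> is the near one.\<close>
  have c': "config u P R N M S"
  proof -
    have "distinct [P, R, N, M, S]" using c unfolding config_def by (simp, blast)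
    moreover have "{P, S, M, N, R} = {P, R, N, M, S}" by blast
    ultimately show ?thesis using c adj_sym unfolding config_def by (intro conjI) blast+
  qed
  have MN: "M \<noteq> N" using c by (simp add: config_def)
  have iff: "X = T \<longleftrightarrow> (X = M \<or> X = N) \<and> near X" for X
    using config_mid_iff[OF c u, of X] T by blast
  show ?thesis
  proof (cases "T = M")
    case True
    then have "near M" "\<not> near N" using iff[of M] iff[of N] MN by auto
    then show ?thesis using that c by blast
  next
    case False
    then have "near N" "\<not> near M" using iff[of T] iff[of M] by auto
    then show ?thesis using that c' by blast
  qed
qed

text \<open>The cube of \<open>\<sigma> \<circ> \<alpha>\<close> is the identity, so
  \<open>\<sigma> \<circ> \<alpha>\<close> is even. On the other hand \<open>\<sigma>\<close>
  consists of cycles of length \<open>p\<close> and \<open>\<alpha>\<close> of transpositions, and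
  neither fixes a vertex.\<close>

lemma snub_sign: "((- 1) :: int) ^ ((p - 1) * (card V div p)) * (- 1) ^ (card V div 2) = 1"
proof -
  have "\<forall>u \<in> V. \<exists>c. case c of (P, S, M, N, R) \<Rightarrow> config u P S M N R \<and> near M \<and> \<not> near N"
  proof
    fix u assume u: "u \<in> V"
    obtain P S M N R where "config u P S M N R" "near M" "\<not> near N" by (rule config_exists[OF u])
    then show "\<exists>c. case c of (P, S, M, N, R) \<Rightarrow> config u P S M N R \<and> near M \<and> \<not> near N"
      by (intro exI[of _ "(P, S, M, N, R)"]) simp
  qed
  from bchoice[OF this] obtain c where
    c: "\<forall>u \<in> V. case c u of (P, S, M, N, R) \<Rightarrow> config u P S M N R \<and> near M \<and> \<not> near N" by blast
  define P where "P u = fst (c u)" for u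
  define S where "S u = fst (snd (c u))" for u
  define M where "M u = fst (snd (snd (c u)))" for u
  define N where "N u = fst (snd (snd (snd (c u))))" for u
  define R where "R u = snd (snd (snd (snd (c u))))" for u
  have cfg: "config u (P u) (S u) (M u) (N u) (R u)" "near (M u)" "\<not> near (N u)" if "u \<in> V" for u
    using bspec[OF c that] by (simp_all add: P_def S_def M_def N_def R_def case_prod_unfold)
  note D = configD[OF cfg(1)]
  note mem = D(3-6,8-11) and all = D(1) and g = D(13-17) and ad = D(18-20) and na = D(23-25,27)
  have ne: "M u \<noteq> N u" "S u \<noteq> N u" if "u \<in> V" for u
    using D(2)[OF that] by simp_all
  have PU: "B = P u" if "u \<in> V" "B \<in> F" "u \<in> B" "gon B = p" for u B
    by (rule pgon_unique[OF that(1,2) mem(1)[OF that(1)] that(3) mem(5)[OF that(1)] that(4) g(1)[OF that(1)]])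
  have nearSR: "near (R u)" if u: "u \<in> V" for u
    using D(22)[OF u] g(5)[OF u] g(1)[OF u] unfolding near_def by blast
  have MU: "T = M u" if u: "u \<in> V" and T: "T \<in> F" "u \<in> T" "near T" "\<not> adj T (P u)" for u T
  proof -
    have "T \<in> {P u, S u, M u, N u, R u}" using T all[OF u] by blast
    moreover have "T \<noteq> P u" using T(3) g(1)[OF u] p3 by (auto simp: near_def)
    moreover have "T \<noteq> S u" using T(4) adj_sym[OF ad(1)[OF u]] by blast
    moreover have "T \<noteq> R u" using T(4) D(22)[OF u] by blast
    ultimately show ?thesis using T(3) cfg(3)[OF u] by blast
  qed
  have NU: "T = N u" if u: "u \<in> V" and T: "T \<in> F" "u \<in> T" "gon T = 3" "\<not> near T" for u T
  proof -
    have "T \<in> {P u, S u, M u, N u, R u}" using T all[OF u] by blast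
    moreover have "T \<noteq> P u" using T(3) g(1)[OF u] p3 by auto
    moreover have "near (S u)" using adj_sym[OF ad(1)[OF u]] g[OF u] unfolding near_def by blast
    ultimately show ?thesis using T(4) cfg(2)[OF u] nearSR[OF u] by blast
  qed
  \<comment> \<open>The chirality makes both choices canonical: \<open>s u\<close> is the next
    vertex of \<open>P u\<close> on the side of \<open>S u\<close>, and \<open>a u\<close> is the
    other end of the edge between \<open>S u\<close> and \<open>M u\<close>.\<close>
  have "\<forall>u \<in> V. \<exists>y. y \<noteq> u \<and> P u \<inter> S u \<inter> V = {u, y}"
    by (rule ballI, rule adj_edgeE[OF ad(1) mem(5) mem(6)]) auto
  from bchoice[OF this] obtain s where s: "\<forall>u \<in> V. s u \<noteq> u \<and> P u \<inter> S u \<inter> V = {u, s u}" by blast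
  have "\<forall>u \<in> V. \<exists>y. y \<noteq> u \<and> S u \<inter> M u \<inter> V = {u, y}"
    by (rule ballI, rule adj_edgeE[OF ad(2) mem(6) mem(7)]) auto
  from bchoice[OF this] obtain a where a: "\<forall>u \<in> V. a u \<noteq> u \<and> S u \<inter> M u \<inter> V = {u, a u}" by blast
  have sn: "s u \<noteq> u" and sE: "P u \<inter> S u \<inter> V = {u, s u}" and an: "a u \<noteq> u" and aE: "S u \<inter> M u \<inter> V = {u, a u}"
    if "u \<in> V" for u
    using bspec[OF s that] bspec[OF a that] by simp_all
  have sV: "s u \<in> V" "s u \<in> P u" "s u \<in> S u" and aV: "a u \<in> V" "a u \<in> S u" "a u \<in> M u" if "u \<in> V" for u
    using sE[OF that] aE[OF that] by blast+
  have aP: "a v \<notin> P v" if v: "v \<in> V" for v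
  proof
    assume "a v \<in> P v"
    moreover have "P v \<noteq> M v" using g[OF v] p3 by auto
    ultimately have "adj (P v) (M v)"
      using adjI[OF mem(1)[OF v] mem(3)[OF v] _ mem(5)[OF v] mem(7)[OF v] _ aV(3)[OF v]] an[OF v] by metis
    then show False using na(1)[OF v] by blast
  qed
  have sa: "s v \<noteq> a v" if v: "v \<in> V" for v using aP[OF v] sV(2)[OF v] by auto
  have Striple: "S v \<inter> V = {v, s v, a v}" if v: "v \<in> V" for v
    by (rule triangle_eq[OF g(2)[OF v] mem(6)[OF v] sV(3)[OF v] aV(2)[OF v] v sV(1)[OF v] aV(1)[OF v]])
      (use sn[OF v] an[OF v] sa[OF v] in simp_all)
  \<comment> \<open>At the other end of the edge between \<open>S v\<close> and \<open>M v\<close>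
    these two triangles exchange roles, so \<open>a\<close> is an involution. The third corner of
    \<open>M v\<close> is then \<open>s (a v)\<close>; it also lies on \<open>N v\<close>, so
    \<open>s\<close> after \<open>a\<close> moves along the triangle \<open>N v\<close>.\<close>
  have key: "M (a v) = S v \<and> S (a v) = M v \<and> a (a v) = v \<and> P (a v) \<inter> M v \<inter> V = {a v, s (a v)} \<and>
      N (s (a v)) = N v \<and> s (a v) \<noteq> v \<and> s (a v) \<in> N v" if v: "v \<in> V" for v
  proof -
    let ?w = "a v"
    note w = aV(1)[OF v]
    obtain B where B: "adj (M v) B" "gon B = p" using cfg(2)[OF v] unfolding near_def by blast
    have vB: "v \<notin> B"
    proof
      assume "v \<in> B"
      then have "B = P v" using PU[OF v adjD(2)[OF B(1)] _ B(2)] by blast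
      then show False using adj_sym[OF B(1)] na(1)[OF v] by simp
    qed
    obtain x where x: "M v \<inter> V = {v, ?w, x}" "x \<noteq> v" "x \<noteq> ?w" "x \<in> V" "x \<in> M v"
      by (rule triangle_thirdE[OF g(3)[OF v] mem(7)[OF v] aV(3)[OF v] v w]) (use an[OF v] in simp)
    have MB: "M v \<inter> B \<inter> V = {?w, x}"
    proof (rule card_subset_eq)
      have "M v \<inter> B \<inter> V = (M v \<inter> V) \<inter> B" by blast
      then show "M v \<inter> B \<inter> V \<subseteq> {?w, x}" unfolding x(1) using vB by auto
      show "card (M v \<inter> B \<inter> V) = card {?w, x}" using adj_card[OF B(1)] x(3) by simp
    qed simp
    then have "?w \<in> B" "x \<in> B" by blast+
    then have Bw: "B = P ?w" using PU[OF w adjD(2)[OF B(1)] _ B(2)] by blast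
    have nS: "near (S v)" using adj_sym[OF ad(1)[OF v]] g[OF v] unfolding near_def by blast
    have "\<not> adj (S v) (P ?w)"
    proof
      assume "adj (S v) (P ?w)"
      then have "P v = P ?w" using near_pgon_unique[OF g(2)[OF v] adj_sym[OF ad(1)[OF v]] _ g(1)[OF v] g(1)[OF w]] by blast
      then show False using aP[OF v] mem(5)[OF w] by simp
    qed
    then have Mw: "M ?w = S v" using MU[OF w mem(2)[OF v] aV(2)[OF v] nS] by simp
    have am: "adj (M ?w) (M v)" using ad(2)[OF v] Mw by simp
    have Sw: "S ?w = M v"
    proof -
      have "M v \<in> {P ?w, S ?w, M ?w, N ?w, R ?w}" using all[OF w] mem(3)[OF v] aV(3)[OF v] by blast
      moreover have "M v \<noteq> P ?w" using g(3)[OF v] g(1)[OF w] p3 by auto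
      moreover have "M v \<noteq> M ?w" using adjD(3)[OF am] by simp
      moreover have "M v \<noteq> N ?w" using cfg(2)[OF v] cfg(3)[OF w] by auto
      moreover have "M v \<noteq> R ?w" using am na(4)[OF w] by auto
      ultimately show ?thesis by blast
    qed
    have "S ?w \<inter> M ?w \<inter> V = {?w, v}" unfolding Sw Mw using aE[OF v] by blast
    then have aa: "a ?w = v" using aE[OF w] by (metis doubleton_eq_iff)
    have PM: "P ?w \<inter> M v \<inter> V = {?w, x}" using MB unfolding Bw by blast
    then have "P ?w \<inter> S ?w \<inter> V = {?w, x}" unfolding Sw .
    then have sw: "s ?w = x" using sE[OF w] by (metis doubleton_eq_iff)
    obtain x' where x': "x' \<noteq> v" "M v \<inter> N v \<inter> V = {v, x'}" "x' \<in> V" "x' \<in> M v" "x' \<in> N v"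
      by (rule adj_edgeE[OF ad(3)[OF v] mem(7,8)[OF v] v])
    have "x' \<noteq> ?w"
    proof
      assume "x' = ?w"
      then have "M v \<inter> S v \<inter> V = M v \<inter> N v \<inter> V" using x'(2) aE[OF v] by (simp add: Int_commute)
      then have "S v = N v" by (rule adj_edge_unique'[OF adj_sym[OF ad(2)[OF v]] ad(3)[OF v]])
      then show False using ne(2)[OF v] by simp
    qed
    then have "x' = x" using x'(1,3,4) x(1) by blast
    then have xN: "x \<in> N v" using x'(5) by simp
    have "N x = N v" using NU[OF x(4) mem(4)[OF v] xN g(4)[OF v] cfg(3)[OF v]] by simp
    then show ?thesis using Mw Sw aa PM sw x(2) xN by simp
  qed
  have Ps: "P (s v) = P v" if v: "v \<in> V" for v
    using PU[OF sV(1)[OF v] mem(1)[OF v] sV(2)[OF v] g(1)[OF v]] by simp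
  have Nadj: "adj (S v) (N (s v))" if v: "v \<in> V" for v
  proof -
    note w = aV(1)[OF v]
    have "adj (M (a v)) (N (a v))" using ad(3)[OF w] .
    moreover have "M (a v) = S v" "N (s (a (a v))) = N (a v)" "a (a v) = v"
      using key[OF v] key[OF w] by blast+
    ultimately show ?thesis by simp
  qed
  \<comment> \<open>If \<open>v\<close> and \<open>v'\<close> reached \<open>y\<close> through
    different triangles, one of these would be \<open>S y\<close>. By \<open>Nadj\<close> both are
    adjacent to \<open>N y\<close>, but \<open>S y\<close> is not.\<close>
  have s_inj: "v = v'" if v: "v \<in> V" "v' \<in> V" "s v = s v'" for v v'
  proof -
    let ?y = "s v"
    note y = sV(1)[OF v(1)]
    have PP: "P v = P ?y" "P v' = P ?y" using Ps v by metis+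
    have "S v = S v'"
    proof (rule ccontr)
      assume neq: "S v \<noteq> S v'"
      have nb: "T \<in> {S ?y, R ?y}" if "T \<in> F" "?y \<in> T" "adj (P ?y) T" for T
        using that all[OF y] na(1,2)[OF y] adjD(3)[OF that(3)] by blast
      have "S v \<in> {S ?y, R ?y}" "S v' \<in> {S ?y, R ?y}"
        using nb[of "S v"] nb[of "S v'"] mem(2) sV(3) ad(1) v PP by metis+
      then have "S ?y = S v \<or> S ?y = S v'" using neq by blast
      then have "adj (S ?y) (N ?y)" using Nadj[OF v(1)] Nadj[OF v(2)] v(3) by auto
      then show False using na(3)[OF y] by blast
    qed
    then have "{v, s v} = {v', s v}" using sE[OF v(1)] sE[OF v(2)] PP v(3) by simp
    then show ?thesis by (metis doubleton_eq_iff)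
  qed
  \<comment> \<open>Otherwise \<open>v\<close> and \<open>s v\<close> would have the same triangle
    \<open>S\<close>, and no corner of it would be left for \<open>a (s v)\<close>.\<close>
  have ss: "s (s v) \<noteq> v" if v: "v \<in> V" for v
  proof
    assume e: "s (s v) = v"
    let ?y = "s v"
    note y = sV(1)[OF v]
    have "P ?y \<inter> S ?y \<inter> V = P ?y \<inter> S v \<inter> V"
      using sE[OF v] sE[OF y] e Ps[OF v] by (simp add: insert_commute)
    then have SS: "S ?y = S v"
      using adj_edge_unique'[OF ad(1)[OF y], of "S v"] ad(1)[OF v] Ps[OF v] by simp
    have "a ?y \<in> S v \<inter> V" using aV[OF y] SS by simp
    then have "a ?y \<in> {v, ?y, a v}" using Striple[OF v] by simp
    moreover have "a ?y \<noteq> ?y" by (rule an[OF y])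
    moreover have "a ?y \<noteq> a v" using key[OF y] key[OF v] sn[OF v] by metis
    moreover have "a ?y \<noteq> v" using key[OF y] sa[OF v] by metis
    ultimately show False by blast
  qed
  \<comment> \<open>Extended by the identity outside \<open>V\<close>, as \<open>permutes\<close>
    demands.\<close>
  define \<sigma> where "\<sigma> v = (if v \<in> V then s v else v)" for v
  define \<alpha> where "\<alpha> v = (if v \<in> V then a v else v)" for v
  have \<sigma>: "\<sigma> permutes V"
  proof (rule bij_imp_permutes)
    have "inj_on \<sigma> V" by (rule inj_onI) (auto simp: \<sigma>_def intro: s_inj)
    moreover have "\<sigma> ` V \<subseteq> V" using sV by (auto simp: \<sigma>_def)
    ultimately show "bij_betw \<sigma> V V" using fin(1) by (simp add: bij_betw_def endo_inj_surj)
  qed (simp add: \<sigma>_def)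
  have \<alpha>: "\<alpha> permutes V"
  proof (rule bij_imp_permutes)
    have "inj_on \<alpha> V" by (rule inj_onI) (metis \<alpha>_def key)
    moreover have "\<alpha> ` V \<subseteq> V" using aV by (auto simp: \<alpha>_def)
    ultimately show "bij_betw \<alpha> V V" using fin(1) by (simp add: bij_betw_def endo_inj_surj)
  qed (simp add: \<alpha>_def)
  have pm: "permutation \<sigma>" "permutation \<alpha>" using \<sigma> \<alpha> fin(1) permutes_imp_permutation by blast+
  have sg\<sigma>: "sign \<sigma> = (- 1) ^ ((p - 1) * (card V div p))"
  proof (rule conjunct2[OF sign_equal_orbits[OF fin(1) \<sigma>]], rule ballI)
    fix v assume v: "v \<in> V"
    have "orbit \<sigma> v = P v \<inter> V"
    proof (rule rotation_orbit[OF \<sigma> _ _ _ v])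
      show "\<forall>v \<in> V. P v \<in> F \<and> v \<in> P v \<and> P (\<sigma> v) = P v" using mem Ps by (simp add: \<sigma>_def)
      show "\<forall>v \<in> V. \<exists>e \<in> E. e \<subseteq> P v \<and> e \<inter> V = {v, \<sigma> v}"
      proof
        fix v assume v: "v \<in> V"
        have "P v \<inter> S v \<in> E" using ad(1)[OF v] by (simp add: adj_def)
        then show "\<exists>e \<in> E. e \<subseteq> P v \<and> e \<inter> V = {v, \<sigma> v}"
          using sE[OF v] v by (intro bexI[of _ "P v \<inter> S v"]) (simp_all add: \<sigma>_def)
      qed
      show "\<forall>v \<in> V. \<sigma> v \<noteq> v \<and> \<sigma> (\<sigma> v) \<noteq> v" using sn ss sV by (simp add: \<sigma>_def)
    qed
    then show "card (orbit \<sigma> v) = p" using g(1)[OF v] by (simp add: gon_def)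
  qed
  have sg\<alpha>: "sign \<alpha> = (- 1) ^ (card V div 2)"
  proof -
    have "card (orbit \<alpha> v) = 2" if v: "v \<in> V" for v
    proof -
      have "(\<alpha> ^^ 2) v = v" using key[OF v] aV[OF v] v by (simp add: \<alpha>_def numeral_2_eq_2)
      then have "orbit \<alpha> v = {(\<alpha> ^^ m) v | m. m < 2}" by (rule orbit_altdef_bounded) simp
      also have "\<dots> = {v, \<alpha> v}" by (force simp: numeral_2_eq_2 less_Suc_eq)
      finally show ?thesis using an[OF v] v by (simp add: \<alpha>_def)
    qed
    then show ?thesis using conjunct2[OF sign_equal_orbits[OF fin(1) \<alpha>, of 2]] by simp
  qed
  \<comment> \<open>On the three corners of \<open>N v\<close> the map \<open>s\<close> after
    \<open>a\<close> is injective without fixed points, hence a 3-cycle.\<close>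
  have cube: "(\<sigma> \<circ> \<alpha>) ((\<sigma> \<circ> \<alpha>) ((\<sigma> \<circ> \<alpha>) v)) = v" for v
  proof (cases "v \<in> V")
    case v: True
    define \<phi> where "\<phi> u = s (a u)" for u
    have \<phi>: "\<phi> u \<in> V" "\<phi> u \<noteq> u" "\<phi> u \<in> N u" "N (\<phi> u) = N u" if "u \<in> V" for u
      using key[OF that] sV aV[OF that] by (simp_all add: \<phi>_def)
    have \<phi>_inj: "u = u'" if "u \<in> V" "u' \<in> V" "\<phi> u = \<phi> u'" for u u'
      using that s_inj[OF aV(1)[OF that(1)] aV(1)[OF that(2)]] key by (metis \<phi>_def)
    let ?x = "\<phi> v"
    obtain z where z: "N v \<inter> V = {v, ?x, z}" "z \<noteq> v" "z \<noteq> ?x" "z \<in> V" "z \<in> N v"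
      by (rule triangle_thirdE[OF g(4)[OF v] mem(8)[OF v] \<phi>(3)[OF v] v \<phi>(1)[OF v]]) (use \<phi>(2)[OF v] in auto)
    note x = \<phi>(1)[OF v]
    have Nz: "N z = N v" using NU[OF z(4) mem(4)[OF v] z(5) g(4)[OF v] cfg(3)[OF v]] by simp
    have "\<phi> ?x \<in> {v, ?x, z}" using \<phi>(1,3,4) x v z(1) by blast
    moreover have z3: "\<phi> z \<in> {v, ?x, z}" using \<phi>(1,3)[OF z(4)] Nz z(1) by blast
    moreover have "\<phi> z \<noteq> ?x" using \<phi>_inj[OF z(4) v] z by blast
    ultimately have "\<phi> z = v" using \<phi>(2)[OF z(4)] by blast
    then have "\<phi> ?x \<noteq> v" using \<phi>_inj[OF z(4) x] z by auto
    then have "\<phi> ?x = z" using \<open>\<phi> ?x \<in> {v, ?x, z}\<close> \<phi>(2)[OF x] by blast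
    then have "\<phi> (\<phi> (\<phi> v)) = v" using \<open>\<phi> z = v\<close> by simp
    then show ?thesis using v sV aV by (simp add: \<phi>_def \<sigma>_def \<alpha>_def)
  next
    case False
    then show ?thesis by (simp add: \<sigma>_def \<alpha>_def)
  qed
  let ?f = "\<sigma> \<circ> \<alpha>"
  have "?f \<circ> (?f \<circ> ?f) = id" using cube by (intro ext) simp
  then have "sign (?f \<circ> (?f \<circ> ?f)) = 1" by simp
  moreover have pf: "permutation ?f" using pm by (rule permutation_compose)
  moreover have "permutation (?f \<circ> ?f)" using pf pf by (rule permutation_compose)
  ultimately have "sign ?f * (sign ?f * sign ?f) = 1" using pf by (simp only: sign_compose)
  then have "sign ?f = 1" by simp
  then show ?thesis using sg\<sigma> sg\<alpha> sign_compose[OF pm] by simp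
qed

end

subsection \<open>The type $[3,3,4,3,5]$\<close>

text \<open>This vertex figure differs from its mirror image, since only in one direction are the
  two adjacent triangles followed by the 4-gon. So the orientation needs no counting here, unlike
  for [3,3,3,3,p].\<close>

locale snub45_map = euler_map +
  assumes l: "l = [3, 3, 4, 3, 5]"
begin

definition config :: "'a \<Rightarrow> 'a set \<Rightarrow> 'a set \<Rightarrow> 'a set \<Rightarrow> 'a set \<Rightarrow> 'a set \<Rightarrow> bool" where
  "config u A B Q D P \<longleftrightarrow> distinct [A, B, Q, D, P] \<and> {f \<in> F. u \<in> f} = {A, B, Q, D, P} \<and>
     gon A = 3 \<and> gon B = 3 \<and> gon Q = 4 \<and> gon D = 3 \<and> gon P = 5 \<and>
     adj A B \<and> adj B Q \<and> adj Q D \<and> adj D P \<and> adj P A \<and>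
     \<not> adj A Q \<and> \<not> adj A D \<and> \<not> adj B D \<and> \<not> adj B P \<and> \<not> adj Q P"

lemma config_exists:
  assumes u: "u \<in> V" shows "\<exists>A B Q D P. config u A B Q D P"
proof -
  obtain f0 f1 f2 f3 f4 where f: "distinct [f0, f1, f2, f3, f4]" "{f \<in> F. u \<in> f} = {f0, f1, f2, f3, f4}"
    "l = [gon f0, gon f1, gon f2, gon f3, gon f4]"
    "adj f0 f1" "adj f1 f2" "adj f2 f3" "adj f3 f4" "adj f4 f0"
    "\<not> adj f0 f2" "\<not> adj f0 f3" "\<not> adj f1 f3" "\<not> adj f1 f4" "\<not> adj f2 f4"
    by (rule five_cycleE[OF _ u]) (simp add: l)
  have "gon f0 = 3" "gon f1 = 3" "gon f2 = 4" "gon f3 = 3" "gon f4 = 5" using f(3) l by simp_all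
  then have "config u f0 f1 f2 f3 f4" unfolding config_def using f by (intro conjI)
  then show ?thesis by blast
qed

lemma configD:
  assumes "config u A B Q D P"
  shows "{f \<in> F. u \<in> f} = {A, B, Q, D, P}" "distinct [A, B, Q, D, P]"
    "A \<in> F" "B \<in> F" "Q \<in> F" "D \<in> F" "P \<in> F" "u \<in> A" "u \<in> B" "u \<in> Q" "u \<in> D" "u \<in> P"
    "gon A = 3" "gon B = 3" "gon Q = 4" "gon D = 3" "gon P = 5"
    "adj A B" "adj B Q" "adj Q D" "adj D P" "adj P A"
    "\<not> adj A Q" "\<not> adj A D" "\<not> adj B D" "\<not> adj B P" "\<not> adj Q P"
proof -
  note c = assms[unfolded config_def]
  show eq: "{f \<in> F. u \<in> f} = {A, B, Q, D, P}" using c by (elim conjE)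
  have "{A, B, Q, D, P} \<subseteq> {f \<in> F. u \<in> f}" unfolding eq ..
  then show "A \<in> F" "B \<in> F" "Q \<in> F" "D \<in> F" "P \<in> F" "u \<in> A" "u \<in> B" "u \<in> Q" "u \<in> D" "u \<in> P"
    by simp_all
  show "distinct [A, B, Q, D, P]" using c by (elim conjE)
  show "gon A = 3" using c by (elim conjE)
  show "gon B = 3" using c by (elim conjE)
  show "gon Q = 4" using c by (elim conjE)
  show "gon D = 3" using c by (elim conjE)
  show "gon P = 5" using c by (elim conjE)
  show "adj A B" using c by (elim conjE)
  show "adj B Q" using c by (elim conjE)
  show "adj Q D" using c by (elim conjE)
  show "adj D P" using c by (elim conjE)
  show "adj P A" using c by (elim conjE)
  show "\<not> adj A Q" using c by (elim conjE)
  show "\<not> adj A D" using c by (elim conjE)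
  show "\<not> adj B D" using c by (elim conjE)
  show "\<not> adj B P" using c by (elim conjE)
  show "\<not> adj Q P" using c by (elim conjE)
qed

text \<open>Rotating the pentagons is an even permutation \<open>\<sigma>\<close>. With the
  involution \<open>\<alpha>\<close> along the edges between \<open>A\<close> and \<open>B\<close>,
  the composite \<open>\<sigma> \<circ> \<alpha>\<close> rotates the 4-gons; both sides are the sign
  of this composite.\<close>

lemma snub45_sign: "(- 1 :: int) ^ (card V div 2) = (- 1) ^ (3 * (card V div 4))"
proof -
  have "\<forall>u \<in> V. \<exists>c. case c of (A, B, Q, D, P) \<Rightarrow> config u A B Q D P"
    using config_exists by simp
  from bchoice[OF this] obtain c where
    c: "\<forall>u \<in> V. case c u of (A, B, Q, D, P) \<Rightarrow> config u A B Q D P" by blast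
  define A where "A u = fst (c u)" for u
  define B where "B u = fst (snd (c u))" for u
  define Q where "Q u = fst (snd (snd (c u)))" for u
  define D where "D u = fst (snd (snd (snd (c u))))" for u
  define P where "P u = snd (snd (snd (snd (c u))))" for u
  have cfg: "config u (A u) (B u) (Q u) (D u) (P u)" if "u \<in> V" for u
    using bspec[OF c that] by (simp add: A_def B_def Q_def D_def P_def case_prod_unfold)
  note CD = configD[OF cfg]
  note all = CD(1) and mem = CD(3-12) and g = CD(13-17) and ad = CD(18-22) and na = CD(23-27)
  have PU: "T = P u" if "u \<in> V" "T \<in> F" "u \<in> T" "gon T = 5" for u T
  proof -
    have "T \<in> {A u, B u, Q u, D u, P u}" using all[OF that(1)] that(2,3) by blast
    then show ?thesis using g[OF that(1)] that(4) by auto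
  qed
  have QU: "T = Q u" if "u \<in> V" "T \<in> F" "u \<in> T" "gon T = 4" for u T
  proof -
    have "T \<in> {A u, B u, Q u, D u, P u}" using all[OF that(1)] that(2,3) by blast
    then show ?thesis using g[OF that(1)] that(4) by auto
  qed
  have TU: "T = A u \<or> T = B u \<or> T = D u" if "u \<in> V" "T \<in> F" "u \<in> T" "gon T = 3" for u T
  proof -
    have "T \<in> {A u, B u, Q u, D u, P u}" using all[OF that(1)] that(2,3) by blast
    then show ?thesis using g[OF that(1)] that(4) by auto
  qed
  have "\<forall>u \<in> V. \<exists>y. y \<noteq> u \<and> P u \<inter> A u \<inter> V = {u, y}"
    by (rule ballI, rule adj_edgeE[OF ad(5) mem(10) mem(6)]) auto
  from bchoice[OF this] obtain s where s: "\<forall>u \<in> V. s u \<noteq> u \<and> P u \<inter> A u \<inter> V = {u, s u}" by blast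
  have "\<forall>u \<in> V. \<exists>y. y \<noteq> u \<and> A u \<inter> B u \<inter> V = {u, y}"
    by (rule ballI, rule adj_edgeE[OF ad(1) mem(6) mem(7)]) auto
  from bchoice[OF this] obtain a where a: "\<forall>u \<in> V. a u \<noteq> u \<and> A u \<inter> B u \<inter> V = {u, a u}" by blast
  have sn: "s u \<noteq> u" and sE: "P u \<inter> A u \<inter> V = {u, s u}" and an: "a u \<noteq> u" and aE: "A u \<inter> B u \<inter> V = {u, a u}"
    if "u \<in> V" for u
    using bspec[OF s that] bspec[OF a that] by simp_all
  have sV: "s u \<in> V" "s u \<in> P u" "s u \<in> A u" and aV: "a u \<in> V" "a u \<in> A u" "a u \<in> B u" if "u \<in> V" for u
    using sE[OF that] aE[OF that] by blast+
  have sa: "s v \<noteq> a v" if v: "v \<in> V" for v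
  proof
    assume "s v = a v"
    then have "A v \<inter> P v \<inter> V = A v \<inter> B v \<inter> V" using sE[OF v] aE[OF v] by (simp add: Int_commute)
    then have "P v = B v" by (rule adj_edge_unique'[OF adj_sym[OF ad(5)[OF v]] ad(1)[OF v]])
    then show False using g[OF v] by simp
  qed
  have At: "A v \<inter> V = {v, s v, a v}" if v: "v \<in> V" for v
    by (rule triangle_eq[OF g(1)[OF v] mem(6)[OF v] sV(3)[OF v] aV(2)[OF v] v sV(1)[OF v] aV(1)[OF v]])
      (use sn[OF v] an[OF v] sa[OF v] in simp_all)
  \<comment> \<open>The two adjacent triangles exchange roles at the other end of their common edge.
    If \<open>A v\<close> kept its role there, both ends would lie on the pentagon
    \<open>P v\<close>, which meets \<open>A v\<close> in a different edge.\<close>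
  have key: "A v = B (a v) \<and> B v = A (a v) \<and> a (a v) = v" if v: "v \<in> V" for v
  proof -
    let ?w = "a v"
    note w = aV(1)[OF v]
    have "A v \<noteq> D ?w"
    proof
      assume e: "A v = D ?w"
      have "B v \<in> {A ?w, B ?w, Q ?w, D ?w, P ?w}" using all[OF w] mem(2)[OF v] aV(3)[OF v] by blast
      moreover have "B v \<noteq> Q ?w" "B v \<noteq> P ?w" using g[OF v] g[OF w] by auto
      moreover have "B v \<noteq> A ?w" "B v \<noteq> B ?w" "B v \<noteq> D ?w"
        using ad(1)[OF v] e na(2,3)[OF w] adj_sym adjD(3) by metis+
      ultimately show False by blast
    qed
    moreover have "A v \<noteq> A ?w"
    proof
      assume e: "A v = A ?w"
      have "s ?w \<in> {v, s v, ?w}" using At[OF v] sV[OF w] e by blast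
      moreover have "s ?w \<noteq> ?w" by (rule sn[OF w])
      ultimately have "s ?w \<in> P v" using mem(10)[OF v] sV(2)[OF v] by auto
      then have "P v = P (s ?w)" using PU[OF sV(1)[OF w] mem(5)[OF v] _ g(5)[OF v]] by simp
      moreover have "P ?w = P (s ?w)" using PU[OF sV(1)[OF w] mem(5)[OF w] sV(2)[OF w] g(5)[OF w]] .
      ultimately have "?w \<in> P v" using mem(10)[OF w] by simp
      then have "?w \<in> {v, s v}" using sE[OF v] aV[OF v] by blast
      then show False using an[OF v] sa[OF v] by simp
    qed
    ultimately have AB: "A v = B ?w" using TU[OF w mem(1)[OF v] aV(2)[OF v] g(1)[OF v]] by blast
    have "B v \<noteq> B ?w" using adjD(3)[OF ad(1)[OF v]] AB by simp
    moreover have "B v \<noteq> D ?w" using ad(1)[OF v] na(3)[OF w] AB by auto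
    ultimately have BA: "B v = A ?w" using TU[OF w mem(2)[OF v] aV(3)[OF v] g(2)[OF v]] by blast
    have "A ?w \<inter> B ?w \<inter> V = {?w, v}" using aE[OF v] AB BA by (simp add: Int_commute insert_commute)
    then have "a ?w = v" using aE[OF w] by (metis doubleton_eq_iff)
    then show ?thesis using AB BA by simp
  qed
  have Ps: "P (s v) = P v" if v: "v \<in> V" for v
    using PU[OF sV(1)[OF v] mem(5)[OF v] sV(2)[OF v] g(5)[OF v]] by simp
  \<comment> \<open>One step along the pentagon, the triangle just passed becomes the single
    triangle. So \<open>s v\<close> determines \<open>A v\<close> and \<open>P v\<close>, hence also
    \<open>v\<close>.\<close>
  have Ds: "D (s v) = A v" if v: "v \<in> V" for v
  proof -
    let ?y = "s v" and ?w = "a v"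
    note y = sV(1)[OF v] and w = aV(1)[OF v]
    have "A v \<noteq> B ?y" using ad(5)[OF v] na(4)[OF y] Ps[OF v] adj_sym by metis
    moreover have "A v \<noteq> A ?y"
    proof
      assume e: "A v = A ?y"
      have "a ?y \<in> {v, ?y, ?w}" using At[OF v] aV[OF y] e by blast
      moreover have "a ?y \<noteq> ?y" by (rule an[OF y])
      moreover have "a ?y \<noteq> v"
      proof
        assume "a ?y = v"
        then have "A v \<inter> B ?y \<inter> V = A v \<inter> P v \<inter> V"
          using aE[OF y] sE[OF v] e by (simp add: Int_commute insert_commute)
        then have "B ?y = P v"
          using adj_edge_unique'[of "A v" "B ?y" "P v"] ad(1)[OF y] adj_sym[OF ad(5)[OF v]] e by simp
        then show False using g[OF y] g[OF v] by simp
      qed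
      ultimately have "a ?y = ?w" by blast
      then have "?y = v" using key[OF y] key[OF v] by metis
      then show False using sn[OF v] by simp
    qed
    ultimately show ?thesis using TU[OF y mem(1)[OF v] sV(3)[OF v] g(1)[OF v]] by blast
  qed
  have s_inj: "v = v'" if v: "v \<in> V" "v' \<in> V" "s v = s v'" for v v'
  proof -
    have "A v = A v'" "P v = P v'" using Ds Ps v by metis+
    then have "{v, s v} = {v', s v}" using sE[OF v(1)] sE[OF v(2)] v(3) by simp
    then show ?thesis by (metis doubleton_eq_iff)
  qed
  have AD: "A v \<noteq> D v" "B v \<noteq> D v" if "v \<in> V" for v using CD(2)[OF that] by simp_all
  have ss: "s (s v) \<noteq> v" if v: "v \<in> V" for v
  proof
    assume e: "s (s v) = v"
    let ?y = "s v"
    note y = sV(1)[OF v]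
    have "P ?y \<inter> A ?y \<inter> V = P ?y \<inter> A v \<inter> V"
      using sE[OF v] sE[OF y] e Ps[OF v] by (simp add: insert_commute)
    then have "A ?y = A v"
      using adj_edge_unique'[OF ad(5)[OF y], of "A v"] ad(5)[OF v] Ps[OF v] by simp
    then show False using Ds[OF v] AD(1)[OF y] by simp
  qed
  \<comment> \<open>Since \<open>B v\<close> is \<open>A (a v)\<close>, its third corner is
    \<open>s (a v)\<close>; this is the next vertex of the 4-gon \<open>Q v\<close> along its edge
    with \<open>B v\<close>.\<close>
  have tE: "s (a v) \<noteq> v \<and> B v \<inter> Q v \<inter> V = {v, s (a v)}" if v: "v \<in> V" for v
  proof -
    let ?w = "a v"
    note w = aV(1)[OF v]
    obtain x where x: "x \<noteq> v" "B v \<inter> Q v \<inter> V = {v, x}" "x \<in> V" "x \<in> B v" "x \<in> Q v"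
      by (rule adj_edgeE[OF ad(2)[OF v] mem(7)[OF v] mem(8)[OF v] v])
    have "x \<noteq> ?w"
    proof
      assume "x = ?w"
      then have "B v \<inter> A v \<inter> V = B v \<inter> Q v \<inter> V" using x(2) aE[OF v] by (simp add: Int_commute)
      then have "A v = Q v" by (rule adj_edge_unique'[OF adj_sym[OF ad(1)[OF v]] ad(2)[OF v]])
      then show False using g[OF v] by simp
    qed
    then have Bt: "B v \<inter> V = {v, ?w, x}"
      by (intro triangle_eq[OF g(2)[OF v] mem(7)[OF v] aV(3)[OF v] x(4) v w x(3)]) (use an[OF v] x(1) in simp_all)
    have "s ?w \<in> {v, ?w, x}" using Bt sV[OF w] key[OF v] by blast
    moreover have "s ?w \<noteq> ?w" by (rule sn[OF w])
    moreover have "s ?w \<noteq> v"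
    proof
      assume "s ?w = v"
      then have "A ?w \<inter> P ?w \<inter> V = A ?w \<inter> B ?w \<inter> V"
        using sE[OF w] aE[OF w] key[OF v] by (simp add: Int_commute insert_commute)
      then have "P ?w = B ?w" by (rule adj_edge_unique'[OF adj_sym[OF ad(5)[OF w]] ad(1)[OF w]])
      then show False using g[OF w] by simp
    qed
    ultimately have "s ?w = x" by blast
    then show ?thesis using x by simp
  qed
  define \<sigma> where "\<sigma> v = (if v \<in> V then s v else v)" for v
  define \<alpha> where "\<alpha> v = (if v \<in> V then a v else v)" for v
  have \<sigma>: "\<sigma> permutes V"
  proof (rule bij_imp_permutes)
    have "inj_on \<sigma> V" by (rule inj_onI) (auto simp: \<sigma>_def intro: s_inj)
    moreover have "\<sigma> ` V \<subseteq> V" using sV by (auto simp: \<sigma>_def)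
    ultimately show "bij_betw \<sigma> V V" using fin(1) by (simp add: bij_betw_def endo_inj_surj)
  qed (simp add: \<sigma>_def)
  have \<alpha>: "\<alpha> permutes V"
  proof (rule bij_imp_permutes)
    have "inj_on \<alpha> V" by (rule inj_onI) (metis \<alpha>_def key)
    moreover have "\<alpha> ` V \<subseteq> V" using aV by (auto simp: \<alpha>_def)
    ultimately show "bij_betw \<alpha> V V" using fin(1) by (simp add: bij_betw_def endo_inj_surj)
  qed (simp add: \<alpha>_def)
  have pm: "permutation \<sigma>" "permutation \<alpha>" using \<sigma> \<alpha> fin(1) permutes_imp_permutation by blast+
  have \<tau>: "\<sigma> \<circ> \<alpha> permutes V" by (rule permutes_compose[OF \<alpha> \<sigma>])
  have \<tau>V: "(\<sigma> \<circ> \<alpha>) v = s (a v)" if "v \<in> V" for v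
    using that aV[OF that] by (simp add: \<sigma>_def \<alpha>_def)
  have "sign \<sigma> = (- 1) ^ ((5 - 1) * (card V div 5))"
  proof (rule conjunct2[OF sign_equal_orbits[OF fin(1) \<sigma>]], rule ballI)
    fix v assume v: "v \<in> V"
    have "orbit \<sigma> v = P v \<inter> V"
    proof (rule rotation_orbit[OF \<sigma> _ _ _ v])
      show "\<forall>v \<in> V. P v \<in> F \<and> v \<in> P v \<and> P (\<sigma> v) = P v" using mem Ps by (simp add: \<sigma>_def)
      show "\<forall>v \<in> V. \<exists>e \<in> E. e \<subseteq> P v \<and> e \<inter> V = {v, \<sigma> v}"
      proof
        fix v assume v: "v \<in> V"
        have "P v \<inter> A v \<in> E" using ad(5)[OF v] by (simp add: adj_def)
        then show "\<exists>e \<in> E. e \<subseteq> P v \<and> e \<inter> V = {v, \<sigma> v}"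
          using sE[OF v] v by (intro bexI[of _ "P v \<inter> A v"]) (simp_all add: \<sigma>_def)
      qed
      show "\<forall>v \<in> V. \<sigma> v \<noteq> v \<and> \<sigma> (\<sigma> v) \<noteq> v" using sn ss sV by (simp add: \<sigma>_def)
    qed
    then show "card (orbit \<sigma> v) = 5" using g(5)[OF v] by (simp add: gon_def)
  qed
  then have sg\<sigma>: "sign \<sigma> = 1" by (simp add: power_mult)
  have sg\<alpha>: "sign \<alpha> = (- 1) ^ (card V div 2)"
  proof -
    have "card (orbit \<alpha> v) = 2" if v: "v \<in> V" for v
    proof -
      have "(\<alpha> ^^ 2) v = v" using key[OF v] aV[OF v] v by (simp add: \<alpha>_def numeral_2_eq_2)
      then have "orbit \<alpha> v = {(\<alpha> ^^ m) v | m. m < 2}" by (rule orbit_altdef_bounded) simp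
      also have "\<dots> = {v, \<alpha> v}" by (force simp: numeral_2_eq_2 less_Suc_eq)
      finally show ?thesis using an[OF v] v by (simp add: \<alpha>_def)
    qed
    then show ?thesis using conjunct2[OF sign_equal_orbits[OF fin(1) \<alpha>, of 2]] by simp
  qed
  have sg\<tau>: "sign (\<sigma> \<circ> \<alpha>) = (- 1) ^ ((4 - 1) * (card V div 4))"
  proof (rule conjunct2[OF sign_equal_orbits[OF fin(1) \<tau>]], rule ballI)
    fix v assume v: "v \<in> V"
    have Qt: "Q (s (a v)) = Q v" if v: "v \<in> V" for v
    proof -
      have "s (a v) \<in> Q v" using tE[OF v] by blast
      then show ?thesis using QU[OF sV(1)[OF aV(1)[OF v]] mem(3)[OF v] _ g(3)[OF v]] by simp
    qed
    have "orbit (\<sigma> \<circ> \<alpha>) v = Q v \<inter> V"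
    proof (rule rotation_orbit[OF \<tau> _ _ _ v])
      show "\<forall>v \<in> V. Q v \<in> F \<and> v \<in> Q v \<and> Q ((\<sigma> \<circ> \<alpha>) v) = Q v" using mem Qt \<tau>V by simp
      show "\<forall>v \<in> V. \<exists>e \<in> E. e \<subseteq> Q v \<and> e \<inter> V = {v, (\<sigma> \<circ> \<alpha>) v}"
      proof
        fix v assume v: "v \<in> V"
        have "B v \<inter> Q v \<in> E" using ad(2)[OF v] by (simp add: adj_def)
        then show "\<exists>e \<in> E. e \<subseteq> Q v \<and> e \<inter> V = {v, (\<sigma> \<circ> \<alpha>) v}"
          using tE[OF v] \<tau>V[OF v] by (intro bexI[of _ "B v \<inter> Q v"]) simp_all
      qed
      show "\<forall>v \<in> V. (\<sigma> \<circ> \<alpha>) v \<noteq> v \<and> (\<sigma> \<circ> \<alpha>) ((\<sigma> \<circ> \<alpha>) v) \<noteq> v"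
      proof (intro ballI conjI)
        fix v assume v: "v \<in> V"
        then show "(\<sigma> \<circ> \<alpha>) v \<noteq> v" using tE[OF v] \<tau>V[OF v] by simp
        let ?x = "s (a v)"
        have x: "?x \<in> V" using sV(1)[OF aV(1)[OF v]] .
        have "s (a ?x) \<noteq> v"
        proof
          assume e: "s (a ?x) = v"
          have "Q v \<inter> B ?x \<inter> V = Q v \<inter> B v \<inter> V"
            using tE[OF x] tE[OF v] e Qt[OF v] by (simp add: Int_commute insert_commute)
          then have "B ?x = B v"
            using adj_edge_unique'[of "Q v" "B ?x" "B v"] adj_sym[OF ad(2)[OF v]] adj_sym[OF ad(2)[OF x]] Qt[OF v] by simp
          moreover have "D ?x = B v" using Ds[OF aV(1)[OF v]] key[OF v] by simp
          ultimately show False using AD(2)[OF x] by simp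
        qed
        then show "(\<sigma> \<circ> \<alpha>) ((\<sigma> \<circ> \<alpha>) v) \<noteq> v" using \<tau>V[OF v] \<tau>V[OF x] by simp
      qed
    qed
    then show "card (orbit (\<sigma> \<circ> \<alpha>) v) = 4" using g(3)[OF v] by (simp add: gon_def)
  qed
  show ?thesis using sign_compose[OF pm] sg\<sigma> sg\<alpha> sg\<tau> by simp
qed

end

subsection \<open>The type $[5,8,8]$\<close>

text \<open>Read \<open>a i j k\<close> as: pentagon \<open>i\<close> has a corner between octagons
  \<open>j\<close> and \<open>k\<close>. "Exactly two of four" is written as "of any three, at least
  one but not all", which yields clauses directly; after instantiating all indices a propositional
  refutation remains.\<close>

lemma no_pentagon_double_cover:
  fixes a :: "nat \<Rightarrow> nat \<Rightarrow> nat \<Rightarrow> bool"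
  assumes sym: "\<And>i j k. a i j k = a i k j"
    and two: "\<And>i j k1 k2 k3. i < 4 \<Longrightarrow> j < 5 \<Longrightarrow> k1 < 5 \<Longrightarrow> k2 < 5 \<Longrightarrow> k3 < 5 \<Longrightarrow>
      distinct [j, k1, k2, k3] \<Longrightarrow> (a i j k1 \<or> a i j k2 \<or> a i j k3) \<and> \<not> (a i j k1 \<and> a i j k2 \<and> a i j k3)"
    and pair: "\<And>j k i1 i2 i3. j < 5 \<Longrightarrow> k < 5 \<Longrightarrow> j \<noteq> k \<Longrightarrow> i1 < 4 \<Longrightarrow> i2 < 4 \<Longrightarrow> i3 < 4 \<Longrightarrow>
      distinct [i1, i2, i3] \<Longrightarrow> (a i1 j k \<or> a i2 j k \<or> a i3 j k) \<and> \<not> (a i1 j k \<and> a i2 j k \<and> a i3 j k)"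
    and angle: "\<And>i i' j k m. i < 4 \<Longrightarrow> i' < 4 \<Longrightarrow> j < 5 \<Longrightarrow> k < 5 \<Longrightarrow> m < 5 \<Longrightarrow> i \<noteq> i' \<Longrightarrow>
      distinct [j, k, m] \<Longrightarrow> \<not> (a i j k \<and> a i j m \<and> a i' j k \<and> a i' j m)"
  shows False
proof -
  have s4: "i \<in> {0, 1, 2, 3} \<Longrightarrow> i < 4" and s5: "j \<in> {0, 1, 2, 3, 4} \<Longrightarrow> j < 5" for i j :: nat by auto
  have 1: "\<forall>i \<in> {0, 1, 2, 3}. \<forall>j \<in> {0, 1, 2, 3, 4}. \<forall>k1 \<in> {0, 1, 2, 3, 4}. \<forall>k2 \<in> {0, 1, 2, 3, 4}. \<forall>k3 \<in> {0, 1, 2, 3, 4}.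
     k1 < k2 \<and> k2 < k3 \<and> j \<noteq> k1 \<and> j \<noteq> k2 \<and> j \<noteq> k3 \<longrightarrow>
     (a i j k1 \<or> a i j k2 \<or> a i j k3) \<and> \<not> (a i j k1 \<and> a i j k2 \<and> a i j k3)"
    by (intro ballI impI two s4 s5) auto
  have 2: "\<forall>j \<in> {0, 1, 2, 3, 4}. \<forall>k \<in> {0, 1, 2, 3, 4}. \<forall>i1 \<in> {0, 1, 2, 3}. \<forall>i2 \<in> {0, 1, 2, 3}. \<forall>i3 \<in> {0, 1, 2, 3}.
     j < k \<and> i1 < i2 \<and> i2 < i3 \<longrightarrow>
     (a i1 j k \<or> a i2 j k \<or> a i3 j k) \<and> \<not> (a i1 j k \<and> a i2 j k \<and> a i3 j k)"
    by (intro ballI impI pair s4 s5) auto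
  have 3: "\<forall>i \<in> {0, 1, 2, 3}. \<forall>i' \<in> {0, 1, 2, 3}. \<forall>j \<in> {0, 1, 2, 3, 4}. \<forall>k \<in> {0, 1, 2, 3, 4}. \<forall>m \<in> {0, 1, 2, 3, 4}.
     i < i' \<and> k < m \<and> j \<noteq> k \<and> j \<noteq> m \<longrightarrow> \<not> (a i j k \<and> a i j m \<and> a i' j k \<and> a i' j m)"
    by (intro ballI impI angle s4 s5) auto
  have 4: "\<forall>i \<in> {0, 1, 2, 3}. \<forall>j \<in> {0, 1, 2, 3, 4}. \<forall>k \<in> {0, 1, 2, 3, 4}. j < k \<longrightarrow> a i k j = a i j k"
    using sym by blast
  show False using 4 1 2 3
    by (simp del: de_Morgan_conj de_Morgan_disj) (elim conjE, sat)
qed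

lemma card_2_of_4:
  assumes "card {k \<in> K. Q k} = 2" "finite K" "card K = 4" "distinct [x, y, z]" "{x, y, z} \<subseteq> K"
  shows "(Q x \<or> Q y \<or> Q z) \<and> \<not> (Q x \<and> Q y \<and> Q z)"
proof
  have c3: "card {x, y, z} = 3" using assms(4) by simp
  show "Q x \<or> Q y \<or> Q z"
  proof (rule ccontr)
    assume "\<not> ?thesis"
    then have "{k \<in> K. Q k} \<subseteq> K - {x, y, z}" by blast
    then have "card {k \<in> K. Q k} \<le> card (K - {x, y, z})" using assms(2) by (intro card_mono) auto
    also have "\<dots> = 1" using c3 assms by (subst card_Diff_subset) auto
    finally show False using assms(1) by simp
  qed
  show "\<not> (Q x \<and> Q y \<and> Q z)"
  proof
    assume "Q x \<and> Q y \<and> Q z"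
    then have "{x, y, z} \<subseteq> {k \<in> K. Q k}" using assms(5) by blast
    then have "card {x, y, z} \<le> card {k \<in> K. Q k}" using assms(2) by (intro card_mono) auto
    then show False using c3 assms(1) by simp
  qed
qed

locale map588 = euler_map +
  assumes l: "l = [5, 8, 8]" and V20: "card V = 20"
begin

definition "Pent = {f \<in> F. gon f = 5}"
definition "Oct = {f \<in> F. gon f = 8}"

lemma card_Pent: "card Pent = 4" and card_Oct: "card Oct = 5"
  using card_gon[of 5] card_gon[of 8] l V20 by (simp_all add: Pent_def Oct_def)

text \<open>At a vertex of degree three, the two neighbours of a face are all the other
  faces.\<close>

lemma adj_at:
  assumes u: "u \<in> V" "u \<in> f" "u \<in> g" and f: "f \<in> F" "g \<in> F" "f \<noteq> g"
  shows "adj f g"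
proof -
  have "card ({k \<in> F. u \<in> k} - {f}) = 2"
    using card_faces_at[OF u(1)] l u f by (subst card_Diff_singleton) auto
  moreover have "{k \<in> F. u \<in> k \<and> adj f k} \<subseteq> {k \<in> F. u \<in> k} - {f}" using adjD(3) by blast
  moreover have "card {k \<in> F. u \<in> k \<and> adj f k} = 2" using card_adj_at[OF f(1) u(2,1)] .
  ultimately have "{k \<in> F. u \<in> k \<and> adj f k} = {k \<in> F. u \<in> k} - {f}"
    by (intro card_subset_eq) auto
  moreover have "g \<in> {k \<in> F. u \<in> k} - {f}" using u f by simp
  ultimately show ?thesis by blast
qed

lemma faces_at:
  assumes u: "u \<in> V"
  obtains P x y where "{f \<in> F. u \<in> f} = {P, x, y}" "P \<in> Pent" "x \<in> Oct" "y \<in> Oct" "x \<noteq> y"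
    "P \<noteq> x" "P \<noteq> y" "u \<in> P" "u \<in> x" "u \<in> y"
proof -
  have "card {f \<in> F. u \<in> f \<and> gon f = 5} = 1" "card {f \<in> F. u \<in> f \<and> gon f = 8} = 2"
    using card_at_gon[OF u] l by simp_all
  then obtain P x y where P: "{f \<in> F. u \<in> f \<and> gon f = 5} = {P}" and xy: "{f \<in> F. u \<in> f \<and> gon f = 8} = {x, y}" "x \<noteq> y"
    by (auto simp: card_1_singleton_iff card_2_iff)
  have "gon f = 5 \<or> gon f = 8" if "f \<in> F" for f using gon_in_type[OF that] l by auto
  then have "{f \<in> F. u \<in> f} = {f \<in> F. u \<in> f \<and> gon f = 5} \<union> {f \<in> F. u \<in> f \<and> gon f = 8}" by blast
  then have "{f \<in> F. u \<in> f} = {P, x, y}" unfolding P xy by blast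
  note eq = this
  have "P \<in> {f \<in> F. u \<in> f \<and> gon f = 5}" "x \<in> {f \<in> F. u \<in> f \<and> gon f = 8}" "y \<in> {f \<in> F. u \<in> f \<and> gon f = 8}"
    unfolding P xy by simp_all
  then have "P \<in> Pent" "x \<in> Oct" "y \<in> Oct" "u \<in> P" "u \<in> x" "u \<in> y" "gon P = 5" "gon x = 8" "gon y = 8"
    by (simp_all add: Pent_def Oct_def)
  moreover from this have "P \<noteq> x" "P \<noteq> y" by auto
  ultimately show ?thesis by (intro that[OF eq _ _ _ xy(2)])
qed

lemma Pent_Oct: "P \<in> Pent \<Longrightarrow> x \<in> Oct \<Longrightarrow> P \<noteq> x" "P \<in> Pent \<Longrightarrow> P \<in> F" "x \<in> Oct \<Longrightarrow> x \<in> F"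
  by (auto simp: Pent_def Oct_def)

lemma no_four:
  assumes "u \<in> V" "u \<in> P" "u \<in> x" "u \<in> y" "P \<in> Pent" "x \<in> Oct" "y \<in> Oct" "x \<noteq> y" "f \<in> F" "u \<in> f"
  shows "f \<in> {P, x, y}"
proof -
  have "{P, x, y} \<subseteq> {f \<in> F. u \<in> f}" using assms Pent_Oct by blast
  moreover have "card {P, x, y} = card {f \<in> F. u \<in> f}"
    using card_faces_at[OF assms(1)] l assms Pent_Oct(1)[of P x] Pent_Oct(1)[of P y] by simp
  ultimately have "{P, x, y} = {f \<in> F. u \<in> f}" by (intro card_subset_eq) auto
  then show ?thesis using assms by blast
qed

lemma Pent_unique:
  assumes "u \<in> V" "u \<in> P" "u \<in> Q" "P \<in> Pent" "Q \<in> Pent" shows "P = Q"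
proof -
  obtain P' x y where p: "{f \<in> F. u \<in> f} = {P', x, y}" "P' \<in> Pent" "x \<in> Oct" "y \<in> Oct" "x \<noteq> y"
    "P' \<noteq> x" "P' \<noteq> y" "u \<in> P'" "u \<in> x" "u \<in> y" by (rule faces_at[OF assms(1)])
  have "P \<in> {P', x, y}" "Q \<in> {P', x, y}" unfolding p(1)[symmetric] using assms Pent_Oct by auto
  then show ?thesis using Pent_Oct(1)[OF assms(4)] Pent_Oct(1)[OF assms(5)] p by blast
qed

text \<open>A pentagon has five neighbours, none of them a pentagon because only one passes through
  each vertex; and there are just five octagons.\<close>

lemma Pent_adj_Oct: assumes P: "P \<in> Pent" and x: "x \<in> Oct" shows "adj P x"
proof -
  note PF = Pent_Oct(2)[OF P]
  have "2 * card {g \<in> F. adj P g} = (\<Sum>u\<in>P \<inter> V. card {g \<in> F. u \<in> g \<and> adj P g})"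
    using sum_adj_at[OF PF, of "\<lambda>_. True"] by simp
  also have "\<dots> = (\<Sum>u\<in>P \<inter> V. 2)" using card_adj_at[OF PF] by (intro sum.cong refl) blast
  finally have "card {g \<in> F. adj P g} = card Oct" using P card_Oct by (simp add: Pent_def gon_def)
  moreover have "{g \<in> F. adj P g} \<subseteq> Oct"
  proof
    fix g assume g: "g \<in> {g \<in> F. adj P g}"
    then have a: "adj P g" by simp
    have "P \<inter> g \<inter> V \<noteq> {}" using adj_card[OF a] by (metis card.empty zero_neq_numeral)
    then obtain u where u: "u \<in> P" "u \<in> g" "u \<in> V" by blast
    have "g \<notin> Pent" using Pent_unique[OF u(3,1,2) P] adjD(3)[OF a] by blast
    moreover have "gon g = 5 \<or> gon g = 8" using gon_in_type[OF adjD(2)[OF a]] l by auto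
    ultimately show "g \<in> Oct" using adjD(2)[OF a] by (auto simp: Pent_def Oct_def)
  qed
  moreover have "finite Oct" by (simp add: Oct_def)
  ultimately have "{g \<in> F. adj P g} = Oct" by (intro card_subset_eq) auto
  then show ?thesis using x by blast
qed

text \<open>An octagon has one octagonal neighbour at each of its eight vertices, hence four in all,
  and these are all the others.\<close>

lemma Oct_adj_Oct: assumes x: "x \<in> Oct" and y: "y \<in> Oct" "x \<noteq> y" shows "adj x y"
proof -
  note xF = Pent_Oct(3)[OF x]
  have "2 * card {g \<in> F. adj x g \<and> g \<in> Oct} = (\<Sum>u\<in>x \<inter> V. card {g \<in> F. u \<in> g \<and> adj x g \<and> g \<in> Oct})"
    using sum_adj_at[OF xF, of "\<lambda>g. g \<in> Oct"] by simp
  also have "\<dots> = (\<Sum>u\<in>x \<inter> V. 1)"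
  proof (rule sum.cong[OF refl])
    fix u assume u: "u \<in> x \<inter> V"
    then have uV: "u \<in> V" "u \<in> x" by auto
    obtain P z w where p: "{f \<in> F. u \<in> f} = {P, z, w}" "P \<in> Pent" "z \<in> Oct" "w \<in> Oct" "z \<noteq> w"
      "P \<noteq> z" "P \<noteq> w" "u \<in> P" "u \<in> z" "u \<in> w" by (rule faces_at[OF uV(1)])
    have "x \<in> {P, z, w}" unfolding p(1)[symmetric] using xF uV by simp
    then have "x = z \<or> x = w" using Pent_Oct(1)[OF p(2) x] by blast
    then have "\<exists>z'. {P, z, w} = {P, x, z'} \<and> z' \<in> Oct \<and> z' \<noteq> x \<and> u \<in> z'"
    proof
      assume "x = z"
      then show ?thesis using p(4,5,10) by blast
    next
      assume "x = w"
      moreover have "{P, z, w} = {P, w, z}" by blast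
      ultimately show ?thesis using p(3,5,9) by blast
    qed
    then obtain z' where z': "{P, z, w} = {P, x, z'}" "z' \<in> Oct" "z' \<noteq> x" "u \<in> z'" by blast
    have "adj x z'" by (rule adj_at[OF uV z'(4) xF Pent_Oct(3)[OF z'(2)]]) (use z'(3) in simp)
    have "{g \<in> F. u \<in> g \<and> adj x g \<and> g \<in> Oct} = {z'}"
    proof
      show "{g \<in> F. u \<in> g \<and> adj x g \<and> g \<in> Oct} \<subseteq> {z'}"
      proof
        fix g assume g: "g \<in> {g \<in> F. u \<in> g \<and> adj x g \<and> g \<in> Oct}"
        then have "g \<in> {f \<in> F. u \<in> f}" by simp
        then have "g \<in> {P, x, z'}" unfolding p(1) z'(1) .
        moreover have "g \<noteq> P" "g \<noteq> x" using g Pent_Oct(1)[OF p(2)] adjD(3) by blast+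
        ultimately show "g \<in> {z'}" by blast
      qed
      show "{z'} \<subseteq> {g \<in> F. u \<in> g \<and> adj x g \<and> g \<in> Oct}" using \<open>adj x z'\<close> z' Pent_Oct(3) by simp
    qed
    then show "card {g \<in> F. u \<in> g \<and> adj x g \<and> g \<in> Oct} = 1" by simp
  qed
  finally have "card {g \<in> F. adj x g \<and> g \<in> Oct} = 4" using x by (simp add: Oct_def gon_def)
  moreover have fO: "finite Oct" by (simp add: Oct_def)
  have "card (Oct - {x}) = 4" using card_Oct x fO by simp
  moreover have "{g \<in> F. adj x g \<and> g \<in> Oct} \<subseteq> Oct - {x}" using adjD(3) by blast
  ultimately have "{g \<in> F. adj x g \<and> g \<in> Oct} = Oct - {x}" using fO by (intro card_subset_eq) auto
  moreover have "y \<in> Oct - {x}" using y by blast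
  ultimately show ?thesis by blast
qed

definition link :: "'a set \<Rightarrow> 'a set \<Rightarrow> 'a set \<Rightarrow> bool" where
  "link P x y \<longleftrightarrow> (\<exists>u \<in> V. u \<in> P \<and> u \<in> x \<and> u \<in> y)"

lemma link_sym: "link P x y = link P y x"
  by (auto simp: link_def)

text \<open>At each end of the edge between \<open>P\<close> and \<open>x\<close> there is one more
  octagon. A single octagon at both ends would meet \<open>P\<close> in the same edge as
  \<open>x\<close>.\<close>

lemma corner_edge:
  assumes P: "P \<in> Pent" "x \<in> Oct"
  obtains v w y z where "P \<inter> x \<inter> V = {v, w}" "v \<noteq> w" "v \<in> V" "w \<in> V" "v \<in> y" "w \<in> z"
    "y \<in> Oct" "z \<in> Oct" "y \<noteq> x" "z \<noteq> x" "y \<noteq> z"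
proof -
  note a = Pent_adj_Oct[OF P]
  have "P \<inter> x \<inter> V \<noteq> {}" using adj_card[OF a] by (metis card.empty zero_neq_numeral)
  then obtain v where v: "v \<in> P" "v \<in> x" "v \<in> V" by blast
  obtain w where w: "w \<noteq> v" "P \<inter> x \<inter> V = {v, w}" "w \<in> V" "w \<in> P" "w \<in> x"
    by (rule adj_edgeE[OF a v])
  have ex: "\<exists>y. y \<in> Oct \<and> y \<noteq> x \<and> u \<in> y" if u: "u \<in> V" "u \<in> x" for u
  proof -
    obtain P' z w where p: "{f \<in> F. u \<in> f} = {P', z, w}" "P' \<in> Pent" "z \<in> Oct" "w \<in> Oct" "z \<noteq> w"
      "P' \<noteq> z" "P' \<noteq> w" "u \<in> P'" "u \<in> z" "u \<in> w" by (rule faces_at[OF u(1)])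
    then show ?thesis by metis
  qed
  obtain y where y: "y \<in> Oct" "y \<noteq> x" "v \<in> y" using ex[OF v(3,2)] by blast
  obtain z where z: "z \<in> Oct" "z \<noteq> x" "w \<in> z" using ex[OF w(3,5)] by blast
  have "y \<noteq> z"
  proof
    assume e: "y = z"
    have "v \<in> P \<inter> y \<inter> V" "w \<in> P \<inter> y \<inter> V" using v w y z e by auto
    moreover obtain w' where "P \<inter> y \<inter> V = {v, w'}"
      by (rule adj_edgeE[OF Pent_adj_Oct[OF P(1) y(1)] v(1) y(3) v(3)])
    ultimately have "P \<inter> y \<inter> V = P \<inter> x \<inter> V" using w(1,2) by auto
    then have "y = x" by (rule adj_edge_unique'[OF Pent_adj_Oct[OF P(1) y(1)] a])
    then show False using y by simp
  qed
  then show ?thesis using that[OF w(2) _ v(3) w(3) y(3) z(3) y(1) z(1) y(2) z(2)] w(1) by simp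
qed

lemma card_link_Oct:
  assumes P: "P \<in> Pent" "x \<in> Oct" shows "card {y \<in> Oct - {x}. link P x y} = 2"
proof -
  obtain v w y z where c: "P \<inter> x \<inter> V = {v, w}" "v \<noteq> w" "v \<in> V" "w \<in> V" "v \<in> y" "w \<in> z"
    "y \<in> Oct" "z \<in> Oct" "y \<noteq> x" "z \<noteq> x" "y \<noteq> z" by (rule corner_edge[OF P])
  have vw: "v \<in> P" "v \<in> x" "w \<in> P" "w \<in> x" using c(1) by blast+
  have "{t \<in> Oct - {x}. link P x t} = {y, z}"
  proof
    show "{t \<in> Oct - {x}. link P x t} \<subseteq> {y, z}"
    proof
      fix t assume "t \<in> {t \<in> Oct - {x}. link P x t}"
      then obtain u where t: "t \<in> Oct" "t \<noteq> x" and u: "u \<in> V" "u \<in> P" "u \<in> x" "u \<in> t"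
        by (auto simp: link_def)
      have "u \<in> {v, w}" unfolding c(1)[symmetric] using u by simp
      moreover have "t = y" if "u = v"
        using no_four[OF c(3) vw(1,2) c(5) P c(7) c(9)[symmetric] Pent_Oct(3)[OF t(1)]] u(4) that t Pent_Oct(1)[OF P(1)] by blast
      moreover have "t = z" if "u = w"
        using no_four[OF c(4) vw(3,4) c(6) P c(8) c(10)[symmetric] Pent_Oct(3)[OF t(1)]] u(4) that t Pent_Oct(1)[OF P(1)] by blast
      ultimately show "t \<in> {y, z}" by blast
    qed
    show "{y, z} \<subseteq> {t \<in> Oct - {x}. link P x t}" using c vw by (auto simp: link_def)
  qed
  then show ?thesis using c(11) by simp
qed

lemma Oct_edge:
  assumes x: "x \<in> Oct" "y \<in> Oct" "x \<noteq> y"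
  obtains v w P Q where "x \<inter> y \<inter> V = {v, w}" "v \<noteq> w" "v \<in> V" "w \<in> V" "v \<in> P" "w \<in> Q"
    "P \<in> Pent" "Q \<in> Pent" "P \<noteq> Q"
proof -
  note a = Oct_adj_Oct[OF x]
  have "x \<inter> y \<inter> V \<noteq> {}" using adj_card[OF a] by (metis card.empty zero_neq_numeral)
  then obtain v where v: "v \<in> x" "v \<in> y" "v \<in> V" by blast
  obtain w where w: "w \<noteq> v" "x \<inter> y \<inter> V = {v, w}" "w \<in> V" "w \<in> x" "w \<in> y"
    by (rule adj_edgeE[OF a v])
  have ex: "\<exists>P. P \<in> Pent \<and> u \<in> P" if u: "u \<in> V" for u
    by (rule faces_at[OF u]) blast
  obtain P where P: "P \<in> Pent" "v \<in> P" using ex[OF v(3)] by blast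
  obtain Q where Q: "Q \<in> Pent" "w \<in> Q" using ex[OF w(3)] by blast
  have "P \<noteq> Q"
  proof
    assume e: "P = Q"
    have pa: "adj x P" using adj_sym[OF Pent_adj_Oct[OF P(1) x(1)]] .
    obtain w' where "x \<inter> P \<inter> V = {v, w'}" by (rule adj_edgeE[OF pa v(1) P(2) v(3)])
    moreover have "w \<in> x \<inter> P \<inter> V" using w Q e by simp
    ultimately have "x \<inter> P \<inter> V = x \<inter> y \<inter> V" using w(1,2) by auto
    then have "P = y" by (rule adj_edge_unique'[OF pa a])
    then show False using Pent_Oct(1)[OF P(1) x(2)] by simp
  qed
  then show ?thesis using that[OF w(2) _ v(3) w(3) P(2) Q(2) P(1) Q(1)] w(1) by simp
qed

lemma card_link_Pent:
  assumes x: "x \<in> Oct" "y \<in> Oct" "x \<noteq> y" shows "card {P \<in> Pent. link P x y} = 2"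
proof -
  obtain v w P Q where c: "x \<inter> y \<inter> V = {v, w}" "v \<noteq> w" "v \<in> V" "w \<in> V" "v \<in> P" "w \<in> Q"
    "P \<in> Pent" "Q \<in> Pent" "P \<noteq> Q" by (rule Oct_edge[OF x])
  have "{R \<in> Pent. link R x y} = {P, Q}"
  proof
    show "{R \<in> Pent. link R x y} \<subseteq> {P, Q}"
    proof
      fix R assume "R \<in> {R \<in> Pent. link R x y}"
      then obtain u where R: "R \<in> Pent" and u: "u \<in> V" "u \<in> R" "u \<in> x" "u \<in> y" by (auto simp: link_def)
      have "u \<in> {v, w}" unfolding c(1)[symmetric] using u by simp
      then show "R \<in> {P, Q}" using Pent_unique[OF u(1,2) _ R] c by blast
    qed
    show "{P, Q} \<subseteq> {R \<in> Pent. link R x y}" using c by (auto simp: link_def)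
  qed
  then show ?thesis using c(9) by simp
qed

text \<open>Otherwise the boundary of the octagon \<open>x\<close> would close up after four edges.\<close>

lemma link_angle:
  assumes P: "P \<in> Pent" "Q \<in> Pent" "P \<noteq> Q" and x: "x \<in> Oct" "y \<in> Oct" "z \<in> Oct" "x \<noteq> y" "x \<noteq> z" "y \<noteq> z"
    and lk: "link P x y" "link P x z" "link Q x y" "link Q x z"
  shows False
proof -
  obtain v where v: "v \<in> V" "v \<in> P" "v \<in> x" "v \<in> y" using lk(1) unfolding link_def by blast
  obtain w where w: "w \<in> V" "w \<in> P" "w \<in> x" "w \<in> z" using lk(2) unfolding link_def by blast
  obtain v' where v': "v' \<in> V" "v' \<in> Q" "v' \<in> x" "v' \<in> y" using lk(3) unfolding link_def by blast
  obtain w' where w': "w' \<in> V" "w' \<in> Q" "w' \<in> x" "w' \<in> z" using lk(4) unfolding link_def by blast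
  have "v \<noteq> w"
  proof
    assume "v = w"
    then have "z \<in> {P, x, y}" using no_four[OF v P(1) x(1,2,4) Pent_Oct(3)[OF x(3)]] w by simp
    then show False using x Pent_Oct(1)[OF P(1) x(3)] by blast
  qed
  have "v' \<noteq> w'"
  proof
    assume "v' = w'"
    then have "z \<in> {Q, x, y}" using no_four[OF v' P(2) x(1,2,4) Pent_Oct(3)[OF x(3)]] w' by simp
    then show False using x Pent_Oct(1)[OF P(2) x(3)] by blast
  qed
  have "v \<noteq> v'" using Pent_unique[OF v(1,2) _ P(1,2)] v' P(3) by blast
  have "w \<noteq> w'" using Pent_unique[OF w(1,2) _ P(1,2)] w' P(3) by blast
  \<comment> \<open>At a corner \<open>a\<close> of \<open>x\<close>, one boundary edge runs along
    the pentagon \<open>R\<close> to \<open>b\<close> and the other along the octagon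
    \<open>t\<close> to \<open>c\<close>.\<close>
  have cover: "e \<inter> V \<subseteq> {a, b, c}"
    if e: "e \<in> E" "e \<subseteq> x" "a \<in> e" and a: "a \<in> V" "a \<in> x" "a \<in> R" "b \<in> R" "a \<in> t" "c \<in> t"
      and bc: "b \<in> x" "c \<in> x" "b \<in> V" "c \<in> V" "b \<noteq> a" "c \<noteq> a" and R: "R \<in> Pent" "t \<in> Oct" "t \<noteq> x"
    for e a b c R t
  proof -
    obtain g where g: "adj x g" "x \<inter> g = e" by (rule edge_face_pair[OF e(1) Pent_Oct(3)[OF x(1)] e(2)])
    have "a \<in> g" using e(3) g(2) by blast
    then have "g \<in> {R, x, t}"
      using no_four[OF a(1,3,2,5) R(1) x(1) R(2) R(3)[symmetric] adjD(2)[OF g(1)]] by simp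
    then have "g = R \<or> g = t" using adjD(3)[OF g(1)] by blast
    then show ?thesis
    proof
      assume "g = R"
      then have "a \<in> e" "b \<in> e" using g(2) a bc by auto
      then show ?thesis using edge_vertices[OF e(1), of a b] bc a by auto
    next
      assume "g = t"
      then have "a \<in> e" "c \<in> e" using g(2) a bc by auto
      then show ?thesis using edge_vertices[OF e(1), of a c] bc a by auto
    qed
  qed
  have "{v, w, v', w'} = x \<inter> V"
  proof (rule face_boundary_connected[OF Pent_Oct(3)[OF x(1)]])
    show "{v, w, v', w'} \<subseteq> x \<inter> V" using v w v' w' by blast
    fix e assume e: "e \<in> E" "e \<subseteq> x" "e \<inter> {v, w, v', w'} \<noteq> {}"
    then consider "v \<in> e" | "w \<in> e" | "v' \<in> e" | "w' \<in> e" by blast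
    then show "e \<inter> V \<subseteq> {v, w, v', w'}"
    proof cases
      case 1
      have "e \<inter> V \<subseteq> {v, w, v'}"
        by (rule cover[OF e(1,2) 1 v(1,3,2) w(2) v(4) v'(4) w(3) v'(3) w(1) v'(1) _ _ P(1) x(2)])
           (use \<open>v \<noteq> w\<close> \<open>v \<noteq> v'\<close> x in auto)
      then show ?thesis by blast
    next
      case 2
      have "e \<inter> V \<subseteq> {w, v, w'}"
        by (rule cover[OF e(1,2) 2 w(1,3,2) v(2) w(4) w'(4) v(3) w'(3) v(1) w'(1) _ _ P(1) x(3)])
           (use \<open>v \<noteq> w\<close> \<open>w \<noteq> w'\<close> x in auto)
      then show ?thesis by blast
    next
      case 3
      have "e \<inter> V \<subseteq> {v', w', v}"
        by (rule cover[OF e(1,2) 3 v'(1,3,2) w'(2) v'(4) v(4) w'(3) v(3) w'(1) v(1) _ _ P(2) x(2)])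
           (use \<open>v' \<noteq> w'\<close> \<open>v \<noteq> v'\<close> x in auto)
      then show ?thesis by blast
    next
      case 4
      have "e \<inter> V \<subseteq> {w', v', w}"
        by (rule cover[OF e(1,2) 4 w'(1,3,2) v'(2) w'(4) w(4) v'(3) w(3) v'(1) w(1) _ _ P(2) x(3)])
           (use \<open>v' \<noteq> w'\<close> \<open>w \<noteq> w'\<close> x in auto)
      then show ?thesis by blast
    qed
  qed simp
  moreover have "card {v, w, v', w'} \<le> 4" by (simp add: card_insert_if)
  ultimately show False using x(1) by (simp add: Oct_def gon_def)
qed

lemma contradiction: False
proof -
  have fO: "finite Oct" and fP: "finite Pent" by (simp_all add: Oct_def Pent_def)
  obtain xs where xs: "set xs = Oct" "distinct xs" using finite_distinct_list[OF fO] by blast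
  obtain ps where ps: "set ps = Pent" "distinct ps" using finite_distinct_list[OF fP] by blast
  have len: "length xs = 5" "length ps = 4"
    using distinct_card[OF xs(2)] distinct_card[OF ps(2)] card_Oct card_Pent xs ps by simp_all
  have X: "xs ! j \<in> Oct" if "j < 5" for j using that len xs(1) by (metis nth_mem)
  have P: "ps ! i \<in> Pent" if "i < 4" for i using that len ps(1) by (metis nth_mem)
  have Xn: "xs ! j \<noteq> xs ! k" if "j < 5" "k < 5" "j \<noteq> k" for j k
    using that len xs(2) by (simp add: nth_eq_iff_index_eq)
  have Pent: "ps ! j \<noteq> ps ! k" if "j < 4" "k < 4" "j \<noteq> k" for j k
    using that len ps(2) by (simp add: nth_eq_iff_index_eq)
  show False
  proof (rule no_pentagon_double_cover[of "\<lambda>i j k. link (ps ! i) (xs ! j) (xs ! k)"])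
    show "link (ps ! i) (xs ! j) (xs ! k) = link (ps ! i) (xs ! k) (xs ! j)" for i j k by (rule link_sym)
  next
    fix i j k1 k2 k3 :: nat
    assume i: "i < 4" and j: "j < 5" "k1 < 5" "k2 < 5" "k3 < 5" and d: "distinct [j, k1, k2, k3]"
    show "(link (ps ! i) (xs ! j) (xs ! k1) \<or> link (ps ! i) (xs ! j) (xs ! k2) \<or> link (ps ! i) (xs ! j) (xs ! k3)) \<and>
      \<not> (link (ps ! i) (xs ! j) (xs ! k1) \<and> link (ps ! i) (xs ! j) (xs ! k2) \<and> link (ps ! i) (xs ! j) (xs ! k3))"
    proof (rule card_2_of_4[where K = "Oct - {xs ! j}" and Q = "link (ps ! i) (xs ! j)"])
      show "card {k \<in> Oct - {xs ! j}. link (ps ! i) (xs ! j) k} = 2" by (rule card_link_Oct[OF P[OF i] X[OF j(1)]])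
      show "card (Oct - {xs ! j}) = 4" using card_Oct X[OF j(1)] fO by simp
      show "distinct [xs ! k1, xs ! k2, xs ! k3]" using d Xn j by simp
      show "{xs ! k1, xs ! k2, xs ! k3} \<subseteq> Oct - {xs ! j}" using d X j Xn[of j] by auto
    qed (use fO in simp)
  next
    fix j k i1 i2 i3 :: nat
    assume j: "j < 5" "k < 5" "j \<noteq> k" and i: "i1 < 4" "i2 < 4" "i3 < 4" and d: "distinct [i1, i2, i3]"
    show "(link (ps ! i1) (xs ! j) (xs ! k) \<or> link (ps ! i2) (xs ! j) (xs ! k) \<or> link (ps ! i3) (xs ! j) (xs ! k)) \<and>
      \<not> (link (ps ! i1) (xs ! j) (xs ! k) \<and> link (ps ! i2) (xs ! j) (xs ! k) \<and> link (ps ! i3) (xs ! j) (xs ! k))"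
    proof (rule card_2_of_4[where K = Pent and Q = "\<lambda>P. link P (xs ! j) (xs ! k)"])
      show "card {P \<in> Pent. link P (xs ! j) (xs ! k)} = 2"
        by (rule card_link_Pent[OF X[OF j(1)] X[OF j(2)] Xn[OF j]])
      show "distinct [ps ! i1, ps ! i2, ps ! i3]" using d Pent i by simp
      show "{ps ! i1, ps ! i2, ps ! i3} \<subseteq> Pent" using P i by simp
    qed (use fP card_Pent in simp_all)
  next
    fix i i' j k m :: nat
    assume i: "i < 4" "i' < 4" and j: "j < 5" "k < 5" "m < 5" and ii: "i \<noteq> i'" and d: "distinct [j, k, m]"
    show "\<not> (link (ps ! i) (xs ! j) (xs ! k) \<and> link (ps ! i) (xs ! j) (xs ! m) \<and>
       link (ps ! i') (xs ! j) (xs ! k) \<and> link (ps ! i') (xs ! j) (xs ! m))"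
      using link_angle[OF P[OF i(1)] P[OF i(2)] Pent[OF i ii] X[OF j(1)] X[OF j(2)] X[OF j(3)]] Xn j d by auto
  qed
qed

end

subsection \<open>The type $[3,5,5,5]$\<close>

type_synonym literal = "((nat \<times> nat) \<times> nat) \<times> bool"
type_synonym table = "((nat \<times> nat) \<times> nat list) list"

text \<open>The nine pentagons are numbered, and \<open>cs ! p\<close> lists those of the five triangles that share an
  edge with \<open>p\<close>. At each vertex there are a triangle, two pentagons \<open>p, q\<close> sharing an edge with it
  and the opposite pentagon \<open>m\<close>; this is the variable \<open>((p, q), m)\<close>.\<close>

definition touch :: "nat list list \<Rightarrow> nat \<Rightarrow> nat \<Rightarrow> bool" where
  "touch cs p q \<longleftrightarrow> list_ex (\<lambda>t. List.member (cs ! q) t) (cs ! p)"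

definition touching :: "nat list list \<Rightarrow> (nat \<times> nat) list" where
  "touching cs = [(p, q). p \<leftarrow> [0..<9], q \<leftarrow> [Suc p..<9], touch cs p q]"

text \<open>The opposite pentagon shares edges with \<open>p\<close> and \<open>q\<close>, whereas
  pentagons touching the same triangle share none; so pentagons touching \<open>p\<close> or
  \<open>q\<close> are excluded from the start.\<close>

definition mids :: "nat list list \<Rightarrow> nat \<times> nat \<Rightarrow> nat list" where
  "mids cs v = filter (\<lambda>m. m \<noteq> fst v) (filter (\<lambda>m. m \<noteq> snd v)
     (filter (\<lambda>m. \<not> touch cs (fst v) m) (filter (\<lambda>m. \<not> touch cs (snd v) m) [0..<9])))"

definition table :: "nat list list \<Rightarrow> table" where
  "table cs = map (\<lambda>v. (v, mids cs v)) (touching cs)"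

definition mid_at :: "table \<Rightarrow> nat \<Rightarrow> (nat \<times> nat) list" where
  "mid_at D m = map fst (filter (\<lambda>d. List.member (snd d) m) D)"

definition pair_less :: "nat \<times> nat \<Rightarrow> nat \<times> nat \<Rightarrow> bool" where
  "pair_less v w \<longleftrightarrow> (if fst v = fst w then snd v < snd w else fst v < fst w)"

text \<open>Puts a cardinality bound into clausal form: if more than \<open>r\<close> entries of a
  list are true, every sublist lacking just \<open>r\<close> entries still contains a true
  one.\<close>

fun omit :: "nat \<Rightarrow> 'b list \<Rightarrow> 'b list list" where
  "omit 0 xs = [xs]"
| "omit (Suc r) [] = []"
| "omit (Suc r) (x # xs) = omit r xs @ map ((#) x) (omit (Suc r) xs)"

text \<open>In this order: each pair of pentagons touching the same triangle has an opposite pentagon; only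
  one; the three corners of a triangle have distinct opposite pentagons; \<open>m\<close> is opposite at exactly
  \<open>5 - 2k\<close> vertices if it has \<open>k\<close> triangles (at most \<open>1\<close> for \<open>k = 2\<close>, and at least that many in
  general, by omitting any \<open>4 - 2k\<close> corners); the edge shared by \<open>p\<close> and \<open>m\<close> has another end.\<close>

definition clauses_of :: "nat list list \<Rightarrow> table \<Rightarrow> (nat \<times> nat) list list \<Rightarrow> literal list list" where
  "clauses_of cs D ats =
     map (\<lambda>(v, ms). map (\<lambda>m. ((v, m), True)) ms) D @
     [[((v, m), False), ((v, n), False)]. (v, ms) \<leftarrow> D, m \<leftarrow> ms, n \<leftarrow> ms, m < n] @
     [[((v, m), False), ((w, m), False)]. (v, ms) \<leftarrow> D, (w, _) \<leftarrow> D, pair_less v w,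
        list_ex (\<lambda>t. List.member (cs ! snd v) t \<and> List.member (cs ! fst w) t \<and> List.member (cs ! snd w) t) (cs ! fst v),
        m \<leftarrow> ms] @
     [[((v, m), False), ((w, m), False)]. m \<leftarrow> filter (\<lambda>m. length (cs ! m) = 2) [0..<9],
        v \<leftarrow> ats ! m, w \<leftarrow> ats ! m, pair_less v w] @
     [map (\<lambda>v. ((v, m), True)) vs. m \<leftarrow> filter (\<lambda>m. cs ! m \<noteq> []) [0..<9], vs \<leftarrow> omit (4 - 2 * length (cs ! m)) (ats ! m)] @
     [((v, m), False) # map (\<lambda>w. ((w, m), True)) (filter (\<lambda>w. w \<noteq> v \<and> (fst w = p \<or> snd w = p)) (ats ! m)) @
        map (\<lambda>w. ((w, p), True)) (filter (\<lambda>w. fst w = m \<or> snd w = m) (ats ! p)).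
        (v, ms) \<leftarrow> D, m \<leftarrow> ms, p \<leftarrow> [fst v, snd v]]"

definition clauses_of_table :: "nat list list \<Rightarrow> table \<Rightarrow> literal list list" where
  "clauses_of_table cs D = clauses_of cs D (map (mid_at D) [0..<9])"

definition clauses :: "nat list list \<Rightarrow> literal list list" where
  "clauses cs = clauses_of_table cs (table cs)"

text \<open>Recursive, like \<open>all_clauses\<close> and \<open>unsat\<close>, so that rewriting
  unfolds an evaluated system into a propositional formula whose atoms are values of
  \<open>y\<close>.\<close>

fun clause :: "((nat \<times> nat) \<times> nat \<Rightarrow> bool) \<Rightarrow> literal list \<Rightarrow> bool" where
  "clause y [] = False"
| "clause y ((x, b) # c) = ((if b then y x else \<not> y x) \<or> clause y c)"

fun all_clauses :: "((nat \<times> nat) \<times> nat \<Rightarrow> bool) \<Rightarrow> literal list list \<Rightarrow> bool" where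
  "all_clauses y [] = True"
| "all_clauses y (c # cs) = (clause y c \<and> all_clauses y cs)"

definition pairs :: "(nat \<times> nat) list" where
  "pairs = [(i, j). i \<leftarrow> [0..<5], j \<leftarrow> [Suc i..<5]]"

text \<open>Fixes the numbering of the pentagons: those with two triangles, those whose only
  triangle is \<open>i\<close> (\<open>c ! i\<close> of them), and the rest, up to nine.\<close>

definition codes :: "(nat \<times> nat) list \<Rightarrow> nat list \<Rightarrow> nat list list" where
  "codes es c = (let ones = [[i]. i \<leftarrow> [0..<5], _ \<leftarrow> [0..<c ! i]] in
     map (\<lambda>e. [fst e, snd e]) es @ ones @ replicate (9 - length es - length ones) [])"

text \<open>The pentagons with two triangles are edges of a simple graph on the five triangles, which has at
  least six of the ten possible edges; \<open>k\<close> is the number of edges still allowed to be missing and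
  \<open>c\<close> the number of sides of each triangle not yet used.\<close>

fun systems :: "(nat \<times> nat) list \<Rightarrow> nat \<Rightarrow> (nat \<times> nat) list \<Rightarrow> nat list \<Rightarrow> nat list list list" where
  "systems [] k es c = (if sorted c then [codes (rev es) c] else [])"
| "systems (e # fs) k es c = (if k = 0 then [] else systems fs (k - 1) es c) @
     (case c ! fst e of 0 \<Rightarrow> [] | Suc i \<Rightarrow> (case c ! snd e of 0 \<Rightarrow> [] | Suc j \<Rightarrow>
        systems fs k (e # es) (c[fst e := i, snd e := j])))"

fun unsat :: "((nat \<times> nat) \<times> nat \<Rightarrow> bool) \<Rightarrow> literal list list list \<Rightarrow> bool" where
  "unsat y [] = True"
| "unsat y (c # cs) = (\<not> all_clauses y c \<and> unsat y cs)"

text \<open>Each of the five triangles has three sides, and at most 10 - 6 = 4 pairs of triangles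
  lack a common pentagon. Every resulting system is refuted separately.\<close>

lemma systems_unsat: "unsat y (map clauses (systems pairs 4 [] [3, 3, 3, 3, 3]))"
  apply code_simp
  apply (simp only: unsat.simps all_clauses.simps clause.simps if_True if_False simp_thms)
  apply (intro conjI; sat)
  done

lemma all_clauses_iff:
  "all_clauses y cl \<longleftrightarrow> (\<forall>c \<in> set cl. \<exists>z \<in> set c. if snd z then y (fst z) else \<not> y (fst z))"
proof -
  have "clause y c \<longleftrightarrow> (\<exists>z \<in> set c. if snd z then y (fst z) else \<not> y (fst z))" for c
    by (induction y c rule: clause.induct) simp_all
  then show ?thesis by (induction cl) simp_all
qed

lemma sum_of_bool_card: "finite A \<Longrightarrow> (\<Sum>a\<in>A. of_bool (P a)) = card {a \<in> A. P a}"
  by (simp add: of_bool_def sum.If_cases Int_def)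

lemma unsat_iff: "unsat y css \<longleftrightarrow> (\<forall>cs \<in> set css. \<not> all_clauses y cs)"
  by (induction css) auto

lemma omit_filter: "vs \<in> set (omit r xs) \<Longrightarrow> set vs \<subseteq> set xs \<and> length (filter P xs) \<le> length (filter P vs) + r"
  by (induction r xs arbitrary: vs rule: omit.induct) fastforce+

lemma list_update_caps:
  assumes "a < length c" "b < length c" "a \<noteq> b" "c ! a = Suc i" "c ! b = Suc j" "x < length c"
  shows "c ! x = c[a := i, b := j] ! x + (if a = x \<or> b = x then 1 else 0)"
  using assms by (auto simp: nth_list_update)

text \<open>The predicate \<open>r\<close> tells which branch to follow at each pair. Along the way
  \<open>c\<close> holds what is finally left, \<open>d\<close>, plus the sides that the remaining
  chosen pairs will use up, so no needed branch is cut off.\<close>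

lemma systems_complete:
  assumes "\<forall>e \<in> set fs. fst e < 5 \<and> snd e < 5 \<and> fst e \<noteq> snd e" "length c = 5" "length d = 5" "sorted d"
    "\<forall>i < 5. c ! i = d ! i + length (filter (\<lambda>e. fst e = i \<or> snd e = i) (filter r fs))"
    "length (filter (\<lambda>e. \<not> r e) fs) \<le> k"
  shows "codes (rev es @ filter r fs) d \<in> set (systems fs k es c)"
  using assms
proof (induction fs arbitrary: k es c)
  case Nil
  then have "c = d" by (intro nth_equalityI) auto
  then show ?case using Nil by simp
next
  case (Cons e fs)
  show ?case
  proof (cases "r e")
    case True
    have e: "fst e < 5" "snd e < 5" "fst e \<noteq> snd e" using Cons.prems(1) by auto
    have "c ! fst e \<noteq> 0" "c ! snd e \<noteq> 0" using Cons.prems(5) e True by auto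
    then obtain i j where ij: "c ! fst e = Suc i" "c ! snd e = Suc j" by (meson not0_implies_Suc)
    have "codes (rev (e # es) @ filter r fs) d \<in> set (systems fs k (e # es) (c[fst e := i, snd e := j]))"
    proof (rule Cons.IH)
      show "\<forall>x < 5. c[fst e := i, snd e := j] ! x = d ! x + length (filter (\<lambda>e. fst e = x \<or> snd e = x) (filter r fs))"
      proof (intro allI impI)
        fix x :: nat assume x: "x < 5"
        show "c[fst e := i, snd e := j] ! x = d ! x + length (filter (\<lambda>e. fst e = x \<or> snd e = x) (filter r fs))"
          using list_update_caps[of "fst e" c "snd e" i j x] Cons.prems(2,5) e ij x True
          by (auto split: if_splits)
      qed
    qed (use Cons.prems True in auto)
    then show ?thesis using True ij by simp
  next
    case False
    then have k: "k \<noteq> 0" using Cons.prems(6) by auto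
    have "codes (rev es @ filter r fs) d \<in> set (systems fs (k - 1) es c)"
      by (rule Cons.IH) (use Cons.prems False in auto)
    then show ?thesis using False k by simp
  qed
qed

section \<open>Vertex configurations of a map of type [3,5,5,5]\<close>

context semi_equivelar_map
begin

lemma four_cycleE:
  assumes len: "length l = 4" and u: "u \<in> V"
  obtains f0 f1 f2 f3 where "distinct [f0, f1, f2, f3]" "{f \<in> F. u \<in> f} = {f0, f1, f2, f3}"
    "l = [gon f0, gon f1, gon f2, gon f3]"
    "adj f0 f1" "adj f1 f2" "adj f2 f3" "adj f3 f0" "\<not> adj f0 f2" "\<not> adj f1 f3"
proof -
  obtain fs where fs: "distinct fs" "set fs = {f \<in> F. u \<in> f}" "map gon fs = l"
    and st: "\<forall>i < length l. adj (fs ! i) (fs ! (Suc i mod length l))"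
    and un: "\<forall>i < length l. \<forall>j < length l. adj (fs ! i) (fs ! j) \<longrightarrow> j = Suc i mod length l \<or> i = Suc j mod length l"
    by (rule vertex_cycle[OF u])
  have "length fs = 4" using fs(3) len by (metis length_map)
  then obtain f0 f1 f2 f3 where f: "fs = [f0, f1, f2, f3]"
    by (auto simp: length_Suc_conv eval_nat_numeral)
  show ?thesis
  proof (rule that)
    show "distinct [f0, f1, f2, f3]" using fs(1) f by simp
    show "{f \<in> F. u \<in> f} = {f0, f1, f2, f3}" using fs(2) f by simp
    show "l = [gon f0, gon f1, gon f2, gon f3]" using fs(3) f by simp
    note st' = st[unfolded len f, rule_format]
    show "adj f0 f1" "adj f1 f2" "adj f2 f3" "adj f3 f0"
      using st'[of 0] st'[of 1] st'[of 2] st'[of 3] by simp_all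
    note un' = un[unfolded len f, rule_format]
    show "\<not> adj f0 f2" "\<not> adj f1 f3" using un'[of 0 2] un'[of 1 3] by auto
  qed
qed

end

locale map3555 = euler_map +
  assumes l: "l = [3, 5, 5, 5]" and V15: "card V = 15"
begin

definition "Tri = {f \<in> F. gon f = 3}"
definition "Pent = {f \<in> F. gon f = 5}"

lemma card_Tri: "card Tri = 5" and card_Pent: "card Pent = 9"
  using card_gon[of 3] card_gon[of 5] l V15 by (simp_all add: Tri_def Pent_def)

definition cfg :: "'a \<Rightarrow> 'a set \<Rightarrow> 'a set \<Rightarrow> 'a set \<Rightarrow> 'a set \<Rightarrow> bool" where
  "cfg u t p q m \<longleftrightarrow> u \<in> V \<and> t \<in> Tri \<and> p \<in> Pent \<and> q \<in> Pent \<and> m \<in> Pent \<and> distinct [t, p, q, m] \<and>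
     {f \<in> F. u \<in> f} = {t, p, q, m} \<and> adj t p \<and> adj t q \<and> adj p m \<and> adj q m \<and> \<not> adj t m \<and> \<not> adj p q"

lemma cfgD:
  assumes "cfg u t p q m"
  shows "u \<in> V" "t \<in> Tri" "p \<in> Pent" "q \<in> Pent" "m \<in> Pent" "distinct [t, p, q, m]" "{f \<in> F. u \<in> f} = {t, p, q, m}"
    "adj t p" "adj t q" "adj p m" "adj q m" "\<not> adj t m" "\<not> adj p q" "u \<in> t" "u \<in> p" "u \<in> q" "u \<in> m"
proof -
  note c = assms[unfolded cfg_def]
  show "u \<in> V" using c by (elim conjE)
  show "t \<in> Tri" using c by (elim conjE)
  show "p \<in> Pent" using c by (elim conjE)
  show "q \<in> Pent" using c by (elim conjE)
  show "m \<in> Pent" using c by (elim conjE)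
  show "distinct [t, p, q, m]" using c by (elim conjE)
  show eq: "{f \<in> F. u \<in> f} = {t, p, q, m}" using c by (elim conjE)
  show "adj t p" using c by (elim conjE)
  show "adj t q" using c by (elim conjE)
  show "adj p m" using c by (elim conjE)
  show "adj q m" using c by (elim conjE)
  show "\<not> adj t m" using c by (elim conjE)
  show "\<not> adj p q" using c by (elim conjE)
  have "{t, p, q, m} \<subseteq> {f \<in> F. u \<in> f}" unfolding eq ..
  then show "u \<in> t" "u \<in> p" "u \<in> q" "u \<in> m" by simp_all
qed

lemma cfg_swap: assumes "cfg u t p q m" shows "cfg u t q p m"
proof -
  note c = cfgD[OF assms]
  have "{t, p, q, m} = {t, q, p, m}" by blast
  then show ?thesis unfolding cfg_def using c adj_sym[of q p] by auto
qed

lemma cfg_exists: assumes u: "u \<in> V" obtains t p q m where "cfg u t p q m"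
proof -
  obtain f0 f1 f2 f3 where f: "distinct [f0, f1, f2, f3]" "{f \<in> F. u \<in> f} = {f0, f1, f2, f3}"
    "l = [gon f0, gon f1, gon f2, gon f3]"
    "adj f0 f1" "adj f1 f2" "adj f2 f3" "adj f3 f0" "\<not> adj f0 f2" "\<not> adj f1 f3"
    by (rule four_cycleE[OF _ u]) (simp add: l)
  have g: "gon f0 = 3" "gon f1 = 5" "gon f2 = 5" "gon f3 = 5" using f(3) l by simp_all
  have m: "f0 \<in> Tri" "f1 \<in> Pent" "f3 \<in> Pent" "f2 \<in> Pent"
    using g adjD[OF f(4)] adjD[OF f(6)] by (simp_all add: Tri_def Pent_def)
  have d: "distinct [f0, f1, f3, f2]" using f(1) by (simp, blast)
  have e: "{f \<in> F. u \<in> f} = {f0, f1, f3, f2}" unfolding f(2) by blast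
  have "cfg u f0 f1 f3 f2" unfolding cfg_def
    using u m d e f(4,5,8,9) adj_sym[OF f(6)] adj_sym[OF f(7)] by (intro conjI)
  then show ?thesis by (rule that)
qed

lemma Tri_Pent: "t \<in> Tri \<Longrightarrow> p \<in> Pent \<Longrightarrow> t \<noteq> p" "t \<in> Tri \<Longrightarrow> t \<in> F" "p \<in> Pent \<Longrightarrow> p \<in> F"
  by (auto simp: Tri_def Pent_def)

lemma Tri_unique:
  assumes "cfg u t p q m" "t' \<in> Tri" "u \<in> t'" shows "t' = t"
proof -
  have "t' \<in> {t, p, q, m}" unfolding cfgD(7)[OF assms(1), symmetric] using assms Tri_Pent by simp
  then show ?thesis using Tri_Pent(1)[OF assms(2)] cfgD(3-5)[OF assms(1)] by blast
qed

lemma cfg_sides: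
  assumes c: "cfg u t p q m" and a: "adj t p'" "u \<in> p'" shows "p' = p \<or> p' = q"
proof -
  have "p' \<in> {t, p, q, m}" unfolding cfgD(7)[OF c, symmetric] using adjD(2)[OF a(1)] a(2) by simp
  then show ?thesis using a(1) adjD(3)[OF a(1)] cfgD(12)[OF c] by blast
qed

definition touches :: "'a set \<Rightarrow> 'a set \<Rightarrow> bool" where
  "touches p q \<longleftrightarrow> p \<noteq> q \<and> (\<exists>t \<in> Tri. adj t p \<and> adj t q)"

text \<open>Two sides of a triangle have a common corner, and there \<open>p\<close> and
  \<open>q\<close> are the two neighbours of the triangle.\<close>

lemma touches_cfg:
  assumes t: "t \<in> Tri" "adj t p" "adj t q" "p \<noteq> q" obtains u m where "cfg u t p q m"
proof -
  have "(t \<inter> p \<inter> V) \<inter> (t \<inter> q \<inter> V) \<noteq> {}"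
  proof
    assume "(t \<inter> p \<inter> V) \<inter> (t \<inter> q \<inter> V) = {}"
    then have "card (t \<inter> p \<inter> V \<union> t \<inter> q \<inter> V) = 4"
      using adj_card[OF t(2)] adj_card[OF t(3)] fin by (subst card_Un_disjoint) auto
    moreover have "card (t \<inter> p \<inter> V \<union> t \<inter> q \<inter> V) \<le> card (t \<inter> V)" by (rule card_mono) auto
    ultimately show False using t(1) by (simp add: Tri_def gon_def)
  qed
  then obtain u where u: "u \<in> V" "u \<in> t" "u \<in> p" "u \<in> q" by blast
  obtain t' p' q' m where c: "cfg u t' p' q' m" by (rule cfg_exists[OF u(1)])
  have tt: "t = t'" using Tri_unique[OF c t(1) u(2)] .
  have "p = p' \<or> p = q'" "q = p' \<or> q = q'" using cfg_sides[OF c] t u tt by simp_all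
  then have "cfg u t p q m" using c cfg_swap[OF c] t(4) tt by blast
  then show ?thesis by (rule that)
qed

text \<open>The pentagons \<open>p\<close> and \<open>q\<close> are opposite at \<open>u\<close>, so
  they share no edge and cannot have a second common vertex. Hence the pair already names the
  vertex.\<close>

lemma cfg_vertex_unique:
  assumes "cfg u t p q m" "cfg u' t' p q m'" shows "u = u'"
proof (rule ccontr)
  assume ne: "u \<noteq> u'"
  note c = cfgD[OF assms(1)] and c' = cfgD[OF assms(2)]
  have "adj p q" by (rule adjI[OF Tri_Pent(3)[OF c(3)] Tri_Pent(3)[OF c(4)] _ c(15,16) c'(15,16) ne]) (use c(6) in simp)
  then show False using c(13) by simp
qed

lemma cfg_unique:
  assumes "cfg u t p q m" "cfg u t' p q m'" shows "t = t'" "m = m'"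
proof -
  note c = cfgD[OF assms(1)] and c' = cfgD[OF assms(2)]
  show t: "t = t'" by (rule Tri_unique[OF assms(2) c(2) c(14)])
  have "{t, p, q, m} = {t, p, q, m'}" using c(7) c'(7) t by simp
  then have "m \<in> {t, p, q, m'}" by blast
  then show "m = m'" using c(6) by auto
qed

text \<open>Pentagons touching a common triangle are opposite at one of its corners and therefore
  share no edge, but \<open>m\<close> shares one with \<open>p\<close> and with
  \<open>q\<close>.\<close>

lemma cfg_not_touch:
  assumes c: "cfg u t p q m" shows "\<not> touches p m" "\<not> touches q m" "m \<noteq> p" "m \<noteq> q"
proof -
  have "\<not> touches x m" if "adj x m" for x
  proof
    assume "touches x m"
    then obtain t' where t': "t' \<in> Tri" "adj t' x" "adj t' m" "x \<noteq> m" by (auto simp: touches_def)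
    obtain u' m' where "cfg u' t' x m m'" by (rule touches_cfg[OF t'])
    then show False using cfgD(13) that by blast
  qed
  then show "\<not> touches p m" "\<not> touches q m" using cfgD(10,11)[OF c] by blast+
  show "m \<noteq> p" "m \<noteq> q" using cfgD(6)[OF c] by auto
qed

text \<open>The triangle and the pentagon opposite to it share no edge, hence at most one
  vertex.\<close>

lemma cfg_mid_unique:
  assumes "cfg u t p q m" "cfg u' t p' q' m" shows "u = u'"
proof (rule ccontr)
  assume ne: "u \<noteq> u'"
  note c = cfgD[OF assms(1)] and c' = cfgD[OF assms(2)]
  have "adj t m" by (rule adjI[OF Tri_Pent(2)[OF c(2)] Tri_Pent(3)[OF c(5)] _ c(14,17) c'(14,17) ne]) (use c(6) in simp)
  then show False using c(12) by simp
qed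

lemma common_triangle:
  assumes "cfg u t p q m" "t' \<in> Tri" "adj t' p" "adj t' q" shows "t' = t"
proof -
  have "p \<noteq> q" using cfgD(6)[OF assms(1)] by simp
  then obtain u' m' where c: "cfg u' t' p q m'" by (rule touches_cfg[OF assms(2-4)])
  then show ?thesis using cfg_vertex_unique[OF assms(1) c] cfg_unique[of u t p q m t' m'] assms(1) by simp
qed

text \<open>Each triangle adjacent to \<open>m\<close> takes two of its five vertices, disjointly
  since only one triangle passes through a vertex. At the remaining vertices \<open>m\<close> is
  opposite to the triangle.\<close>

lemma card_mid:
  assumes m: "m \<in> Pent"
  shows "card {u. \<exists>t p q. cfg u t p q m} + 2 * card {t \<in> Tri. adj t m} = 5"
proof -
  let ?S = "{u \<in> m \<inter> V. \<exists>t \<in> Tri. u \<in> t \<and> adj t m}"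
  let ?P = "\<lambda>u. \<exists>t \<in> Tri. u \<in> t \<and> adj t m"
  have "2 * card {t \<in> F. adj m t \<and> t \<in> Tri} = (\<Sum>u\<in>m \<inter> V. card {t \<in> F. u \<in> t \<and> adj m t \<and> t \<in> Tri})"
    by (rule sum_adj_at[OF Tri_Pent(3)[OF m], symmetric])
  also have "\<dots> = (\<Sum>u\<in>m \<inter> V. of_bool (?P u))"
  proof (rule sum.cong[OF refl])
    fix u assume u: "u \<in> m \<inter> V"
    then have "u \<in> V" by simp
    then obtain t p q m' where c: "cfg u t p q m'" by (rule cfg_exists)
    show "card {t \<in> F. u \<in> t \<and> adj m t \<and> t \<in> Tri} = of_bool (?P u)"
    proof (cases "adj t m")
      case True
      have "{t \<in> F. u \<in> t \<and> adj m t \<and> t \<in> Tri} = {t}"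
        using Tri_unique[OF c] cfgD(2,14)[OF c] adj_sym[OF True] Tri_Pent(2) by blast
      moreover have "?P u" using True cfgD(2,14)[OF c] by blast
      ultimately show ?thesis by simp
    next
      case False
      have e: "{t \<in> F. u \<in> t \<and> adj m t \<and> t \<in> Tri} = {}"
        using Tri_unique[OF c] False adj_sym by blast
      have "\<not> ?P u" using Tri_unique[OF c] False by blast
      then show ?thesis unfolding e by simp
    qed
  qed
  also have "\<dots> = card ?S" by (rule sum_of_bool_card) simp
  finally have 0: "2 * card {t \<in> F. adj m t \<and> t \<in> Tri} = card ?S" .
  have "{t \<in> F. adj m t \<and> t \<in> Tri} = {t \<in> Tri. adj t m}" using Tri_Pent(2) adj_sym by blast
  then have 1: "2 * card {t \<in> Tri. adj t m} = card ?S" using 0 by simp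
  have "{u. \<exists>t p q. cfg u t p q m} = m \<inter> V - ?S"
  proof
    show "{u. \<exists>t p q. cfg u t p q m} \<subseteq> m \<inter> V - ?S"
    proof
      fix u assume "u \<in> {u. \<exists>t p q. cfg u t p q m}"
      then obtain t p q where c: "cfg u t p q m" by blast
      have "u \<notin> ?S" using Tri_unique[OF c] cfgD(12)[OF c] by blast
      then show "u \<in> m \<inter> V - ?S" using cfgD(1,17)[OF c] by blast
    qed
    show "m \<inter> V - ?S \<subseteq> {u. \<exists>t p q. cfg u t p q m}"
    proof
      fix u assume u: "u \<in> m \<inter> V - ?S"
      then have "u \<in> V" by simp
      then obtain t p q m' where c: "cfg u t p q m'" by (rule cfg_exists)
      have "m \<in> {f \<in> F. u \<in> f}" using u Tri_Pent(3)[OF m] by simp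
      then have "m \<in> {t, p, q, m'}" unfolding cfgD(7)[OF c] .
      moreover have "m \<noteq> t" using Tri_Pent(1)[OF cfgD(2)[OF c] m] by simp
      moreover have "\<not> adj t m" using u cfgD(2,14)[OF c] by blast
      then have "m \<noteq> p" "m \<noteq> q" using cfgD(8,9)[OF c] by auto
      ultimately show "u \<in> {u. \<exists>t p q. cfg u t p q m}" using c by blast
    qed
  qed
  moreover have "card (m \<inter> V - ?S) = card (m \<inter> V) - card ?S"
    by (rule card_Diff_subset) (auto intro: finite_subset[of _ "m \<inter> V"])
  moreover have "card ?S \<le> card (m \<inter> V)" by (rule card_mono) auto
  ultimately show ?thesis using 1 m by (simp add: Pent_def gon_def)
qed

text \<open>At the other end of the edge between \<open>p\<close> and \<open>m\<close> these two are
  adjacent again, so one of them is opposite to the triangle there and the other one is beside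
  it.\<close>

lemma cfg_other_end:
  assumes c: "cfg u t p q m"
  shows "\<exists>u' t' q'. u' \<noteq> u \<and> (cfg u' t' p q' m \<or> cfg u' t' m q' p)"
proof -
  note d = cfgD[OF c]
  obtain u' where u': "u' \<noteq> u" "u' \<in> V" "u' \<in> p" "u' \<in> m"
    by (rule adj_edgeE[OF d(10) d(15) d(17) d(1)])
  obtain t' p' q' m' where c': "cfg u' t' p' q' m'" by (rule cfg_exists[OF u'(2)])
  note d' = cfgD[OF c']
  have "p \<in> {f \<in> F. u' \<in> f}" "m \<in> {f \<in> F. u' \<in> f}" using u' Tri_Pent(3)[OF d(3)] Tri_Pent(3)[OF d(5)] by simp_all
  then have "p \<in> {t', p', q', m'}" "m \<in> {t', p', q', m'}" unfolding d'(7) by simp_all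
  moreover have "p \<noteq> t'" "m \<noteq> t'" using Tri_Pent(1)[OF d'(2)] d(3,5) by blast+
  moreover have "p \<noteq> m" using d(6) by auto
  moreover have "\<not> adj p' q'" "\<not> adj q' p'" using d'(13) adj_sym by blast+
  ultimately have "m = m' \<and> (p = p' \<or> p = q') \<or> p = m' \<and> (m = p' \<or> m = q')" using d(10) by blast
  then show ?thesis using u'(1) c' cfg_swap[OF c'] by blast
qed

end

section \<open>Matching a map of type [3,5,5,5] with one of the clause systems\<close>

lemma set_pairs: "set pairs = {e. fst e < snd e \<and> snd e < 5}"
proof (intro set_eqI)
  fix e :: "nat \<times> nat"
  show "e \<in> set pairs \<longleftrightarrow> e \<in> {e. fst e < snd e \<and> snd e < 5}"
    by (cases e) (simp add: pairs_def image_iff, presburger)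
qed

lemma length_pairs: "length pairs = 10"
  by (simp add: pairs_def upt_rec)

lemma concat_classes:
  assumes "\<And>k. distinct (L k) \<and> set (L k) = {p \<in> A. c p = k}" "distinct K"
  shows "distinct (concat (map L K)) \<and> set (concat (map L K)) = {p \<in> A. c p \<in> set K}"
  using assms(2) by (induction K) (use assms(1) in auto)

lemma filter_ones:
  assumes "i < 5"
  shows "length (filter (\<lambda>k. i \<in> set k) (concat (map (\<lambda>j. replicate (f j) [j]) [0..<5]))) = f i"
proof -
  have u: "[0..<5] = [0, 1, 2, 3, 4 :: nat]" by (simp add: upt_rec)
  have "i = 0 \<or> i = 1 \<or> i = 2 \<or> i = 3 \<or> i = 4" using assms by auto
  then show ?thesis unfolding u by (elim disjE) simp_all
qed

lemma length_ones: "length (concat (map (\<lambda>j. replicate (f j) [j]) [0..<5])) = (\<Sum>i<5. f i)"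
proof -
  have "length (concat (map (\<lambda>j. replicate (f j) [j]) xs)) = (\<Sum>j\<leftarrow>xs. f j)" for xs
    by (induction xs) simp_all
  then show ?thesis by (simp add: sum_list_distinct_conv_sum_set atLeast0LessThan)
qed

lemma sum_degrees:
  assumes "\<forall>e \<in> set es. fst e < n \<and> snd e < n \<and> fst e \<noteq> (snd e :: nat)"
  shows "(\<Sum>i<n. length (filter (\<lambda>e. fst e = i \<or> snd e = i) es)) = 2 * length es"
  using assms
proof (induction es)
  case (Cons e es)
  have s: "{..<n} \<inter> {i. fst e = i \<or> snd e = i} = {fst e, snd e}" using Cons.prems by auto
  have "(\<Sum>i<n. (if fst e = i \<or> snd e = i then 1 else 0 :: nat)) = card {fst e, snd e}"
    by (simp add: sum.If_cases s del: card_insert_disjoint)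
  also have "\<dots> = 2" using Cons.prems by simp
  finally have 2: "(\<Sum>i<n. (if fst e = i \<or> snd e = i then 1 else 0 :: nat)) = 2" .
  have "(\<Sum>i<n. length (filter (\<lambda>e. fst e = i \<or> snd e = i) (e # es))) =
     (\<Sum>i<n. (if fst e = i \<or> snd e = i then 1 else 0) + length (filter (\<lambda>e. fst e = i \<or> snd e = i) es))"
    by (intro sum.cong) auto
  also have "\<dots> = 2 + 2 * length es" unfolding sum.distrib 2 using Cons by simp
  finally show ?case by simp
qed simp

lemma concat_indicator:
  assumes "\<forall>e \<in> set es. n e \<le> (1 :: nat)"
  shows "concat (map (\<lambda>e. replicate (n e) (g e)) es) = map g (filter (\<lambda>e. n e = 1) es)"
  using assms by (induction es) (auto simp: le_Suc_eq)

lemma in_touching: "v \<in> set (touching cs) \<longleftrightarrow> fst v < snd v \<and> snd v < 9 \<and> touch cs (fst v) (snd v)"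
  by (cases v) (auto simp: touching_def)

lemma in_mids: "m \<in> set (mids cs v) \<longleftrightarrow> m < 9 \<and> m \<noteq> fst v \<and> m \<noteq> snd v \<and> \<not> touch cs (fst v) m \<and> \<not> touch cs (snd v) m"
  by (auto simp: mids_def)

lemma in_table: "(v, ms) \<in> set (table cs) \<longleftrightarrow> v \<in> set (touching cs) \<and> ms = mids cs v"
  by (auto simp: table_def)

lemma mid_at_eq: "mid_at (table cs) m = filter (\<lambda>v. m \<in> set (mids cs v)) (touching cs)"
  by (simp add: mid_at_def table_def filter_map o_def)

lemma clauses_cases:
  assumes "c \<in> set (clauses cs)"
  obtains
    v where "v \<in> set (touching cs)" "c = map (\<lambda>m. ((v, m), True)) (mids cs v)"
  | v m n where "v \<in> set (touching cs)" "m \<in> set (mids cs v)" "n \<in> set (mids cs v)" "m < n"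
      "c = [((v, m), False), ((v, n), False)]"
  | v w t m where "v \<in> set (touching cs)" "w \<in> set (touching cs)" "v \<noteq> w"
      "t \<in> set (cs ! fst v)" "t \<in> set (cs ! snd v)" "t \<in> set (cs ! fst w)" "t \<in> set (cs ! snd w)"
      "m \<in> set (mids cs v)" "c = [((v, m), False), ((w, m), False)]"
  | v w m where "m < 9" "length (cs ! m) = 2" "v \<in> set (mid_at (table cs) m)" "w \<in> set (mid_at (table cs) m)" "v \<noteq> w"
      "c = [((v, m), False), ((w, m), False)]"
  | m vs where "m < 9" "cs ! m \<noteq> []" "vs \<in> set (omit (4 - 2 * length (cs ! m)) (mid_at (table cs) m))"
      "c = map (\<lambda>v. ((v, m), True)) vs"
  | v m p where "v \<in> set (touching cs)" "m \<in> set (mids cs v)" "p = fst v \<or> p = snd v"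
      "c = ((v, m), False) # map (\<lambda>w. ((w, m), True)) (filter (\<lambda>w. w \<noteq> v \<and> (fst w = p \<or> snd w = p)) (mid_at (table cs) m)) @
        map (\<lambda>w. ((w, p), True)) (filter (\<lambda>w. fst w = m \<or> snd w = m) (mid_at (table cs) p))"
proof -
  have ats: "map (mid_at (table cs)) [0..<9] ! m = mid_at (table cs) m" if "m < 9" for m
    using that by simp
  have pl: "v \<noteq> w" if "pair_less v w" for v w using that by (auto simp: pair_less_def)
  have lt: "fst v < 9" "snd v < 9" if "v \<in> set (touching cs)" for v using that by (simp_all add: in_touching)
  let ?A = "map (mid_at (table cs)) [0..<9]"
  have "c \<in> set (clauses_of cs (table cs) ?A)" using assms by (simp add: clauses_def clauses_of_table_def)
  then consider
    "c \<in> set (map (\<lambda>(v, ms). map (\<lambda>m. ((v, m), True)) ms) (table cs))" |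
    "c \<in> set [[((v, m), False), ((v, n), False)]. (v, ms) \<leftarrow> table cs, m \<leftarrow> ms, n \<leftarrow> ms, m < n]" |
    "c \<in> set [[((v, m), False), ((w, m), False)]. (v, ms) \<leftarrow> table cs, (w, _) \<leftarrow> table cs, pair_less v w,
        list_ex (\<lambda>t. List.member (cs ! snd v) t \<and> List.member (cs ! fst w) t \<and> List.member (cs ! snd w) t) (cs ! fst v),
        m \<leftarrow> ms]" |
    "c \<in> set [[((v, m), False), ((w, m), False)]. m \<leftarrow> filter (\<lambda>m. length (cs ! m) = 2) [0..<9],
        v \<leftarrow> ?A ! m, w \<leftarrow> ?A ! m, pair_less v w]" |
    "c \<in> set [map (\<lambda>v. ((v, m), True)) vs. m \<leftarrow> filter (\<lambda>m. cs ! m \<noteq> []) [0..<9], vs \<leftarrow> omit (4 - 2 * length (cs ! m)) (?A ! m)]" |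
    "c \<in> set [((v, m), False) # map (\<lambda>w. ((w, m), True)) (filter (\<lambda>w. w \<noteq> v \<and> (fst w = p \<or> snd w = p)) (?A ! m)) @
        map (\<lambda>w. ((w, p), True)) (filter (\<lambda>w. fst w = m \<or> snd w = m) (?A ! p)).
        (v, ms) \<leftarrow> table cs, m \<leftarrow> ms, p \<leftarrow> [fst v, snd v]]"
    unfolding clauses_of_def set_append by blast
  then show thesis
  proof cases
    case 1
    then obtain v ms where "(v, ms) \<in> set (table cs)" "c = map (\<lambda>m. ((v, m), True)) ms" by auto
    then show ?thesis using that(1)[of v] by (simp add: in_table)
  next
    case 2
    then obtain v ms m n where "(v, ms) \<in> set (table cs)" "m \<in> set ms" "n \<in> set ms" "m < n" "c = [((v, m), False), ((v, n), False)]"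
      by (auto split: if_splits)
    then show ?thesis using that(2)[of v m n] by (simp add: in_table)
  next
    case 3
    then obtain v ms w ms' t m where "(v, ms) \<in> set (table cs)" "(w, ms') \<in> set (table cs)" "pair_less v w" "m \<in> set ms"
      "t \<in> set (cs ! fst v)" "t \<in> set (cs ! snd v)" "t \<in> set (cs ! fst w)" "t \<in> set (cs ! snd w)"
      "c = [((v, m), False), ((w, m), False)]"
      by (auto simp: list_ex_iff split: if_splits)
    then show ?thesis using that(3)[of v w t m] pl[of v w] by (simp add: in_table)
  next
    case 4
    then obtain m v w where "m < 9" "length (cs ! m) = 2" "v \<in> set (?A ! m)" "w \<in> set (?A ! m)" "pair_less v w"
      "c = [((v, m), False), ((w, m), False)]"
      by (auto split: if_splits)
    then show ?thesis using that(4)[of m v w] pl[of v w] ats[of m] by simp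
  next
    case 5
    then obtain m vs where "m < 9" "cs ! m \<noteq> []" "vs \<in> set (omit (4 - 2 * length (cs ! m)) (?A ! m))" "c = map (\<lambda>v. ((v, m), True)) vs"
      by auto
    then show ?thesis using that(5)[of m vs] ats[of m] by simp
  next
    case 6
    then obtain v ms m p where v: "(v, ms) \<in> set (table cs)" "m \<in> set ms" "p = fst v \<or> p = snd v"
      and c: "c = ((v, m), False) # map (\<lambda>w. ((w, m), True)) (filter (\<lambda>w. w \<noteq> v \<and> (fst w = p \<or> snd w = p)) (?A ! m)) @
        map (\<lambda>w. ((w, p), True)) (filter (\<lambda>w. fst w = m \<or> snd w = m) (?A ! p))"
    proof -
      let ?G = "\<lambda>v m p. ((v, m), False) # map (\<lambda>w. ((w, m), True)) (filter (\<lambda>w. w \<noteq> v \<and> (fst w = p \<or> snd w = p)) (?A ! m)) @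
        map (\<lambda>w. ((w, p), True)) (filter (\<lambda>w. fst w = m \<or> snd w = m) (?A ! p))"
      have "\<exists>v ms m p. (v, ms) \<in> set (table cs) \<and> m \<in> set ms \<and> (p = fst v \<or> p = snd v) \<and> c = G v m p"
        if "c \<in> set (concat (map (\<lambda>(v, ms). concat (map (\<lambda>m. map (G v m) [fst v, snd v]) ms)) (table cs)))"
        for G :: "nat \<times> nat \<Rightarrow> nat \<Rightarrow> nat \<Rightarrow> (((nat \<times> nat) \<times> nat) \<times> bool) list"
        using that by (fastforce simp: split_beta)
      from this[of ?G, OF 6] show thesis using that by blast
    qed
    have "m < 9" "p < 9" using v lt[of v] by (auto simp: in_table in_mids)
    then show ?thesis using that(6)[of v m p] v c ats[of m] ats[of p] by (simp add: in_table)
  qed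
qed

context map3555
begin

lemma contradiction: False
proof -
  have fT: "finite Tri" and fP: "finite Pent" by (simp_all add: Tri_def Pent_def)
  obtain tl where tl: "set tl = Tri" "distinct tl" using finite_distinct_list[OF fT] by blast
  \<comment> \<open>The number of pentagons touching no triangle but \<open>t\<close>. Numbering the
    triangles by increasing \<open>n1\<close> meets the test \<open>sorted c\<close> in
    \<open>systems\<close>, which breaks the symmetry among the triangles.\<close>
  define n1 where "n1 t = card {p \<in> Pent. {t' \<in> Tri. adj t' p} = {t}}" for t
  define ts where "ts = sort_key n1 tl"
  have ts: "set ts = Tri" "distinct ts" "sorted (map n1 ts)" using tl by (simp_all add: ts_def)
  have lts: "length ts = 5" using distinct_card[OF ts(2)] ts(1) card_Tri by simp
  have T: "ts ! i \<in> Tri" if "i < 5" for i using that lts ts(1) by (metis nth_mem)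
  have Tinj: "ts ! i = ts ! j \<longleftrightarrow> i = j" if "i < 5" "j < 5" for i j
    using that lts ts(2) by (simp add: nth_eq_iff_index_eq)
  have Tsurj: "\<exists>i<5. ts ! i = t" if "t \<in> Tri" for t using that lts ts(1) by (metis in_set_conv_nth)
  define code where "code p = filter (\<lambda>i. adj (ts ! i) p) [0..<5]" for p
  have code: "i \<in> set (code p) \<longleftrightarrow> i < 5 \<and> adj (ts ! i) p" for i p by (auto simp: code_def)
  have dcode: "distinct (code p)" "sorted (code p)" for p by (simp_all add: code_def sorted_wrt_filter)
  have code_img: "{t \<in> Tri. adj t p} = (!) ts ` set (code p)" for p
  proof (intro set_eqI iffI)
    fix t assume t: "t \<in> {t \<in> Tri. adj t p}"
    then obtain i where "i < 5" "ts ! i = t" using Tsurj by blast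
    then show "t \<in> (!) ts ` set (code p)" using t by (intro image_eqI[of _ _ i]) (simp_all add: code)
  next
    fix t assume "t \<in> (!) ts ` set (code p)"
    then obtain i where "i < 5" "adj (ts ! i) p" "t = ts ! i" by (auto simp: code)
    then show "t \<in> {t \<in> Tri. adj t p}" using T[of i] by simp
  qed
  have lcode: "length (code p) = card {t \<in> Tri. adj t p}" for p
  proof -
    have "inj_on ((!) ts) (set (code p))" using Tinj by (auto simp: inj_on_def code)
    then show ?thesis unfolding code_img using distinct_card[OF dcode(1)] by (simp add: card_image)
  qed
  have two: "length (code p) \<le> 2" if "p \<in> Pent" for p using card_mid[OF that] lcode[of p] by linarith
  \<comment> \<open>All possible codes, in the order in which \<open>codes\<close> lists
    them.\<close>
  define K where "K = map (\<lambda>e. [fst e, snd e]) pairs @ map (\<lambda>i. [i]) [0..<5] @ [[]]"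
  have dK: "distinct K" unfolding K_def by code_simp
  have codeK: "code p \<in> set K" if p: "p \<in> Pent" for p
  proof -
    consider "code p = []" | i where "code p = [i]" | i j where "code p = [i, j]"
      using two[OF p] by (cases "code p" rule: remdups_adj.cases) (auto simp: Suc_le_eq)
    then show ?thesis
    proof cases
      case 2
      then show ?thesis using code[of i p] by (auto simp: K_def)
    next
      case 3
      then have "i < 5" "j < 5" "i < j" using code[of i p] code[of j p] dcode[of p] by auto
      then have "(i, j) \<in> set pairs" by (simp add: set_pairs)
      then show ?thesis using 3 by (force simp: K_def)
    qed (simp add: K_def)
  qed
  have "\<forall>k. \<exists>xs. distinct xs \<and> set xs = {p \<in> Pent. code p = k}"
  proof
    fix k
    have "finite {p \<in> Pent. code p = k}" using fP by simp
    from finite_distinct_list[OF this] show "\<exists>xs. distinct xs \<and> set xs = {p \<in> Pent. code p = k}" by blast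
  qed
  then obtain L where L: "\<And>k. distinct (L k) \<and> set (L k) = {p \<in> Pent. code p = k}" by metis
  define n where "n k = length (L k)" for k
  have n: "n k = card {p \<in> Pent. code p = k}" for k using distinct_card[of "L k"] L[of k] by (simp add: n_def)
  \<comment> \<open>With the pentagons sorted by code, the list of codes depends only on the
    multiplicities \<open>n\<close>.\<close>
  define ps where "ps = concat (map L K)"
  have ps: "distinct ps" "set ps = Pent" using concat_classes[OF L dK] codeK by (auto simp: ps_def)
  have lps: "length ps = 9" using distinct_card[OF ps(1)] ps(2) card_Pent by simp
  define cs where "cs = map code ps"
  define d where "d = map (\<lambda>i. n [i]) [0..<5]"
  define r where "r e \<longleftrightarrow> n [fst e, snd e] = 1" for e :: "nat \<times> nat"
  define es where "es = filter r pairs"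
  \<comment> \<open>By \<open>common_triangle\<close> two pentagons cannot share two triangles; so
    the pentagons with two triangles form a simple graph on the triangles.\<close>
  have le1: "n [fst e, snd e] \<le> 1" if e: "e \<in> set pairs" for e
  proof -
    have "p = q" if pq: "p \<in> Pent" "q \<in> Pent" "code p = [fst e, snd e]" "code q = [fst e, snd e]" for p q
    proof (rule ccontr)
      assume ne: "p \<noteq> q"
      have ij: "fst e < 5" "snd e < 5" "fst e \<noteq> snd e" using e by (auto simp: set_pairs)
      have a: "adj (ts ! fst e) p" "adj (ts ! fst e) q" "adj (ts ! snd e) p" "adj (ts ! snd e) q"
        using code[of "fst e" p] code[of "snd e" p] code[of "fst e" q] code[of "snd e" q] pq by simp_all
      obtain u m where "cfg u (ts ! fst e) p q m" by (rule touches_cfg[OF T[OF ij(1)] a(1,2) ne])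
      from common_triangle[OF this T[OF ij(2)] a(3,4)] show False using Tinj ij by simp
    qed
    then have "card {p \<in> Pent. code p = [fst e, snd e]} \<le> Suc 0"
      using fP by (subst card_le_Suc0_iff_eq) auto
    then show ?thesis using n by simp
  qed
  have "cs = concat (map (\<lambda>k. map code (L k)) K)" by (simp add: cs_def ps_def map_concat o_def)
  also have "(\<lambda>k. map code (L k)) = (\<lambda>k. replicate (n k) k)"
  proof
    fix k
    have "\<forall>x \<in> set (map code (L k)). x = k" using L[of k] by auto
    from replicate_length_same[OF this] show "map code (L k) = replicate (n k) k" by (simp add: n_def)
  qed
  finally have cs1: "cs = concat (map (\<lambda>e. replicate (n [fst e, snd e]) [fst e, snd e]) pairs) @
     concat (map (\<lambda>i. replicate (n [i]) [i]) [0..<5]) @ replicate (n []) []"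
    by (simp add: K_def o_def)
  have cs2: "cs = map (\<lambda>e. [fst e, snd e]) es @ concat (map (\<lambda>i. replicate (n [i]) [i]) [0..<5]) @ replicate (n []) []"
    unfolding cs1 using concat_indicator[of pairs "\<lambda>e. n [fst e, snd e]" "\<lambda>e. [fst e, snd e]"] le1
    by (simp add: es_def r_def[abs_def])
  have lcs: "length cs = 9" using lps by (simp add: cs_def)
  have lsum: "length es + (\<Sum>i<5. n [i]) + n [] = 9"
    using lcs unfolding cs2 length_append length_ones by simp
  have ld: "length d = 5" "\<And>i. i < 5 \<Longrightarrow> d ! i = n [i]" by (simp_all add: d_def)
  have cs: "cs = codes es d"
  proof -
    have "concat (map (\<lambda>i. map (\<lambda>_. [i]) [0..<d ! i]) [0..<5]) = concat (map (\<lambda>i. replicate (n [i]) [i]) [0..<5])"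
      by (intro arg_cong[where f = concat] map_cong refl) (simp add: map_replicate_const ld)
    then have c: "codes es d = map (\<lambda>e. [fst e, snd e]) es @ concat (map (\<lambda>i. replicate (n [i]) [i]) [0..<5]) @
      replicate (9 - length es - length (concat (map (\<lambda>i. replicate (n [i]) [i]) [0..<5]))) []"
      by (simp add: codes_def Let_def)
    show ?thesis unfolding cs2 c length_ones using lsum by simp
  qed
  \<comment> \<open>Each of the three sides of a triangle borders a pentagon, which touches this
    triangle only or one more.\<close>
  have deg: "3 = d ! i + length (filter (\<lambda>e. fst e = i \<or> snd e = i) es)" if i: "i < 5" for i
  proof -
    note t = T[OF i]
    have "2 * card {g \<in> F. adj (ts ! i) g} = (\<Sum>u\<in>ts ! i \<inter> V. card {g \<in> F. u \<in> g \<and> adj (ts ! i) g})"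
      using sum_adj_at[OF Tri_Pent(2)[OF t], of "\<lambda>_. True"] by simp
    also have "\<dots> = (\<Sum>u\<in>ts ! i \<inter> V. 2)" using card_adj_at[OF Tri_Pent(2)[OF t]] by (intro sum.cong refl) blast
    also have "\<dots> = 6" using t by (simp add: Tri_def gon_def)
    finally have 3: "card {g \<in> F. adj (ts ! i) g} = 3" by simp
    have "{g \<in> F. adj (ts ! i) g} = {p \<in> Pent. adj (ts ! i) p}"
    proof
      show "{g \<in> F. adj (ts ! i) g} \<subseteq> {p \<in> Pent. adj (ts ! i) p}"
      proof clarify
        fix g assume g: "adj (ts ! i) g"
        have "ts ! i \<inter> g \<inter> V \<noteq> {}" using adj_card[OF g] by (metis card.empty zero_neq_numeral)
        then obtain u where u: "u \<in> ts ! i" "u \<in> g" "u \<in> V" by blast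
        obtain t' p q m where c: "cfg u t' p q m" by (rule cfg_exists[OF u(3)])
        have "ts ! i = t'" using Tri_unique[OF c t u(1)] .
        then have "g = p \<or> g = q" using cfg_sides[OF c _ u(2)] g by simp
        then show "g \<in> Pent" using cfgD(3,4)[OF c] by blast
      qed
    qed (use Tri_Pent(3) in blast)
    then have "3 = card {p \<in> set ps. adj (ts ! i) p}" using 3 ps(2) by simp
    also have "\<dots> = length (filter (\<lambda>p. adj (ts ! i) p) ps)" using distinct_card[OF distinct_filter[OF ps(1)]] by simp
    also have "\<dots> = length (filter (\<lambda>k. i \<in> set k) cs)" using i by (simp add: cs_def filter_map o_def code)
    also have "\<dots> = length (filter (\<lambda>e. i = fst e \<or> i = snd e) es) + n [i]"
      unfolding cs2 filter_append length_append filter_ones[OF i] by (simp add: filter_map o_def)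
    finally show ?thesis using ld(2)[OF i] by (simp add: eq_commute[of i])
  qed
  have es: "\<forall>e \<in> set es. fst e < 5 \<and> snd e < 5 \<and> fst e \<noteq> snd e" by (auto simp: es_def set_pairs)
  \<comment> \<open>The 15 sides are the pentagons with one triangle plus twice those with two. As
    there are nine pentagons in all, at least 15 - 9 = 6 have two triangles.\<close>
  have "(\<Sum>i<(5 :: nat). 3 :: nat) = (\<Sum>i<5. n [i] + length (filter (\<lambda>e. fst e = i \<or> snd e = i) es))"
    by (intro sum.cong refl) (use deg ld in fastforce)
  also have "\<dots> = (\<Sum>i<5. n [i]) + 2 * length es" unfolding sum.distrib sum_degrees[OF es] ..
  finally have "6 \<le> length es" using lsum by simp
  then have k4: "length (filter (\<lambda>e. \<not> r e) pairs) \<le> 4"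
    using sum_length_filter_compl[of r pairs] length_pairs by (simp add: es_def)
  have "d = map n1 ts"
  proof (rule nth_equalityI)
    show "length d = length (map n1 ts)" using ld lts by simp
    fix i assume "i < length d"
    then have i: "i < 5" using ld by simp
    have "code p = [i] \<longleftrightarrow> {t' \<in> Tri. adj t' p} = {ts ! i}" for p
    proof
      assume "{t' \<in> Tri. adj t' p} = {ts ! i}"
      then have "length (code p) = 1" using lcode[of p] by simp
      then obtain j where j: "code p = [j]" by (auto simp: length_Suc_conv)
      then have "j < 5" "adj (ts ! j) p" using code[of j p] by simp_all
      then have "ts ! j = ts ! i" using \<open>{t' \<in> Tri. adj t' p} = {ts ! i}\<close> T by blast
      then show "code p = [i]" using j Tinj \<open>j < 5\<close> i by simp
    qed (simp add: code_img)
    then show "d ! i = map n1 ts ! i" using i lts ld n by (simp add: n1_def)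
  qed
  then have "sorted d" using ts(3) by simp
  then have sys: "cs \<in> set (systems pairs 4 [] [3, 3, 3, 3, 3])"
    using systems_complete[of pairs "[3, 3, 3, 3, 3]" d r 4 "[]"] deg k4 ld
    unfolding cs es_def
    by (auto simp: set_pairs nth_Cons' es_def)

  \<comment> \<open>The truth assignment read off from the map; it satisfies every clause of the
    system found above.\<close>
  define y where "y x = (\<exists>u t. cfg u t (ps ! fst (fst x)) (ps ! snd (fst x)) (ps ! snd x))" for x :: "(nat \<times> nat) \<times> nat"
  have P: "ps ! p \<in> Pent" if "p < 9" for p using that lps ps(2) by (metis nth_mem)
  have Pinj: "ps ! p = ps ! q \<longleftrightarrow> p = q" if "p < 9" "q < 9" for p q
    using that lps ps(1) by (simp add: nth_eq_iff_index_eq)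
  have Psurj: "\<exists>p<9. ps ! p = m" if "m \<in> Pent" for m using that lps ps(2) by (metis in_set_conv_nth)
  have cc: "cs ! p = code (ps ! p)" if "p < 9" for p using that lps by (simp add: cs_def)
  have touch: "touch cs p q \<longleftrightarrow> touches (ps ! p) (ps ! q)" if "p < 9" "q < 9" "p \<noteq> q" for p q
  proof -
    have "touch cs p q \<longleftrightarrow> (\<exists>t \<in> set (code (ps ! p)). t \<in> set (code (ps ! q)))"
      using that by (simp add: touch_def list_ex_iff cc)
    also have "\<dots> \<longleftrightarrow> touches (ps ! p) (ps ! q)"
    proof
      assume "\<exists>t \<in> set (code (ps ! p)). t \<in> set (code (ps ! q))"
      then obtain i where i: "i < 5" "adj (ts ! i) (ps ! p)" "adj (ts ! i) (ps ! q)" using code by blast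
      have "ps ! p \<noteq> ps ! q" using Pinj that by simp
      then show "touches (ps ! p) (ps ! q)" unfolding touches_def using i T[OF i(1)] by blast
    next
      assume "touches (ps ! p) (ps ! q)"
      then obtain t where t: "t \<in> Tri" "adj t (ps ! p)" "adj t (ps ! q)" unfolding touches_def by blast
      obtain i where "i < 5" "ts ! i = t" using Tsurj[OF t(1)] by blast
      then show "\<exists>t \<in> set (code (ps ! p)). t \<in> set (code (ps ! q))"
        using t by (intro bexI[of _ i]) (simp_all add: code)
    qed
    finally show ?thesis .
  qed
  have yD: "v \<in> set (touching cs)" "m \<in> set (mids cs v)"
    if v: "fst v < snd v" "snd v < 9" "m < 9" and yv: "y (v, m)" for v m
  proof -
    obtain u t where c: "cfg u t (ps ! fst v) (ps ! snd v) (ps ! m)" using yv by (auto simp: y_def)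
    have "touches (ps ! fst v) (ps ! snd v)" unfolding touches_def using cfgD(2,6,8,9)[OF c] by auto
    then show "v \<in> set (touching cs)" using v touch by (simp add: in_touching)
    have "m \<noteq> fst v" "m \<noteq> snd v" using cfg_not_touch(3,4)[OF c] by metis+
    then show "m \<in> set (mids cs v)"
      using cfg_not_touch(1,2)[OF c] v touch[of "fst v" m] touch[of "snd v" m] by (simp add: in_mids)
  qed
  have vl: "fst v < 9" "snd v < 9" "fst v < snd v" if "v \<in> set (touching cs)" for v
    using that by (auto simp: in_touching)
  have y_ex: "\<exists>u t m. m < 9 \<and> cfg u t (ps ! fst v) (ps ! snd v) (ps ! m)" if v: "v \<in> set (touching cs)" for v
  proof -
    have "touches (ps ! fst v) (ps ! snd v)" using v vl[OF v] touch by (simp add: in_touching)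
    then obtain t where t: "t \<in> Tri" "adj t (ps ! fst v)" "adj t (ps ! snd v)" "ps ! fst v \<noteq> ps ! snd v"
      by (auto simp: touches_def)
    obtain u m where c: "cfg u t (ps ! fst v) (ps ! snd v) m" by (rule touches_cfg[OF t])
    then show ?thesis using Psurj[OF cfgD(5)[OF c]] by blast
  qed
  have same_v: "v = w" if vw: "v \<in> set (touching cs)" "w \<in> set (touching cs)"
    and c: "cfg u t (ps ! fst v) (ps ! snd v) m" "cfg u t' (ps ! fst w) (ps ! snd w) m'" for u t t' v w m m'
  proof -
    note cv = cfgD[OF c(1)] and cw = cfgD[OF c(2)]
    have tt: "t' = t" by (rule Tri_unique[OF c(1) cw(2,14)])
    have "ps ! fst w = ps ! fst v \<or> ps ! fst w = ps ! snd v" "ps ! snd w = ps ! fst v \<or> ps ! snd w = ps ! snd v"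
      using cfg_sides[OF c(1)] cw tt by simp_all
    then have "fst w = fst v \<or> fst w = snd v" "snd w = fst v \<or> snd w = snd v"
      using Pinj vl[OF vw(1)] vl[OF vw(2)] by simp_all
    then show ?thesis using vl(3)[OF vw(1)] vl(3)[OF vw(2)] by (auto intro: prod_eqI)
  qed
  \<comment> \<open>The vertices counted by \<open>card_mid\<close> inject into the true variables
    with middle \<open>m\<close>, since a vertex is determined by the two pentagons beside the
    triangle.\<close>
  have counts: "5 \<le> length (filter (\<lambda>v. y (v, m)) (mid_at (table cs) m)) + 2 * length (cs ! m)" if m: "m < 9" for m
  proof -
    let ?U = "{u. \<exists>t p q. cfg u t p q (ps ! m)}" and ?L = "filter (\<lambda>v. y (v, m)) (mid_at (table cs) m)"
    have "\<exists>v. v \<in> set ?L \<and> (\<exists>t. cfg u t (ps ! fst v) (ps ! snd v) (ps ! m))" if u: "u \<in> ?U" for u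
    proof -
      obtain t p q where c: "cfg u t p q (ps ! m)" using u by blast
      obtain i where i: "i < 9" "ps ! i = p" using Psurj[OF cfgD(3)[OF c]] by blast
      obtain j where j: "j < 9" "ps ! j = q" using Psurj[OF cfgD(4)[OF c]] by blast
      have "i \<noteq> j" using cfgD(6)[OF c] i j by auto
      then have "\<exists>v. fst v < snd v \<and> snd v < 9 \<and> cfg u t (ps ! fst v) (ps ! snd v) (ps ! m)"
      proof (cases "i < j")
        case True
        then show ?thesis using c i j by (intro exI[of _ "(i, j)"]) simp
      next
        case False
        then show ?thesis using \<open>i \<noteq> j\<close> cfg_swap[OF c] i j by (intro exI[of _ "(j, i)"]) simp
      qed
      then obtain v where v: "fst v < snd v" "snd v < 9" "cfg u t (ps ! fst v) (ps ! snd v) (ps ! m)" by blast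
      then have "y (v, m)" by (auto simp: y_def)
      then have "v \<in> set ?L" using yD[OF v(1,2) m] by (simp add: mid_at_eq)
      then show ?thesis using v(3) by blast
    qed
    then have "\<forall>u\<in>?U. \<exists>v. v \<in> set ?L \<and> (\<exists>t. cfg u t (ps ! fst v) (ps ! snd v) (ps ! m))" by blast
    from bchoice[OF this] obtain g where
      g: "\<forall>u\<in>?U. g u \<in> set ?L \<and> (\<exists>t. cfg u t (ps ! fst (g u)) (ps ! snd (g u)) (ps ! m))" by (rule exE)
    have "inj_on g ?U"
    proof (rule inj_onI)
      fix u u' assume u: "u \<in> ?U" "u' \<in> ?U" "g u = g u'"
      obtain t where t: "cfg u t (ps ! fst (g u)) (ps ! snd (g u)) (ps ! m)" using bspec[OF g u(1)] by blast
      obtain t' where t': "cfg u' t' (ps ! fst (g u)) (ps ! snd (g u)) (ps ! m)"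
        using bspec[OF g u(2)] unfolding u(3)[symmetric] by blast
      show "u = u'" by (rule cfg_vertex_unique[OF t t'])
    qed
    moreover have "g ` ?U \<subseteq> set ?L" using g by blast
    ultimately have "card ?U \<le> card (set ?L)" by (intro card_inj_on_le[of g]) auto
    also have "\<dots> \<le> length ?L" by (rule card_length)
    finally show ?thesis using card_mid[OF P[OF m]] lcode[of "ps ! m"] cc[OF m] by simp
  qed
  have "all_clauses y (clauses cs)"
    unfolding all_clauses_iff
  proof
    fix c assume "c \<in> set (clauses cs)"
    then show "\<exists>z \<in> set c. if snd z then y (fst z) else \<not> y (fst z)"
    proof (cases rule: clauses_cases)
      case (1 v)
      obtain u t m where m: "m < 9" "cfg u t (ps ! fst v) (ps ! snd v) (ps ! m)" using y_ex[OF 1(1)] by blast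
      then have "y (v, m)" by (auto simp: y_def)
      then show ?thesis using yD(2)[of v m] vl[OF 1(1)] m(1) 1(2) by force
    next
      case (2 v m k)
      have "\<not> (y (v, m) \<and> y (v, k))"
      proof
        assume "y (v, m) \<and> y (v, k)"
        then obtain u t u' t' where c: "cfg u t (ps ! fst v) (ps ! snd v) (ps ! m)" "cfg u' t' (ps ! fst v) (ps ! snd v) (ps ! k)"
          by (auto simp: y_def)
        have "u = u'" by (rule cfg_vertex_unique[OF c])
        then have "ps ! m = ps ! k" using cfg_unique(2)[OF c(1)] c(2) by blast
        then show False using Pinj 2 by (simp add: in_mids)
      qed
      then show ?thesis using 2(5) by auto
    next
      case (3 v w i m)
      have "\<not> (y (v, m) \<and> y (w, m))"
      proof
        assume "y (v, m) \<and> y (w, m)"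
        then obtain u t u' t' where c: "cfg u t (ps ! fst v) (ps ! snd v) (ps ! m)" "cfg u' t' (ps ! fst w) (ps ! snd w) (ps ! m)"
          by (auto simp: y_def)
        have i: "i < 5" "adj (ts ! i) (ps ! fst v)" "adj (ts ! i) (ps ! snd v)" "adj (ts ! i) (ps ! fst w)" "adj (ts ! i) (ps ! snd w)"
          using 3(4-7) cc vl[OF 3(1)] vl[OF 3(2)] code by simp_all
        have "ts ! i = t" "ts ! i = t'"
          using common_triangle[OF c(1) T[OF i(1)] i(2,3)] common_triangle[OF c(2) T[OF i(1)] i(4,5)] by simp_all
        then have "u = u'" using cfg_mid_unique[OF c(1)] c(2) by simp
        then show False using same_v[OF 3(1,2) c(1)] c(2) 3(3) by blast
      qed
      then show ?thesis using 3(9) by auto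
    next
      case (4 v w m)
      have vw: "v \<in> set (touching cs)" "w \<in> set (touching cs)" using 4(3,4) by (simp_all add: mid_at_eq)
      have "\<not> (y (v, m) \<and> y (w, m))"
      proof
        assume "y (v, m) \<and> y (w, m)"
        then obtain u t u' t' where c: "cfg u t (ps ! fst v) (ps ! snd v) (ps ! m)" "cfg u' t' (ps ! fst w) (ps ! snd w) (ps ! m)"
          by (auto simp: y_def)
        have "card {t \<in> Tri. adj t (ps ! m)} = 2" using 4(1,2) cc[OF 4(1)] lcode by simp
        then have "card {u. \<exists>t p q. cfg u t p q (ps ! m)} = 1" using card_mid[OF P[OF 4(1)]] by simp
        then obtain z where "{u. \<exists>t p q. cfg u t p q (ps ! m)} = {z}" by (auto simp: card_1_singleton_iff)
        then have "u = z" "u' = z" using c by blast+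
        then show False using same_v[OF vw c(1)] c(2) 4(5) by blast
      qed
      then show ?thesis using 4(6) by auto
    next
      case (5 m vs)
      \<comment> \<open>With k triangles, k being 1 or 2, at least 5 - 2k variables are true, so one
        survives the omission of any 4 - 2k.\<close>
      have "length (cs ! m) \<le> 2" "length (cs ! m) \<ge> 1" using two[OF P[OF 5(1)]] cc[OF 5(1)] 5(2) by (simp_all add: Suc_le_eq)
      moreover have o: "set vs \<subseteq> set (mid_at (table cs) m)"
         "length (filter (\<lambda>v. y (v, m)) (mid_at (table cs) m)) \<le> length (filter (\<lambda>v. y (v, m)) vs) + (4 - 2 * length (cs ! m))"
        using omit_filter[OF 5(3)] by blast+
      ultimately have "length (filter (\<lambda>v. y (v, m)) vs) > 0" using counts[OF 5(1)] by linarith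
      then obtain v where "v \<in> set vs" "y (v, m)" by (auto simp: filter_empty_conv)
      then show ?thesis using 5(4) by force
    next
      case (6 v m p)
      show ?thesis
      proof (cases "y (v, m)")
        case True
        then obtain u t where c0: "cfg u t (ps ! fst v) (ps ! snd v) (ps ! m)" by (auto simp: y_def)
        have m9: "m < 9" using 6(2) by (simp add: in_mids)
        have p9: "p < 9" using 6(3) vl[OF 6(1)] by auto
        obtain q where c: "cfg u t (ps ! p) q (ps ! m)" using c0 cfg_swap[OF c0] 6(3) by blast
        obtain u' t' q' where u': "u' \<noteq> u" "cfg u' t' (ps ! p) q' (ps ! m) \<or> cfg u' t' (ps ! m) q' (ps ! p)"
          using cfg_other_end[OF c] by blast
        have lift: "\<exists>w. fst w < snd w \<and> snd w < 9 \<and> (fst w = a \<or> snd w = a) \<and> cfg u' t' (ps ! fst w) (ps ! snd w) (ps ! b)"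
          if ab: "a < 9" "cfg u' t' (ps ! a) q' (ps ! b)" for a b
        proof -
          obtain j where j: "j < 9" "ps ! j = q'" using Psurj[OF cfgD(4)[OF ab(2)]] by blast
          have "a \<noteq> j" using cfgD(6)[OF ab(2)] j by auto
          then consider "a < j" | "j < a" by linarith
          then show ?thesis
          proof cases
            case 1
            then show ?thesis using ab j by (intro exI[of _ "(a, j)"]) simp
          next
            case 2
            then show ?thesis using cfg_swap[OF ab(2)] ab(1) j by (intro exI[of _ "(j, a)"]) simp
          qed
        qed
        from u'(2) show ?thesis
        proof
          assume "cfg u' t' (ps ! p) q' (ps ! m)"
          from lift[OF p9 this] obtain w where w: "fst w < snd w" "snd w < 9" "fst w = p \<or> snd w = p"
            "cfg u' t' (ps ! fst w) (ps ! snd w) (ps ! m)" by blast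
          have yw: "y (w, m)" using w(4) by (auto simp: y_def)
          have "w \<noteq> v" using cfg_vertex_unique[OF c0] w(4) u'(1) by metis
          then have "((w, m), True) \<in> set c" using yD[OF w(1,2) m9 yw] w(3) unfolding 6(4) by (simp add: mid_at_eq image_iff)
          then show ?thesis using yw by (intro bexI[of _ "((w, m), True)"]) simp_all
        next
          assume "cfg u' t' (ps ! m) q' (ps ! p)"
          from lift[OF m9 this] obtain w where w: "fst w < snd w" "snd w < 9" "fst w = m \<or> snd w = m"
            "cfg u' t' (ps ! fst w) (ps ! snd w) (ps ! p)" by blast
          have yw: "y (w, p)" using w(4) by (auto simp: y_def)
          then have "((w, p), True) \<in> set c" using yD[OF w(1,2) p9 yw] w(3) unfolding 6(4) by (simp add: mid_at_eq image_iff)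
          then show ?thesis using yw by (intro bexI[of _ "((w, p), True)"]) simp_all
        qed
      qed (use 6(4) in simp)
    qed
  qed
  then show False using systems_unsat[of y] sys unfolding unsat_iff by simp
qed

end

subsection \<open>Passing between lists and types\<close>

lemma cyclic_rotate:
  assumes "\<forall>i < length fs. R (fs ! i) (fs ! (Suc i mod length fs))" "i < length fs"
  shows "R (rotate k fs ! i) (rotate k fs ! (Suc i mod length fs))"
proof -
  let ?n = "length fs" and ?j = "(k + i) mod length fs"
  have n: "0 < ?n" using assms(2) by linarith
  have "?j < ?n" by (rule mod_less_divisor[OF n])
  then have "R (fs ! ?j) (fs ! (Suc ?j mod ?n))" using assms(1) by blast
  moreover have "rotate k fs ! (Suc i mod ?n) = fs ! (Suc ?j mod ?n)"
  proof -
    have "Suc i mod ?n < ?n" by (rule mod_less_divisor[OF n])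
    then have "rotate k fs ! (Suc i mod ?n) = fs ! ((k + Suc i mod ?n) mod ?n)" by (rule nth_rotate)
    also have "(k + Suc i mod ?n) mod ?n = Suc ?j mod ?n" by (simp add: mod_simps)
    finally show ?thesis .
  qed
  ultimately show ?thesis using assms(2) by (simp add: nth_rotate)
qed

lemma cyclic_rev:
  assumes "\<forall>i < length fs. R (fs ! i) (fs ! (Suc i mod length fs))" "i < length fs" "symp R"
  shows "R (rev fs ! i) (rev fs ! (Suc i mod length fs))"
proof -
  let ?n = "length fs"
  have "\<exists>j < ?n. rev fs ! (Suc i mod ?n) = fs ! j \<and> rev fs ! i = fs ! (Suc j mod ?n)"
  proof (cases "Suc i < ?n")
    case True
    then have "Suc (?n - Suc (Suc i)) = ?n - Suc i" by simp
    then show ?thesis using True by (intro exI[of _ "?n - Suc (Suc i)"]) (simp add: rev_nth)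
  next
    case False
    then have i: "?n = Suc i" using assms(2) by simp
    then have "rev fs ! 0 = fs ! i" "rev fs ! i = fs ! 0" by (subst rev_nth; simp)+
    then show ?thesis using i by (intro exI[of _ i]) simp
  qed
  then show ?thesis using assms(1,3) by (metis sympD)
qed

context semi_equivelar_map
begin

abbreviation "fan u fs ks \<equiv> distinct fs \<and> set fs = {f \<in> F. u \<in> f} \<and>
  (\<forall>i < length fs. \<exists>e \<in> E. u \<in> e \<and> e \<subseteq> fs ! i \<and> e \<subseteq> fs ! (Suc i mod length fs)) \<and> map gon fs = ks"

lemma semi_equivelar_rotate: "semi_equivelar_map V E F (rotate k l)"
proof
  fix u assume u: "u \<in> V"
  obtain fs where fs: "fan u fs l" using fc[OF u] by blast
  let ?R = "\<lambda>f g. \<exists>e \<in> E. u \<in> e \<and> e \<subseteq> f \<and> e \<subseteq> g"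
  have "fan u (rotate k fs) (rotate k l)"
    using fs cyclic_rotate[of fs ?R] by (simp add: rotate_map[symmetric])
  then show "\<exists>fs. fan u fs (rotate k l)" by blast
qed (use deg V_ne in auto)

lemma semi_equivelar_rev: "semi_equivelar_map V E F (rev l)"
proof
  fix u assume u: "u \<in> V"
  obtain fs where fs: "fan u fs l" using fc[OF u] by blast
  let ?R = "\<lambda>f g. \<exists>e \<in> E. u \<in> e \<and> e \<subseteq> f \<and> e \<subseteq> g"
  have "symp ?R" by (auto intro: sympI)
  then have "fan u (rev fs) (rev l)"
    using fs cyclic_rev[of fs ?R] by (simp add: rev_map[symmetric])
  then show "\<exists>fs. fan u fs (rev l)" by blast
qed (use deg V_ne in auto)

end

text \<open>Solves for the listed representative, so that the locale can be entered again with
  \<open>t\<close> in place of the given reading \<open>l\<close>.\<close>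

lemma dihedral_images_inverse:
  assumes "map int l \<in> set (dihedral_images t)"
  obtains k where "map nat t = rotate k l \<or> map nat t = rev (rotate k l)"
proof -
  obtain k where k: "k < length t" "map int l = rotate k t \<or> map int l = rotate k (rev t)"
    using assms by (auto simp: dihedral_images_def)
  let ?k = "length t - k"
  have nat: "map nat (map int xs) = xs" for xs by (simp add: o_def)
  have inv: "map nat s = rotate ?k l" if "map int l = rotate k s" "length s = length t" for s
  proof -
    have "rotate ?k (map int l) = s" using that k(1) by (simp add: rotate_rotate)
    then have "s = map int (rotate ?k l)" by (simp add: rotate_map)
    then show ?thesis using nat by simp
  qed
  from k(2) show thesis
  proof
    assume "map int l = rotate k t"
    then show thesis using inv that by blast
  next
    assume "map int l = rotate k (rev t)"
    then have "rev (map nat t) = rotate ?k l" using inv[of "rev t"] by (simp add: rev_map)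
    then show thesis using that by (metis rev_rev_ident)
  qed
qed

context euler_map
begin

text \<open>A vertex figure may be read from any face and in either direction, so the map can be
  assumed to have exactly one of the listed forms.\<close>

lemma type_cases: "\<exists>(m, t) \<in> set candidates. m = int (card V) \<and> euler_map V E F (map nat t)"
proof -
  obtain m t where mt: "(m, t) \<in> set candidates" "m = int (card V)" "map int l \<in> set (dihedral_images t)"
    using type_candidate by blast
  obtain k where k: "map nat t = rotate k l \<or> map nat t = rev (rotate k l)"
    by (rule dihedral_images_inverse[OF mt(3)])
  have "semi_equivelar_map V E F (map nat t)"
    using k semi_equivelar_rotate[of k] semi_equivelar_map.semi_equivelar_rev[OF semi_equivelar_rotate[of k]] by metis
  then have "euler_map V E F (map nat t)" by (intro euler_map.intro euler_map_axioms.intro euler)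
  then show ?thesis using mt by blast
qed

lemma allowed_type:
  "\<exists>t \<in> {[(3,1),(4,1),(3,1),(4,2)], [(3,5),(4,1)], [(3,1),(4,1),(8,1),(4,1)], [(4,1),(6,1),(16,1)],
     [(6,2),(8,1)], [(4,3),(5,1)], [(6,2),(7,1)], [(3,1),(4,1),(7,1),(4,1)], [(4,1),(6,1),(14,1)],
     [(4,1),(8,1),(10,1)]}. valid_type t \<and> euler_map V E F (expand_type t)"
proof -
  \<comment> \<open>For \<open>p = 7\<close>, \<open>n = 42\<close> the exponents are 36 and 21; for
    \<open>p = 8\<close>, \<open>n = 24\<close> they are 21 and 12. Each sum is odd.\<close>
  have snub: False if "euler_map V E F [3, 3, 3, 3, p]" "card V = n" "(p, n) = (7, 42) \<or> (p, n) = (8, 24)" for p n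
  proof -
    have p: "3 < p" using that(3) by auto
    have "snub_map V E F [3, 3, 3, 3, p] p" by (rule snub_map.intro[OF that(1) snub_map_axioms.intro[OF refl p]])
    from snub_map.snub_sign[OF this] show False using that(2,3) by (elim disjE) simp_all
  qed
  \<comment> \<open>With 20 vertices the two exponents are 10 and 15, so the signs differ.\<close>
  have snub45: False if "euler_map V E F [3, 3, 4, 3, 5]" "card V = 20"
  proof -
    have "snub45_map V E F [3, 3, 4, 3, 5]" by (rule snub45_map.intro[OF that(1) snub45_map_axioms.intro[OF refl]])
    from snub45_map.snub45_sign[OF this] show False using that(2) by simp
  qed
  have a: False if "euler_map V E F [5, 8, 8]" "card V = 20"
    by (rule map588.contradiction[OF map588.intro[OF that(1) map588_axioms.intro[OF refl that(2)]]])
  have b: False if "euler_map V E F [3, 5, 5, 5]" "card V = 15"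
    by (rule map3555.contradiction[OF map3555.intro[OF that(1) map3555_axioms.intro[OF refl that(2)]]])
  obtain m t where mt: "(m, t) \<in> set candidates" "m = int (card V)" "euler_map V E F (map nat t)"
    using type_cases by blast
  have valid: "valid_type [(3,1),(4,1),(3,1),(4,2)]" "valid_type [(3,5),(4,1)]"
    "valid_type [(3,1),(4,1),(8,1),(4,1)]" "valid_type [(4,1),(6,1),(16,1)]"
    "valid_type [(6,2),(8,1)]" "valid_type [(4,3),(5,1)]" "valid_type [(6,2),(7,1)]"
    "valid_type [(3,1),(4,1),(7,1),(4,1)]" "valid_type [(4,1),(6,1),(14,1)]" "valid_type [(4,1),(8,1),(10,1)]"
    by code_simp+
  have expand: "expand_type [(3,1),(4,1),(3,1),(4,2)] = [3,4,3,4,4]" "expand_type [(3,5),(4,1)] = [3,3,3,3,3,4]"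
    "expand_type [(3,1),(4,1),(8,1),(4,1)] = [3,4,8,4]" "expand_type [(4,1),(6,1),(16,1)] = [4,6,16]"
    "expand_type [(6,2),(8,1)] = [6,6,8]" "expand_type [(4,3),(5,1)] = [4,4,4,5]" "expand_type [(6,2),(7,1)] = [6,6,7]"
    "expand_type [(3,1),(4,1),(7,1),(4,1)] = [3,4,7,4]" "expand_type [(4,1),(6,1),(14,1)] = [4,6,14]"
    "expand_type [(4,1),(8,1),(10,1)] = [4,8,10]"
    by code_simp+
  have "map nat t \<in> {[3,4,3,4,4], [3,3,3,3,3,4], [3,4,8,4], [4,6,16], [6,6,8], [4,4,4,5], [6,6,7], [3,4,7,4], [4,6,14], [4,8,10]}"
    using mt(1) unfolding candidates_def list.set insert_iff empty_iff prod.inject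
    by (elim disjE conjE FalseE) (use mt(2,3) snub[of 7 42] snub[of 8 24] snub45 a b in \<open>simp_all\<close>)
  then show ?thesis using mt(3) unfolding insert_iff empty_iff by (elim disjE FalseE) (simp_all add: valid expand del: One_nat_def)
qed

end

section \<open>From the topological map to its incidence structure and back\<close>

lemma polyhedral_map_euler_map:
  assumes poly: "polyhedral_map X" and chi: "euler_char X = -1" and t: "semi_equivelar_of_type X t"
  shows "euler_map (verts X) (edges X) (faces X) (expand_type t)"
proof -
  note P = poly[unfolded polyhedral_map_def]
  note P1 = P[THEN conjunct1] and P2 = P[THEN conjunct2, THEN conjunct1]
    and P3 = P[THEN conjunct2, THEN conjunct2, THEN conjunct1]
    and P4 = P[THEN conjunct2, THEN conjunct2, THEN conjunct2, THEN conjunct1]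
    and P5 = P[THEN conjunct2, THEN conjunct2, THEN conjunct2, THEN conjunct2]
  interpret surface_map X by (rule surface_map.intro[OF P1 P2])
  have poly: "poly_map (verts X) (edges X) (faces X)"
  proof
    show "finite (verts X)" "finite (edges X)" "finite (faces X)" using cell_simps by blast+
    show "\<exists>a b. a \<noteq> b \<and> e \<inter> verts X = {a, b}" if e: "e \<in> edges X" for e
    proof -
      obtain h where "e \<inter> verts X = {h 0, h 1}" "h 0 \<noteq> h (1 :: real)" by (rule edge_obtain[OF e])
      then show ?thesis by blast
    qed
    show "e = e'" if "e \<in> edges X" "e' \<in> edges X" "e \<inter> verts X = e' \<inter> verts X" for e e'
      using P3 that by blast
    show "card {f \<in> faces X. e \<subseteq> f} = 2" if "e \<in> edges X" for e using card_faces_at_edge[OF that] .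
    show "\<exists>vs es. 3 \<le> length vs \<and> length es = length vs \<and> distinct vs \<and>
       (\<forall>i<length vs. es ! i \<inter> verts X = {vs ! i, vs ! (Suc i mod length vs)}) \<and>
       f \<inter> verts X = set vs \<and> {e \<in> edges X. e \<subseteq> f} = set es" if f: "f \<in> faces X" for f
    proof -
      obtain vs es where c: "graph_cycle X vs es" "f \<inter> verts X = set vs" "{e \<in> edges X. e \<subseteq> f} = set es"
        by (rule face_cycle_exists[OF f])
      show ?thesis
        by (intro exI[of _ vs] exI[of _ es] conjI) (use c in \<open>simp_all add: graph_cycle_def\<close>)
    qed
    show "f \<inter> f' = {} \<or> (\<exists>u \<in> verts X. f \<inter> f' = {u}) \<or> f \<inter> f' \<in> edges X"
      if "f \<in> faces X" "f' \<in> faces X" "f \<noteq> f'" for f f' using P5 that by blast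
  qed
  \<comment> \<open>Without vertices there are no edges and no faces, and the Euler characteristic
    would be 0.\<close>
  have ne: "verts X \<noteq> {}"
  proof
    assume v: "verts X = {}"
    have "edges X = {}" using poly_map.edge_ends[OF poly] v by blast
    moreover have "faces X = {}"
    proof (rule ccontr)
      assume "faces X \<noteq> {}"
      then obtain f where f: "f \<in> faces X" by blast
      obtain vs es where c: "graph_cycle X vs es" "f \<inter> verts X = set vs" by (rule face_cycle_exists[OF f])
      then show False using v by (auto simp: graph_cycle_def)
    qed
    ultimately show False using chi v by (simp add: euler_char_def)
  qed
  have gon: "gonality X = poly_map.gon (verts X)" by (simp add: fun_eq_iff gonality_def poly_map.gon_def[OF poly])
  have "semi_equivelar_map (verts X) (edges X) (faces X) (expand_type t)"
  proof (intro semi_equivelar_map.intro semi_equivelar_map_axioms.intro poly ne)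
    show "3 \<le> card {e \<in> edges X. u \<in> e}" if "u \<in> verts X" for u using P4 that by blast
    show "\<exists>fs. distinct fs \<and> set fs = {f \<in> faces X. u \<in> f} \<and>
        (\<forall>i < length fs. \<exists>e \<in> edges X. u \<in> e \<and> e \<subseteq> fs ! i \<and> e \<subseteq> fs ! (Suc i mod length fs)) \<and>
        map (poly_map.gon (verts X)) fs = expand_type t" if "u \<in> verts X" for u
      using t that unfolding semi_equivelar_of_type_def face_cycle_def gon by simp
  qed
  then show ?thesis
    using chi by (intro euler_map.intro euler_map_axioms.intro) (simp_all add: euler_char_def)
qed

lemma (in euler_map) semi_equivelar_of_typeI:
  assumes "verts X = V" "edges X = E" "faces X = F" "valid_type t" "expand_type t = l"
  shows "semi_equivelar_of_type X t"
proof -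
  have "gonality X = gon" by (simp add: fun_eq_iff gonality_def gon_def assms)
  then show ?thesis using fc assms unfolding semi_equivelar_of_type_def face_cycle_def by simp
qed

theorem theorem1p1:
  fixes X :: "'a cell_map"
  assumes "polyhedral_map X"
    and "euler_char X = - 1"
    and "semi_equivelar X"
  shows "\<exists>t \<in> {[(3,1),(4,1),(3,1),(4,2)],
               [(3,5),(4,1)],
               [(3,1),(4,1),(8,1),(4,1)],
               [(4,1),(6,1),(16,1)],
               [(6,2),(8,1)],
               [(4,3),(5,1)],
               [(6,2),(7,1)],
               [(3,1),(4,1),(7,1),(4,1)],
               [(4,1),(6,1),(14,1)],
               [(4,1),(8,1),(10,1)]}. semi_equivelar_of_type X t"
proof -
  obtain t where "semi_equivelar_of_type X t" using assms(3) unfolding semi_equivelar_def by blast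
  from polyhedral_map_euler_map[OF assms(1,2) this] have "euler_map (verts X) (edges X) (faces X) (expand_type t)" .
  from euler_map.allowed_type[OF this] euler_map.semi_equivelar_of_typeI[OF _ refl refl refl _ refl]
  show ?thesis by (elim bexE conjE) (rule bexI)
qed

end
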